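(* Let $(M,h)$ be a compact Riemannian manifold, $(N,g)$ a Riemannian manifold, and $\delta_1,\delta_2\in\mathbb{R}$. Let $\phi\colon M\to N$ be a smooth interpolating sesqui-harmonic map, i.e. a smooth solution of $$\delta_2\,\Delta\tau(\phi)=\delta_2\, R^N(d\phi(e_\alpha),\tau(\phi))d\phi(e_\alpha)+\delta_1\,\tau(\phi).$$ (1) If $N$ has non-positive sectional curvature $K^N\leq 0$ and $\delta_1,\delta_2$ have the same sign, then $\phi$ is harmonic. (2) If $|d\phi|^2\leq\dfrac{\delta_1}{|R^N|_{L^\infty}\,\delta_2}$ on $M$ and $\delta_1,\delta_2$ have the same sign, then $\phi$ is harmonic.
   Context: $\tau(\phi):=\operatorname{Tr}_h\nabla d\phi$ is the tension field; $\phi$ is harmonic if $\tau(\phi)=0$. $\{e_\alpha\}$ is a local orthonormal frame of $TM$, repeated indices are summed; $\Delta:=\nabla_{e_\alpha}\nabla_{e_\alpha}-\nabla_{\nabla_{e_\alpha}e_\alpha}$ is the connection Laplacian on $\phi^*TN$; $R^N$ is the curvature tensor of $N$ with $R(X,Y)Z=[\nabla_X,\nabla_Y]Z-\nabla_{[X,Y]}Z$ and sectional curvature $K(X,Y)=R(X,Y,Y,X)=\langle R(X,Y)Y,X\rangle$ for orthonormal $X,Y$. "Same sign" means $\delta_1\delta_2>0$. $|R^N|_{L^\infty}$ is the supremum over $N$ of the pointwise norm of the curvature tensor (in (2) it is understood to be finite and positive). *)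

theory Defs
  imports "HOL-Analysis.Analysis"
begin

section \<open>Smooth functions on open subsets of Euclidean space\<close>

primrec C_on :: "nat \<Rightarrow> 'a::euclidean_space set \<Rightarrow> ('a \<Rightarrow> 'b::real_normed_vector) \<Rightarrow> bool" where
  "C_on 0 S f \<longleftrightarrow> continuous_on S f"
| "C_on (Suc k) S f \<longleftrightarrow>
     f differentiable_on S \<and> (\<forall>v. C_on k S (\<lambda>x. frechet_derivative f (at x) v))"

definition smooth_on :: "'a::euclidean_space set \<Rightarrow> ('a \<Rightarrow> 'b::real_normed_vector) \<Rightarrow> bool" where
  "smooth_on S f \<longleftrightarrow> (\<forall>k. C_on k S f)"


section \<open>Smooth manifolds, tangent vectors, Riemannian metrics\<close>

text \<open>
  A chart is a pair of its domain and its coordinate map (only relevant on the domain).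
  A tangent vector is the family of its coordinate representations in all charts of the atlas
  around the foot point; the entries at all other charts are 0, so that equality of tangent
  vectors is equality of functions.
\<close>

type_synonym ('a, 'm) chart = "'a set \<times> ('a \<Rightarrow> real ^ 'm)"
type_synonym ('a, 'm) tvec = "('a, 'm) chart \<Rightarrow> real ^ 'm"

record ('a, 'm) riem =
  top_of :: "'a topology"
  atlas :: "('a, 'm) chart set"
  rmetric :: "'a \<Rightarrow> ('a, 'm) tvec \<Rightarrow> ('a, 'm) tvec \<Rightarrow> real"

abbreviation pts :: "('a, 'm) riem \<Rightarrow> 'a set" where
  "pts M \<equiv> topspace (top_of M)"

definition inv_chart :: "('a, 'm) chart \<Rightarrow> real ^ 'm \<Rightarrow> 'a" where
  "inv_chart c = inv_into (fst c) (snd c)"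

definition smooth_manifold :: "('a, 'm::finite) riem \<Rightarrow> bool" where
  "smooth_manifold M \<longleftrightarrow>
     Hausdorff_space (top_of M) \<and> second_countable (top_of M) \<and>
     (\<Union>c\<in>atlas M. fst c) = pts M \<and>
     (\<forall>c\<in>atlas M. openin (top_of M) (fst c) \<and> open (snd c ` fst c) \<and>
        homeomorphic_map (subtopology (top_of M) (fst c)) (top_of_set (snd c ` fst c)) (snd c)) \<and>
     (\<forall>c\<in>atlas M. \<forall>c'\<in>atlas M.
        smooth_on (snd c ` (fst c \<inter> fst c')) (snd c' \<circ> inv_chart c))"

definition charts_at :: "('a, 'm) riem \<Rightarrow> 'a \<Rightarrow> ('a, 'm) chart set" where
  "charts_at M p = {c \<in> atlas M. p \<in> fst c}"

definition tangent_space :: "('a, 'm::finite) riem \<Rightarrow> 'a \<Rightarrow> ('a, 'm) tvec set" where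
  "tangent_space M p = {v.
     (\<forall>c. c \<notin> charts_at M p \<longrightarrow> v c = 0) \<and>
     (\<forall>c\<in>charts_at M p. \<forall>c'\<in>charts_at M p.
        v c' = frechet_derivative (snd c' \<circ> inv_chart c) (at (snd c p)) (v c))}"

text \<open>The tangent vector at \<open>p\<close> whose representation in the chart \<open>c\<close> is \<open>u\<close>; for
  \<open>u = axis i 1\<close> this is the coordinate vector \<open>\<partial>\<^sub>i\<close> of \<open>c\<close> at \<open>p\<close>.\<close>

definition coord_vec ::
  "('a, 'm::finite) riem \<Rightarrow> ('a, 'm) chart \<Rightarrow> 'a \<Rightarrow> real ^ 'm \<Rightarrow> ('a, 'm) tvec" where
  "coord_vec M c p u = (\<lambda>c'. if c' \<in> charts_at M p
     then frechet_derivative (snd c' \<circ> inv_chart c) (at (snd c p)) u else 0)"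

definition metric_matrix ::
  "('a, 'm::finite) riem \<Rightarrow> ('a, 'm) chart \<Rightarrow> 'a \<Rightarrow> real ^ 'm ^ 'm" where
  "metric_matrix M c p =
     (\<chi> i j. rmetric M p (coord_vec M c p (axis i 1)) (coord_vec M c p (axis j 1)))"

definition riemannian_manifold :: "('a, 'm::finite) riem \<Rightarrow> bool" where
  "riemannian_manifold M \<longleftrightarrow>
     smooth_manifold M \<and>
     (\<forall>p\<in>pts M. \<forall>u\<in>tangent_space M p. \<forall>v\<in>tangent_space M p.
        rmetric M p u v = rmetric M p v u \<and>
        (u \<noteq> (\<lambda>c. 0) \<longrightarrow> rmetric M p u u > 0) \<and>
        (\<forall>w\<in>tangent_space M p. \<forall>a b.
           rmetric M p (\<lambda>c. a *\<^sub>R u c + b *\<^sub>R v c) w = a * rmetric M p u w + b * rmetric M p v w)) \<and>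
     (\<forall>c\<in>atlas M. \<forall>i j. smooth_on (snd c ` fst c) (\<lambda>z. metric_matrix M c (inv_chart c z) $ i $ j))"

definition compact_manifold :: "('a, 'm::finite) riem \<Rightarrow> bool" where
  "compact_manifold M \<longleftrightarrow> compact_space (top_of M)"

definition smooth_map ::
  "('a, 'm::finite) riem \<Rightarrow> ('b, 'n::finite) riem \<Rightarrow> ('a \<Rightarrow> 'b) \<Rightarrow> bool" where
  "smooth_map M N \<phi> \<longleftrightarrow>
     continuous_map (top_of M) (top_of N) \<phi> \<and>
     (\<forall>c\<in>atlas M. \<forall>d\<in>atlas N.
        smooth_on (snd c ` (fst c \<inter> \<phi> -` fst d)) (snd d \<circ> \<phi> \<circ> inv_chart c))"

definition smooth_vector_field_on ::
  "('a, 'm::finite) riem \<Rightarrow> 'a set \<Rightarrow> ('a \<Rightarrow> ('a, 'm) tvec) \<Rightarrow> bool" where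
  "smooth_vector_field_on M W X \<longleftrightarrow>
     (\<forall>p\<in>W. X p \<in> tangent_space M p) \<and>
     (\<forall>c\<in>atlas M. smooth_on (snd c ` (fst c \<inter> W)) (\<lambda>z. X (inv_chart c z) c))"

definition orthonormal_basis_at ::
  "('a, 'm::finite) riem \<Rightarrow> 'a \<Rightarrow> ('m \<Rightarrow> ('a, 'm) tvec) \<Rightarrow> bool" where
  "orthonormal_basis_at M p e \<longleftrightarrow>
     (\<forall>\<alpha>. e \<alpha> \<in> tangent_space M p) \<and>
     (\<forall>\<alpha> \<beta>. rmetric M p (e \<alpha>) (e \<beta>) = (if \<alpha> = \<beta> then 1 else 0))"

definition local_orthonormal_frame ::
  "('a, 'm::finite) riem \<Rightarrow> 'a \<Rightarrow> ('m \<Rightarrow> 'a \<Rightarrow> ('a, 'm) tvec) \<Rightarrow> bool" where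
  "local_orthonormal_frame M p e \<longleftrightarrow>
     (\<exists>W. openin (top_of M) W \<and> p \<in> W \<and>
        (\<forall>\<alpha>. smooth_vector_field_on M W (e \<alpha>)) \<and>
        (\<forall>q\<in>W. orthonormal_basis_at M q (\<lambda>\<alpha>. e \<alpha> q)))"

text \<open>A choice of smooth orthonormal frame around each point. All traces below are independent
  of this choice.\<close>

definition frame :: "('a, 'm::finite) riem \<Rightarrow> 'a \<Rightarrow> 'm \<Rightarrow> 'a \<Rightarrow> ('a, 'm) tvec" where
  "frame M p = (SOME e. local_orthonormal_frame M p e)"


section \<open>Differentiation\<close>

text \<open>\<open>dir_deriv M p v f\<close> is the derivative \<open>v f\<close> of a vector-valued function \<open>f\<close>, smooth near
  \<open>p\<close>, in the direction of the tangent vector \<open>v\<close> at \<open>p\<close>; by the chain rule it does not depend on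
  the chosen chart.\<close>

definition chart_at :: "('a, 'm) riem \<Rightarrow> 'a \<Rightarrow> ('a, 'm) chart" where
  "chart_at M p = (SOME c. c \<in> charts_at M p)"

definition dir_deriv ::
  "('a, 'm::finite) riem \<Rightarrow> 'a \<Rightarrow> ('a, 'm) tvec \<Rightarrow> ('a \<Rightarrow> 'e::real_normed_vector) \<Rightarrow> 'e" where
  "dir_deriv M p v f = (let c = chart_at M p in
     frechet_derivative (f \<circ> inv_chart c) (at (snd c p)) (v c))"

definition differential ::
  "('a, 'm::finite) riem \<Rightarrow> ('b, 'n::finite) riem \<Rightarrow> ('a \<Rightarrow> 'b) \<Rightarrow> 'a \<Rightarrow> ('a, 'm) tvec \<Rightarrow> ('b, 'n) tvec"
  where
  "differential M N \<phi> p v = (\<lambda>d. if d \<in> charts_at N (\<phi> p)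
     then dir_deriv M p v (\<lambda>q. snd d (\<phi> q)) else 0)"


section \<open>Levi-Civita connection and curvature\<close>

definition metric_partial ::
  "('a, 'm::finite) riem \<Rightarrow> ('a, 'm) chart \<Rightarrow> 'a \<Rightarrow> 'm \<Rightarrow> 'm \<Rightarrow> 'm \<Rightarrow> real" where
  "metric_partial M c p l i j =
     frechet_derivative (\<lambda>z. metric_matrix M c (inv_chart c z) $ i $ j) (at (snd c p)) (axis l 1)"

text \<open>\<open>christoffel M c p k i j\<close> is \<open>\<Gamma>\<^sup>k\<^sub>i\<^sub>j\<close> at \<open>p\<close> in the chart \<open>c\<close>.\<close>

definition christoffel ::
  "('a, 'm::finite) riem \<Rightarrow> ('a, 'm) chart \<Rightarrow> 'a \<Rightarrow> 'm \<Rightarrow> 'm \<Rightarrow> 'm \<Rightarrow> real" where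
  "christoffel M c p k i j =
     (1/2) * (\<Sum>l\<in>UNIV. matrix_inv (metric_matrix M c p) $ k $ l *
        (metric_partial M c p i j l + metric_partial M c p j i l - metric_partial M c p l i j))"

definition christoffel_form ::
  "('a, 'm::finite) riem \<Rightarrow> ('a, 'm) chart \<Rightarrow> 'a \<Rightarrow> real ^ 'm \<Rightarrow> real ^ 'm \<Rightarrow> real ^ 'm" where
  "christoffel_form M c p u w =
     (\<chi> k. \<Sum>i\<in>UNIV. \<Sum>j\<in>UNIV. christoffel M c p k i j * (u $ i) * (w $ j))"

text \<open>The covariant derivative \<open>\<nabla>\<^sub>x Y\<close> at \<open>p\<close> of a vector field \<open>Y\<close> in direction of a tangent
  vector \<open>x\<close> at \<open>p\<close>.\<close>

definition nabla ::
  "('a, 'm::finite) riem \<Rightarrow> 'a \<Rightarrow> ('a, 'm) tvec \<Rightarrow> ('a \<Rightarrow> ('a, 'm) tvec) \<Rightarrow> ('a, 'm) tvec" where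
  "nabla M p x Y = (\<lambda>c. if c \<in> charts_at M p
     then dir_deriv M p x (\<lambda>q. Y q c) + christoffel_form M c p (x c) (Y p c) else 0)"

definition nabla_field ::
  "('a, 'm::finite) riem \<Rightarrow> ('a \<Rightarrow> ('a, 'm) tvec) \<Rightarrow> ('a \<Rightarrow> ('a, 'm) tvec) \<Rightarrow> 'a \<Rightarrow> ('a, 'm) tvec" where
  "nabla_field M X Y = (\<lambda>p. nabla M p (X p) Y)"

definition lie_bracket ::
  "('a, 'm::finite) riem \<Rightarrow> ('a \<Rightarrow> ('a, 'm) tvec) \<Rightarrow> ('a \<Rightarrow> ('a, 'm) tvec) \<Rightarrow> 'a \<Rightarrow> ('a, 'm) tvec" where
  "lie_bracket M X Y = (\<lambda>p c. if c \<in> charts_at M p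
     then dir_deriv M p (X p) (\<lambda>q. Y q c) - dir_deriv M p (Y p) (\<lambda>q. X q c) else 0)"

definition curvature_field ::
  "('a, 'm::finite) riem \<Rightarrow> ('a \<Rightarrow> ('a, 'm) tvec) \<Rightarrow> ('a \<Rightarrow> ('a, 'm) tvec) \<Rightarrow>
     ('a \<Rightarrow> ('a, 'm) tvec) \<Rightarrow> 'a \<Rightarrow> ('a, 'm) tvec" where
  "curvature_field M X Y Z = (\<lambda>p c.
     nabla_field M X (nabla_field M Y Z) p c - nabla_field M Y (nabla_field M X Z) p c
       - nabla_field M (lie_bracket M X Y) Z p c)"

text \<open>The curvature tensor \<open>R(x,y)z\<close> at \<open>p\<close>: tangent vectors are extended to vector fields near
  \<open>p\<close> with constant components in a chart; by tensoriality any other extension gives the same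
  result.\<close>

definition extend_vec ::
  "('a, 'm::finite) riem \<Rightarrow> 'a \<Rightarrow> ('a, 'm) tvec \<Rightarrow> 'a \<Rightarrow> ('a, 'm) tvec" where
  "extend_vec M p x = (\<lambda>q. coord_vec M (chart_at M p) q (x (chart_at M p)))"

definition curvature ::
  "('a, 'm::finite) riem \<Rightarrow> 'a \<Rightarrow> ('a, 'm) tvec \<Rightarrow> ('a, 'm) tvec \<Rightarrow> ('a, 'm) tvec \<Rightarrow> ('a, 'm) tvec" where
  "curvature M p x y z =
     curvature_field M (extend_vec M p x) (extend_vec M p y) (extend_vec M p z) p"

text \<open>For orthonormal \<open>x\<close>, \<open>y\<close> the sectional curvature is \<open>\<langle>R(x,y)y, x\<rangle>\<close>.\<close>

definition sectional_curvature ::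
  "('a, 'm::finite) riem \<Rightarrow> 'a \<Rightarrow> ('a, 'm) tvec \<Rightarrow> ('a, 'm) tvec \<Rightarrow> real" where
  "sectional_curvature M p x y = rmetric M p (curvature M p x y y) x"

definition nonpositive_sectional_curvature :: "('a, 'm::finite) riem \<Rightarrow> bool" where
  "nonpositive_sectional_curvature M \<longleftrightarrow>
     (\<forall>p\<in>pts M. \<forall>x\<in>tangent_space M p. \<forall>y\<in>tangent_space M p.
        rmetric M p x x = 1 \<and> rmetric M p y y = 1 \<and> rmetric M p x y = 0 \<longrightarrow>
        sectional_curvature M p x y \<le> 0)"

text \<open>The norm induced by the metric on the bundle of \<open>(0,4)\<close>-tensors, applied to
  \<open>\<langle>R(x,y)z, w\<rangle>\<close>.\<close>

definition curvature_norm :: "('a, 'm::finite) riem \<Rightarrow> 'a \<Rightarrow> real" where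
  "curvature_norm M p = (let e = (\<lambda>\<alpha>. frame M p \<alpha> p) in
     sqrt (\<Sum>i\<in>UNIV. \<Sum>j\<in>UNIV. \<Sum>k\<in>UNIV. \<Sum>l\<in>UNIV.
       (rmetric M p (curvature M p (e i) (e j) (e k)) (e l))\<^sup>2))"

definition curvature_bounded :: "('a, 'm::finite) riem \<Rightarrow> bool" where
  "curvature_bounded M \<longleftrightarrow> bdd_above (curvature_norm M ` pts M)"

text \<open>Only meaningful if \<open>curvature_bounded M\<close> holds and \<open>M\<close> is non-empty.\<close>

definition curvature_sup_norm :: "('a, 'm::finite) riem \<Rightarrow> real" where
  "curvature_sup_norm M = (SUP p\<in>pts M. curvature_norm M p)"


section \<open>Harmonic and interpolating sesqui-harmonic maps\<close>

text \<open>
  A section of \<open>\<phi>\<^sup>*TN\<close> is a map \<open>V\<close> with \<open>V p\<close> a tangent vector of \<open>N\<close> at \<open>\<phi> p\<close>.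
  \<open>nabla_pb M N \<phi> p x V\<close> is its covariant derivative at \<open>p\<close> in direction of the
  tangent vector \<open>x\<close> of \<open>M\<close>, with respect to the pull-back of the Levi-Civita connection of \<open>N\<close>.
\<close>

definition nabla_pb ::
  "('a, 'm::finite) riem \<Rightarrow> ('b, 'n::finite) riem \<Rightarrow> ('a \<Rightarrow> 'b) \<Rightarrow>
     'a \<Rightarrow> ('a, 'm) tvec \<Rightarrow> ('a \<Rightarrow> ('b, 'n) tvec) \<Rightarrow> ('b, 'n) tvec" where
  "nabla_pb M N \<phi> p x V = (\<lambda>d. if d \<in> charts_at N (\<phi> p)
     then dir_deriv M p x (\<lambda>q. V q d)
            + christoffel_form N d (\<phi> p) (differential M N \<phi> p x d) (V p d)
     else 0)"

text \<open>\<open>(\<nabla>\<^sub>X d\<phi>)(Y) = \<nabla>\<^sub>X (d\<phi>(Y)) - d\<phi>(\<nabla>\<^sub>X Y)\<close>\<close>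

definition nabla_d ::
  "('a, 'm::finite) riem \<Rightarrow> ('b, 'n::finite) riem \<Rightarrow> ('a \<Rightarrow> 'b) \<Rightarrow>
     ('a \<Rightarrow> ('a, 'm) tvec) \<Rightarrow> ('a \<Rightarrow> ('a, 'm) tvec) \<Rightarrow> 'a \<Rightarrow> ('b, 'n) tvec" where
  "nabla_d M N \<phi> X Y = (\<lambda>p d.
     nabla_pb M N \<phi> p (X p) (\<lambda>q. differential M N \<phi> q (Y q)) d
       - differential M N \<phi> p (nabla_field M X Y p) d)"

definition tension ::
  "('a, 'm::finite) riem \<Rightarrow> ('b, 'n::finite) riem \<Rightarrow> ('a \<Rightarrow> 'b) \<Rightarrow> 'a \<Rightarrow> ('b, 'n) tvec" where
  "tension M N \<phi> = (\<lambda>p d. let e = frame M p in \<Sum>\<alpha>\<in>UNIV. nabla_d M N \<phi> (e \<alpha>) (e \<alpha>) p d)"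

definition harmonic ::
  "('a, 'm::finite) riem \<Rightarrow> ('b, 'n::finite) riem \<Rightarrow> ('a \<Rightarrow> 'b) \<Rightarrow> bool" where
  "harmonic M N \<phi> \<longleftrightarrow> (\<forall>p\<in>pts M. tension M N \<phi> p = (\<lambda>d. 0))"

definition connection_laplacian ::
  "('a, 'm::finite) riem \<Rightarrow> ('b, 'n::finite) riem \<Rightarrow> ('a \<Rightarrow> 'b) \<Rightarrow>
     ('a \<Rightarrow> ('b, 'n) tvec) \<Rightarrow> 'a \<Rightarrow> ('b, 'n) tvec" where
  "connection_laplacian M N \<phi> V = (\<lambda>p d. let e = frame M p in \<Sum>\<alpha>\<in>UNIV.
     nabla_pb M N \<phi> p (e \<alpha> p) (\<lambda>q. nabla_pb M N \<phi> q (e \<alpha> q) V) d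
       - nabla_pb M N \<phi> p (nabla_field M (e \<alpha>) (e \<alpha>) p) V d)"

text \<open>\<open>R\<^sup>N(d\<phi>(e\<^sub>\<alpha>), V) d\<phi>(e\<^sub>\<alpha>)\<close>, summed over \<open>\<alpha>\<close>\<close>

definition curvature_term ::
  "('a, 'm::finite) riem \<Rightarrow> ('b, 'n::finite) riem \<Rightarrow> ('a \<Rightarrow> 'b) \<Rightarrow>
     ('a \<Rightarrow> ('b, 'n) tvec) \<Rightarrow> 'a \<Rightarrow> ('b, 'n) tvec" where
  "curvature_term M N \<phi> V = (\<lambda>p d. let e = frame M p in \<Sum>\<alpha>\<in>UNIV.
     curvature N (\<phi> p) (differential M N \<phi> p (e \<alpha> p)) (V p) (differential M N \<phi> p (e \<alpha> p)) d)"

definition sesqui_harmonic ::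
  "real \<Rightarrow> real \<Rightarrow> ('a, 'm::finite) riem \<Rightarrow> ('b, 'n::finite) riem \<Rightarrow> ('a \<Rightarrow> 'b) \<Rightarrow> bool" where
  "sesqui_harmonic \<delta>1 \<delta>2 M N \<phi> \<longleftrightarrow>
     smooth_map M N \<phi> \<and>
     (\<forall>p\<in>pts M.
        (\<lambda>d. \<delta>2 *\<^sub>R connection_laplacian M N \<phi> (tension M N \<phi>) p d) =
        (\<lambda>d. \<delta>2 *\<^sub>R curvature_term M N \<phi> (tension M N \<phi>) p d + \<delta>1 *\<^sub>R tension M N \<phi> p d))"

definition energy_density ::
  "('a, 'm::finite) riem \<Rightarrow> ('b, 'n::finite) riem \<Rightarrow> ('a \<Rightarrow> 'b) \<Rightarrow> 'a \<Rightarrow> real" where \<comment> \<open>\<open>|d\<phi>|\<^sup>2\<close>, without a factor 1/2\<close>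
  "energy_density M N \<phi> p = (let e = frame M p in \<Sum>\<alpha>\<in>UNIV.
     rmetric N (\<phi> p) (differential M N \<phi> p (e \<alpha> p)) (differential M N \<phi> p (e \<alpha> p)))"

end

theory Submission
  imports Defs
begin

text \<open>
  Write \<open>\<tau>\<close> for the tension field. The proof looks at a single point, a maximum \<open>p\<close> of \<open>|\<tau>|\<^sup>2\<close> on the
  compact manifold \<open>M\<close>. For a section \<open>V\<close> along \<open>\<phi>\<close> and a vector field \<open>X\<close>, compatibility of the
  pulled back connection with the metric gives
  \<open>X (X |V|\<^sup>2) = 2 \<langle>\<nabla>\<^sub>X \<nabla>\<^sub>X V, V\<rangle> + 2 |\<nabla>\<^sub>X V|\<^sup>2\<close>, so at a maximum of \<open>|V|\<^sup>2\<close> the second derivative test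
  yields \<open>\<langle>\<Delta>V, V\<rangle> \<le> 0\<close> (\<open>connection_laplacian_at_max\<close>). For \<open>V = \<tau>\<close> the equation turns this into
  \<open>\<langle>R(d\<phi>(e\<^sub>\<alpha>), \<tau>) d\<phi>(e\<^sub>\<alpha>), \<tau>\<rangle> + (\<delta>\<^sub>1 / \<delta>\<^sub>2) |\<tau>|\<^sup>2 \<le> 0\<close> at \<open>p\<close>. If the left-hand side is known to be positive
  wherever \<open>\<tau>\<close> does not vanish, then \<open>\<tau>\<close> vanishes at \<open>p\<close> and hence everywhere
  (\<open>sesqui_harmonic_imp_harmonic\<close>).

  For nonpositive sectional curvature the curvature sum is nonnegative
  (\<open>curvature_term_nonneg\<close>). For bounded energy density the point is that \<open>R\<close> is skew in its
  first two arguments, so that \<open>|\<langle>R(x,y)x, y\<rangle>| \<le> |R| |x|\<^sup>2 |y|\<^sup>2 / \<surd>2\<close> (\<open>curvature_norm_bound\<close>). The factor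
  \<open>1 / \<surd>2\<close> keeps the absolute value of the curvature sum strictly below \<open>(\<delta>\<^sub>1 / \<delta>\<^sub>2) |\<tau>|\<^sup>2\<close>
  where \<open>\<tau>\<close> does not vanish, even if the bound on \<open>|d\<phi>|\<^sup>2\<close> is attained.

  The rest is the calculus behind these lines. It is done in coordinates, for a metric on an open
  subset of Euclidean space whose Christoffel symbols are characterised by Koszul's formula. The
  transformation law of the symbols (\<open>christoffel_transformation\<close>) shows that covariant derivatives
  computed in charts are tangent vectors. The tension field is defined with a frame chosen
  separately at each point; traces do not depend on the orthonormal basis (\<open>trace_unique\<close>), so near a
  given point a single smooth frame computes it, and it is a smooth section
  (\<open>smooth_section_tension\<close>).
\<close>

section \<open>Calculus of smooth maps between Euclidean spaces\<close>

abbreviation D :: "('a::real_normed_vector \<Rightarrow> 'b::real_normed_vector) \<Rightarrow> 'a \<Rightarrow> 'a \<Rightarrow> 'b" where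
  "D f x \<equiv> frechet_derivative f (at x)"

lemma D_eqI: "(f has_derivative f') (at x) \<Longrightarrow> D f x = f'"
  by (metis frechet_derivative_at)

lemma D_has_derivative: "f differentiable (at x) \<Longrightarrow> (f has_derivative D f x) (at x)"
  using frechet_derivative_works by blast

lemma D_cong_open:
  assumes "open S" "x \<in> S" "\<And>y. y \<in> S \<Longrightarrow> f y = g y" "f differentiable (at x)"
  shows "D g x = D f x" "g differentiable (at x)"
proof -
  have "(g has_derivative D f x) (at x)"
    using has_derivative_transform_within_open[OF D_has_derivative[OF assms(4)] assms(1,2,3)] .
  then show "D g x = D f x" "g differentiable (at x)"
    by (auto simp: D_eqI differentiable_def)
qed

lemma D_linear: "f differentiable (at x) \<Longrightarrow> linear (D f x)"
  by (rule linear_frechet_derivative)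

lemma D_add:
  assumes "f differentiable (at x)" "g differentiable (at x)"
  shows "D (\<lambda>y. f y + g y) x v = D f x v + D g x v"
  by (subst D_eqI[OF has_derivative_add[OF assms[THEN D_has_derivative]]]) simp

lemma D_sum:
  assumes "\<And>i. i \<in> I \<Longrightarrow> f i differentiable (at x)"
  shows "D (\<lambda>y. \<Sum>i\<in>I. f i y) x v = (\<Sum>i\<in>I. D (f i) x v)"
  by (subst D_eqI[OF has_derivative_sum[where f = f and I = I, OF assms[THEN D_has_derivative]]])
     simp_all

lemma D_bounded_linear:
  assumes "bounded_linear h" "f differentiable (at x)"
  shows "D (\<lambda>y. h (f y)) x v = h (D f x v)"
  by (subst D_eqI[OF bounded_linear.has_derivative[OF assms(1) D_has_derivative[OF assms(2)]]]) simp

lemma D_bounded_bilinear: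
  assumes "bounded_bilinear h" "f differentiable (at x)" "g differentiable (at x)"
  shows "D (\<lambda>y. h (f y) (g y)) x v = h (D f x v) (g x) + h (f x) (D g x v)"
  by (subst D_eqI[OF bounded_bilinear.FDERIV[OF assms(1) assms(2,3)[THEN D_has_derivative]]]) simp

lemma D_chain:
  assumes "f differentiable (at x)" "g differentiable (at (f x))"
  shows "D (\<lambda>y. g (f y)) x v = D g (f x) (D f x v)"
  using D_eqI[OF diff_chain_at[OF assms[THEN D_has_derivative]]] by (simp add: o_def)

lemma differentiable_chain:
  assumes "f differentiable (at x)" "g differentiable (at (f x))"
  shows "(\<lambda>y. g (f y)) differentiable (at x)"
  using diff_chain_at[OF assms[THEN D_has_derivative]] by (auto simp: o_def differentiable_def)

lemma differentiable_bounded_linear: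
  assumes "bounded_linear h" "f differentiable (at x)"
  shows "(\<lambda>y. h (f y)) differentiable (at x)"
  using bounded_linear.has_derivative[OF assms(1) D_has_derivative[OF assms(2)]]
  by (auto simp: differentiable_def)

lemma differentiable_bounded_bilinear:
  assumes "bounded_bilinear h" "f differentiable (at x)" "g differentiable (at x)"
  shows "(\<lambda>y. h (f y) (g y)) differentiable (at x)"
  using bounded_bilinear.FDERIV[OF assms(1) assms(2,3)[THEN D_has_derivative]]
  by (auto simp: differentiable_def)

lemma differentiable_on_open_at:
  "open S \<Longrightarrow> f differentiable_on S \<longleftrightarrow> (\<forall>x\<in>S. f differentiable (at x))"
  by (metis at_within_open differentiable_on_def)

lemma C_on_cong:
  assumes "open S"
  shows "C_on k S f \<Longrightarrow> (\<And>x. x \<in> S \<Longrightarrow> f x = g x) \<Longrightarrow> C_on k S g"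
proof (induction k arbitrary: f g)
  case 0
  then show ?case using continuous_on_cong[of S S f g] by simp
next
  case (Suc k)
  have f: "\<And>x. x \<in> S \<Longrightarrow> f differentiable (at x)"
    using Suc.prems(1) assms by (auto simp: differentiable_on_open_at)
  have *: "D f x = D g x" "g differentiable (at x)" if "x \<in> S" for x
    using D_cong_open[OF assms that Suc.prems(2) f[OF that]] by auto
  have "C_on k S (\<lambda>x. D g x v)" for v
    by (rule Suc.IH[of "\<lambda>x. D f x v"]) (use Suc.prems(1) *(1) in auto)
  then show ?case
    using *(2) by (simp add: differentiable_on_open_at assms)
qed

lemma C_on_antimono_order: "open S \<Longrightarrow> C_on (Suc k) S f \<Longrightarrow> C_on k S f"
proof (induction k arbitrary: f)
  case 0
  then show ?case using differentiable_imp_continuous_on by auto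
qed auto

lemma C_on_subset: "C_on k S f \<Longrightarrow> T \<subseteq> S \<Longrightarrow> C_on k T f"
  by (induction k arbitrary: f)
     (auto intro: continuous_on_subset differentiable_on_subset)

lemma C_on_local:
  "(\<And>x. x \<in> S \<Longrightarrow> \<exists>T. open T \<and> x \<in> T \<and> C_on k T f) \<Longrightarrow> C_on k S f"
proof (induction k arbitrary: f)
  case 0
  have "continuous (at x) f" if "x \<in> S" for x
    using 0[OF that] by (auto simp: continuous_on_eq_continuous_at)
  then show ?case by (simp add: continuous_at_imp_continuous_on)
next
  case (Suc k)
  have "f differentiable (at x)" if "x \<in> S" for x
    using Suc.prems[OF that] by (auto simp: differentiable_on_open_at)
  moreover have "C_on k S (\<lambda>x. D f x v)" for v
    using Suc.prems by (intro Suc.IH) (metis C_on.simps(2))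
  ultimately show ?case by (auto simp: differentiable_on_def differentiable_at_withinI)
qed

lemma C_on_const: "C_on k S (\<lambda>x. c)"
  by (induction k arbitrary: c) auto

lemma C_on_bounded_linear:
  assumes "open S" "bounded_linear h"
  shows "C_on k S f \<Longrightarrow> C_on k S (\<lambda>x. h (f x))"
proof (induction k arbitrary: f)
  case 0
  then show ?case using bounded_linear.continuous_on[OF assms(2)] by simp
next
  case (Suc k)
  have f: "\<And>x. x \<in> S \<Longrightarrow> f differentiable (at x)"
    using Suc.prems(1) assms by (auto simp: differentiable_on_open_at)
  have "C_on k S (\<lambda>x. D (\<lambda>x. h (f x)) x v)" for v
    by (rule C_on_cong[OF assms(1), of _ "\<lambda>x. h (D f x v)"])
       (use Suc f in \<open>auto simp: D_bounded_linear[OF assms(2)]\<close>)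
  then show ?case
    using f differentiable_bounded_linear[OF assms(2)]
    by (auto simp: differentiable_on_open_at assms)
qed

lemma C_on_ident: "open S \<Longrightarrow> C_on k S (\<lambda>x. x)"
  by (cases k) (auto simp: C_on_const differentiable_on_open_at)

lemma C_on_add:
  assumes "open S"
  shows "C_on k S f \<Longrightarrow> C_on k S g \<Longrightarrow> C_on k S (\<lambda>x. f x + g x)"
proof (induction k arbitrary: f g)
  case 0
  then show ?case by (auto intro: continuous_on_add)
next
  case (Suc k)
  have fg: "\<And>x. x \<in> S \<Longrightarrow> f differentiable (at x)" "\<And>x. x \<in> S \<Longrightarrow> g differentiable (at x)"
    using Suc.prems assms by (auto simp: differentiable_on_open_at)
  have "C_on k S (\<lambda>x. D (\<lambda>x. f x + g x) x v)" for v
    by (rule C_on_cong[OF assms(1), of _ "\<lambda>x. D f x v + D g x v"])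
       (use Suc fg in \<open>auto simp: D_add\<close>)
  then show ?case
    using fg by (auto simp: differentiable_on_open_at assms)
qed

lemma C_on_bounded_bilinear:
  assumes "open S" "bounded_bilinear h"
  shows "C_on k S f \<Longrightarrow> C_on k S g \<Longrightarrow> C_on k S (\<lambda>x. h (f x) (g x))"
proof (induction k arbitrary: f g)
  case 0
  then show ?case using bounded_bilinear.continuous_on[OF assms(2)] by simp
next
  case (Suc k)
  have fg: "\<And>x. x \<in> S \<Longrightarrow> f differentiable (at x)" "\<And>x. x \<in> S \<Longrightarrow> g differentiable (at x)"
    using Suc.prems assms by (auto simp: differentiable_on_open_at)
  have "C_on k S (\<lambda>x. D (\<lambda>x. h (f x) (g x)) x v)" for v
  proof (rule C_on_cong[OF assms(1)])
    show "C_on k S (\<lambda>x. h (D f x v) (g x) + h (f x) (D g x v))"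
    proof (intro C_on_add[OF assms(1)] Suc.IH)
      show "C_on k S f" "C_on k S g"
        by (rule C_on_antimono_order[OF assms(1) Suc.prems(1)],
            rule C_on_antimono_order[OF assms(1) Suc.prems(2)])
    qed (use Suc.prems in auto)
  qed (use fg in \<open>auto simp: D_bounded_bilinear[OF assms(2)]\<close>)
  then show ?case
    using differentiable_bounded_bilinear[OF assms(2) fg]
    by (auto simp: differentiable_on_open_at assms)
qed

lemma C_on_sum:
  "open S \<Longrightarrow> (\<And>i. i \<in> I \<Longrightarrow> C_on k S (f i)) \<Longrightarrow> C_on k S (\<lambda>x. \<Sum>i\<in>I. f i x)"
  by (induction I rule: infinite_finite_induct) (auto simp: C_on_const intro!: C_on_add)

lemma linear_sum_Basis:
  fixes f :: "'a::euclidean_space \<Rightarrow> 'b::real_vector"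
  assumes "linear f"
  shows "f v = (\<Sum>b\<in>Basis. (v \<bullet> b) *\<^sub>R f b)"
proof -
  have "f v = f (\<Sum>b\<in>Basis. (v \<bullet> b) *\<^sub>R b)" by (simp add: euclidean_representation)
  then show ?thesis using assms by (simp add: linear_sum linear_cmul)
qed

lemma C_on_compose:
  fixes f :: "'a::euclidean_space \<Rightarrow> 'b::euclidean_space" and g :: "'b \<Rightarrow> 'c::real_normed_vector"
  assumes "open S" "open T" "f ` S \<subseteq> T"
  shows "C_on k S f \<Longrightarrow> C_on k T g \<Longrightarrow> C_on k S (\<lambda>x. g (f x))"
proof (induction k arbitrary: g)
  case 0
  then show ?case using continuous_on_compose2[of T g S f] assms(3) by auto
next
  case (Suc k)
  have f: "\<And>x. x \<in> S \<Longrightarrow> f differentiable (at x)"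
    and g: "\<And>x. x \<in> S \<Longrightarrow> g differentiable (at (f x))"
    using Suc.prems assms by (auto simp: differentiable_on_open_at)
  have "C_on k S (\<lambda>x. D (\<lambda>x. g (f x)) x v)" for v
  proof (rule C_on_cong[OF assms(1)])
    show "C_on k S (\<lambda>x. \<Sum>b\<in>Basis. (D f x v \<bullet> b) *\<^sub>R D g (f x) b)"
    proof (intro C_on_sum[OF assms(1)] C_on_bounded_bilinear[OF assms(1) bounded_bilinear_scaleR]
            C_on_bounded_linear[OF assms(1) bounded_linear_inner_left])
      show "C_on k S (\<lambda>x. D f x v)" using Suc.prems(1) by simp
      show "C_on k S (\<lambda>x. D g (f x) b)" for b
        using Suc.prems(2) by (intro Suc.IH C_on_antimono_order[OF assms(1) Suc.prems(1)]) simp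
    qed
    show "(\<Sum>b\<in>Basis. (D f x v \<bullet> b) *\<^sub>R D g (f x) b) = D (\<lambda>x. g (f x)) x v" if "x \<in> S" for x
      by (simp only: D_chain[OF f g, OF that that] linear_sum_Basis[OF D_linear[OF g[OF that]], symmetric])
  qed
  then show ?case
    using differentiable_chain[OF f g] by (auto simp: differentiable_on_open_at assms)
qed

lemma C_on_powr: "C_on k {0<..} (\<lambda>x::real. x powr a)"
proof (induction k arbitrary: a)
  case 0
  show ?case by (auto intro!: continuous_intros)
next
  case (Suc k)
  have *: "((\<lambda>x. x powr a) has_derivative (\<lambda>v. v *\<^sub>R (a * x powr (a - 1)))) (at x)" if "x > 0" for x
    using has_real_derivative_powr[OF that, of a]
    by (simp add: has_field_derivative_def mult_commute_abs)
  have "C_on k {0<..} (\<lambda>x. D (\<lambda>x. x powr a) x v)" for v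
  proof (rule C_on_cong)
    show "C_on k {0<..} (\<lambda>x. (v * a) *\<^sub>R (x powr (a - 1)))"
      by (rule C_on_bounded_linear[OF _ bounded_linear_scaleR_right]) (use Suc in auto)
  qed (use D_eqI[OF *] in auto)
  then show ?case
    using * by (auto simp: differentiable_on_open_at differentiable_def)
qed

subsection \<open>Smooth maps\<close>

lemma smooth_on_cong:
  "open S \<Longrightarrow> smooth_on S f \<Longrightarrow> (\<And>x. x \<in> S \<Longrightarrow> f x = g x) \<Longrightarrow> smooth_on S g"
  unfolding smooth_on_def by (meson C_on_cong)

lemma smooth_on_subset: "smooth_on S f \<Longrightarrow> T \<subseteq> S \<Longrightarrow> smooth_on T f"
  unfolding smooth_on_def by (meson C_on_subset)

text \<open>Smoothness of a field in a chart is proved on small open sets, on each of which a chart of the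
  target manifold is available.\<close>

lemma smooth_on_local:
  "(\<And>x. x \<in> S \<Longrightarrow> \<exists>T. open T \<and> x \<in> T \<and> smooth_on T f) \<Longrightarrow> smooth_on S f"
  unfolding smooth_on_def by (meson C_on_local)

lemma smooth_on_D: "smooth_on S f \<Longrightarrow> smooth_on S (\<lambda>x. D f x v)"
  unfolding smooth_on_def using C_on.simps(2) by blast

lemma smooth_on_differentiable:
  assumes "smooth_on S f" "open S" "x \<in> S"
  shows "f differentiable (at x)"
proof -
  have "C_on (Suc 0) S f" using assms(1) unfolding smooth_on_def by blast
  then show ?thesis using assms(2,3) by (auto simp: differentiable_on_open_at)
qed

lemma smooth_on_continuous: "smooth_on S f \<Longrightarrow> continuous_on S f"
  unfolding smooth_on_def by (meson C_on.simps(1))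

lemma smooth_on_const: "smooth_on S (\<lambda>x. c)"
  by (simp add: smooth_on_def C_on_const)

lemma smooth_on_ident: "open S \<Longrightarrow> smooth_on S (\<lambda>x. x)"
  by (simp add: smooth_on_def C_on_ident)

lemma smooth_on_bounded_linear:
  "open S \<Longrightarrow> bounded_linear h \<Longrightarrow> smooth_on S f \<Longrightarrow> smooth_on S (\<lambda>x. h (f x))"
  by (simp add: smooth_on_def C_on_bounded_linear)

lemma smooth_on_bounded_bilinear:
  "open S \<Longrightarrow> bounded_bilinear h \<Longrightarrow> smooth_on S f \<Longrightarrow> smooth_on S g \<Longrightarrow>
     smooth_on S (\<lambda>x. h (f x) (g x))"
  by (simp add: smooth_on_def C_on_bounded_bilinear)

lemma smooth_on_add:
  "open S \<Longrightarrow> smooth_on S f \<Longrightarrow> smooth_on S g \<Longrightarrow> smooth_on S (\<lambda>x. f x + g x)"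
  by (simp add: smooth_on_def C_on_add)

lemma smooth_on_minus: "open S \<Longrightarrow> smooth_on S f \<Longrightarrow> smooth_on S (\<lambda>x. - f x)"
  by (rule smooth_on_bounded_linear[OF _ bounded_linear_minus[OF bounded_linear_ident]])

lemma smooth_on_diff:
  "open S \<Longrightarrow> smooth_on S f \<Longrightarrow> smooth_on S g \<Longrightarrow> smooth_on S (\<lambda>x. f x - g x)"
  using smooth_on_add[OF _ _ smooth_on_minus, of S f g] by simp

lemma smooth_on_sum:
  "open S \<Longrightarrow> (\<And>i. i \<in> I \<Longrightarrow> smooth_on S (f i)) \<Longrightarrow> smooth_on S (\<lambda>x. \<Sum>i\<in>I. f i x)"
  by (simp add: smooth_on_def C_on_sum)

lemma smooth_on_compose:
  fixes f :: "'a::euclidean_space \<Rightarrow> 'b::euclidean_space" and g :: "'b \<Rightarrow> 'c::real_normed_vector"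
  shows "open S \<Longrightarrow> open T \<Longrightarrow> f ` S \<subseteq> T \<Longrightarrow> smooth_on S f \<Longrightarrow> smooth_on T g \<Longrightarrow>
    smooth_on S (\<lambda>x. g (f x))"
  by (simp add: smooth_on_def C_on_compose)

text \<open>Covers reciprocals and square roots, in particular the normalisation of vectors.\<close>

lemma smooth_on_powr:
  assumes "open S" "smooth_on S f" "\<And>x. x \<in> S \<Longrightarrow> (f x :: real) > 0"
  shows "smooth_on S (\<lambda>x. f x powr a)"
  by (rule smooth_on_compose[OF assms(1) open_greaterThan _ assms(2)])
     (use assms(3) C_on_powr in \<open>auto simp: smooth_on_def\<close>)

lemma smooth_on_scaleR:
  "open S \<Longrightarrow> smooth_on S f \<Longrightarrow> smooth_on S g \<Longrightarrow> smooth_on S (\<lambda>x. f x *\<^sub>R g x)"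
  by (rule smooth_on_bounded_bilinear[OF _ bounded_bilinear_scaleR])

lemma smooth_on_inner_const: "open S \<Longrightarrow> smooth_on S f \<Longrightarrow> smooth_on S (\<lambda>x. f x \<bullet> b)"
  by (rule smooth_on_bounded_linear[OF _ bounded_linear_inner_left])

subsection \<open>Smooth families of linear maps\<close>

text \<open>Metrics, Christoffel symbols and derivatives of maps are all families of (multi)linear maps
  depending smoothly on a base point. Expanding the linear argument in the standard basis turns
  such a family, evaluated along a map and at a vector-valued function, into a sum of products,
  which gives smoothness and the Leibniz rule for all of them at once. Multilinear families are
  treated one argument at a time.\<close>

lemma smooth_on_linear_family:
  fixes A :: "'u::euclidean_space \<Rightarrow> 'b::euclidean_space \<Rightarrow> 'c::real_normed_vector"
    and \<Phi> :: "'a::euclidean_space \<Rightarrow> 'u"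
  assumes "open S" "open U" "\<Phi> ` S \<subseteq> U" "smooth_on S \<Phi>" "smooth_on S V"
    and "\<And>z. z \<in> U \<Longrightarrow> linear (A z)" "\<And>v. smooth_on U (\<lambda>z. A z v)"
  shows "smooth_on S (\<lambda>x. A (\<Phi> x) (V x))"
proof (rule smooth_on_cong[OF assms(1)])
  show "smooth_on S (\<lambda>x. \<Sum>b\<in>Basis. (V x \<bullet> b) *\<^sub>R A (\<Phi> x) b)"
    by (intro smooth_on_sum smooth_on_scaleR smooth_on_inner_const assms(1,5)
        smooth_on_compose[OF assms(1-4)] assms(7))
  show "(\<Sum>b\<in>Basis. (V x \<bullet> b) *\<^sub>R A (\<Phi> x) b) = A (\<Phi> x) (V x)" if "x \<in> S" for x
    by (rule linear_sum_Basis[symmetric]) (use assms(3,6) that in auto)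
qed

lemma D_linear_family:
  fixes A :: "'u::euclidean_space \<Rightarrow> 'b::euclidean_space \<Rightarrow> 'c::real_normed_vector"
    and \<Phi> :: "'a::euclidean_space \<Rightarrow> 'u"
  assumes "open S" "open U" "\<Phi> ` S \<subseteq> U" "x \<in> S" "\<Phi> differentiable (at x)" "V differentiable (at x)"
    and "\<And>z. z \<in> U \<Longrightarrow> linear (A z)" "\<And>v. (\<lambda>z. A z v) differentiable (at (\<Phi> x))"
  shows "D (\<lambda>x. A (\<Phi> x) (V x)) x u = D (\<lambda>z. A z (V x)) (\<Phi> x) (D \<Phi> x u) + A (\<Phi> x) (D V x u)"
    and "(\<lambda>x. A (\<Phi> x) (V x)) differentiable (at x)"
proof -
  have eq: "(\<Sum>b\<in>Basis. (V y \<bullet> b) *\<^sub>R A (\<Phi> y) b) = A (\<Phi> y) (V y)" if "y \<in> S" for y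
    by (rule linear_sum_Basis[symmetric]) (use assms(3,7) that in auto)
  have d1: "(\<lambda>y. V y \<bullet> b) differentiable (at x)" for b
    by (rule differentiable_bounded_linear[OF bounded_linear_inner_left assms(6)])
  have d2: "(\<lambda>y. A (\<Phi> y) b) differentiable (at x)" for b
    by (rule differentiable_chain[OF assms(5,8)])
  have d3: "(\<lambda>y. (V y \<bullet> b) *\<^sub>R A (\<Phi> y) b) differentiable (at x)" for b
    by (rule differentiable_bounded_bilinear[OF bounded_bilinear_scaleR d1 d2])
  have d: "(\<lambda>y. \<Sum>b\<in>Basis. (V y \<bullet> b) *\<^sub>R A (\<Phi> y) b) differentiable (at x)"
    by (intro differentiable_sum) (use d3 in auto)
  have e1: "D (\<lambda>y. V y \<bullet> b) x u = D V x u \<bullet> b" for b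
    by (rule D_bounded_linear[OF bounded_linear_inner_left assms(6)])
  have e2: "D (\<lambda>y. A (\<Phi> y) b) x u = D (\<lambda>z. A z b) (\<Phi> x) (D \<Phi> x u)" for b
    by (rule D_chain[OF assms(5,8)])
  have "D (\<lambda>y. \<Sum>b\<in>Basis. (V y \<bullet> b) *\<^sub>R A (\<Phi> y) b) x u
      = (\<Sum>b\<in>Basis. (V x \<bullet> b) *\<^sub>R D (\<lambda>z. A z b) (\<Phi> x) (D \<Phi> x u)) + (\<Sum>b\<in>Basis. (D V x u \<bullet> b) *\<^sub>R A (\<Phi> x) b)"
    by (subst D_sum[OF d3])
       (simp_all add: D_bounded_bilinear[OF bounded_bilinear_scaleR d1 d2] e1 e2 sum.distrib add.commute)
  also have "(\<Sum>b\<in>Basis. (D V x u \<bullet> b) *\<^sub>R A (\<Phi> x) b) = A (\<Phi> x) (D V x u)"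
    by (rule linear_sum_Basis[symmetric]) (use assms(3,4,7) in auto)
  also have "(\<Sum>b\<in>Basis. (V x \<bullet> b) *\<^sub>R D (\<lambda>z. A z b) (\<Phi> x) (D \<Phi> x u))
      = D (\<lambda>z. A z (V x)) (\<Phi> x) (D \<Phi> x u)"
  proof -
    have d4: "(\<lambda>z. (V x \<bullet> b) *\<^sub>R A z b) differentiable (at (\<Phi> x))" for b
      by (rule differentiable_bounded_linear[OF bounded_linear_scaleR_right assms(8)])
    have "D (\<lambda>z. A z (V x)) (\<Phi> x) = D (\<lambda>z. \<Sum>b\<in>Basis. (V x \<bullet> b) *\<^sub>R A z b) (\<Phi> x)"
    proof (rule D_cong_open(1)[OF assms(2)])
      show "\<Phi> x \<in> U" using assms(3,4) by blast
      show "(\<Sum>b\<in>Basis. (V x \<bullet> b) *\<^sub>R A z b) = A z (V x)" if "z \<in> U" for z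
        by (rule linear_sum_Basis[OF assms(7)[OF that], symmetric])
    qed (use d4 in auto)
    moreover have "D (\<lambda>z. \<Sum>b\<in>Basis. (V x \<bullet> b) *\<^sub>R A z b) (\<Phi> x) (D \<Phi> x u)
        = (\<Sum>b\<in>Basis. (V x \<bullet> b) *\<^sub>R D (\<lambda>z. A z b) (\<Phi> x) (D \<Phi> x u))"
      by (subst D_sum[OF d4])
         (simp_all add: D_bounded_linear[OF bounded_linear_scaleR_right assms(8)])
    ultimately show ?thesis by simp
  qed
  finally show "D (\<lambda>x. A (\<Phi> x) (V x)) x u = D (\<lambda>z. A z (V x)) (\<Phi> x) (D \<Phi> x u) + A (\<Phi> x) (D V x u)"
    using D_cong_open(1)[OF assms(1,4) eq d] by simp
  show "(\<lambda>x. A (\<Phi> x) (V x)) differentiable (at x)"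
    using D_cong_open(2)[OF assms(1,4) eq d] .
qed

lemma linear_D_family:
  assumes "open U" "\<And>z. z \<in> U \<Longrightarrow> linear (A z)" "\<And>v. (\<lambda>z. A z v) differentiable (at z)" "z \<in> U"
  shows "linear (\<lambda>v. D (\<lambda>z. A z v) z u)"
proof (rule linearI)
  fix v w c
  have "D (\<lambda>z. A z (v + w)) z = D (\<lambda>z. A z v + A z w) z"
    by (rule D_cong_open(1)[OF assms(1,4)]) (use assms(2,3) in \<open>auto simp: linear_add\<close>)
  then show "D (\<lambda>z. A z (v + w)) z u = D (\<lambda>z. A z v) z u + D (\<lambda>z. A z w) z u"
    by (simp add: D_add assms(3))
  have "D (\<lambda>z. A z (c *\<^sub>R v)) z = D (\<lambda>z. c *\<^sub>R A z v) z"
    by (rule D_cong_open(1)[OF assms(1,4)])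
       (use assms(2,3) differentiable_bounded_linear[OF bounded_linear_scaleR_right] in \<open>auto simp: linear_cmul\<close>)
  then show "D (\<lambda>z. A z (c *\<^sub>R v)) z u = c *\<^sub>R D (\<lambda>z. A z v) z u"
    by (simp add: D_bounded_linear[OF bounded_linear_scaleR_right] assms(3))
qed

lemma smooth_on_bilinear_family:
  fixes A :: "'u::euclidean_space \<Rightarrow> 'b::euclidean_space \<Rightarrow> 'c::euclidean_space \<Rightarrow> 'd::real_normed_vector"
    and \<Phi> :: "'a::euclidean_space \<Rightarrow> 'u"
  assumes "open S" "open U" "\<Phi> ` S \<subseteq> U" "smooth_on S \<Phi>" "smooth_on S V" "smooth_on S W"
    and "\<And>z v. z \<in> U \<Longrightarrow> linear (A z v)" "\<And>z w. z \<in> U \<Longrightarrow> linear (\<lambda>v. A z v w)"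
    and "\<And>v w. smooth_on U (\<lambda>z. A z v w)"
  shows "smooth_on S (\<lambda>x. A (\<Phi> x) (V x) (W x))"
proof -
  have "smooth_on S (\<lambda>x. A (\<Phi> x) v (W x))" for v
    by (rule smooth_on_linear_family[OF assms(1-4,6)]) (use assms(7,9) in auto)
  then show ?thesis
    by (intro smooth_on_linear_family[OF assms(1,1) _ smooth_on_ident[OF assms(1)] assms(5),
          of "\<lambda>x v. A (\<Phi> x) v (W x)"])
       (use assms(3,8) in auto)
qed

lemma D_bilinear_family:
  fixes A :: "'u::euclidean_space \<Rightarrow> 'b::euclidean_space \<Rightarrow> 'c::euclidean_space \<Rightarrow> 'd::real_normed_vector"
    and \<Phi> :: "'a::euclidean_space \<Rightarrow> 'u"
  assumes "open S" "open U" "\<Phi> ` S \<subseteq> U" "smooth_on S \<Phi>" "smooth_on S V" "smooth_on S W"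
    and "\<And>z v. z \<in> U \<Longrightarrow> linear (A z v)" "\<And>z w. z \<in> U \<Longrightarrow> linear (\<lambda>v. A z v w)"
    and "\<And>v w. smooth_on U (\<lambda>z. A z v w)" and x: "x \<in> S"
  shows "D (\<lambda>x. A (\<Phi> x) (V x) (W x)) x u = D (\<lambda>z. A z (V x) (W x)) (\<Phi> x) (D \<Phi> x u)
    + A (\<Phi> x) (D V x u) (W x) + A (\<Phi> x) (V x) (D W x u)"
proof -
  note diff = smooth_on_differentiable[OF _ assms(1) x]
  have 0: "(\<lambda>z. A z v w) differentiable (at (\<Phi> x))" for v w
    by (rule smooth_on_differentiable[OF assms(9,2)]) (use assms(3) x in auto)
  have 1: "D (\<lambda>y. A (\<Phi> y) v (W y)) x u
      = D (\<lambda>z. A z v (W x)) (\<Phi> x) (D \<Phi> x u) + A (\<Phi> x) v (D W x u)"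
    "(\<lambda>y. A (\<Phi> y) v (W y)) differentiable (at x)" for v
    by (rule D_linear_family[OF assms(1-3) x diff diff, of W "\<lambda>z. A z v", OF assms(4,6) assms(7) 0];
        assumption)+
  have "D (\<lambda>x. A (\<Phi> x) (V x) (W x)) x u
      = D (\<lambda>y. A (\<Phi> y) (V x) (W y)) x (D (\<lambda>y. y) x u) + A (\<Phi> x) (D V x u) (W x)"
    by (rule D_linear_family(1)[OF assms(1) assms(1) _ x _ diff[OF assms(5)],
          of "\<lambda>y. y" "\<lambda>y v. A (\<Phi> y) v (W y)"])
       (use assms(3,8) 1(2) in auto)
  then show ?thesis using 1(1) by simp
qed

lemma smooth_on_D_arg:
  fixes f :: "'a::euclidean_space \<Rightarrow> 'b::real_normed_vector"
  assumes "open S" "smooth_on S f" "smooth_on S v"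
  shows "smooth_on S (\<lambda>x. D f x (v x))"
  by (rule smooth_on_linear_family[OF assms(1) assms(1) _ smooth_on_ident[OF assms(1)] assms(3)])
     (use assms in \<open>auto intro: smooth_on_D D_linear smooth_on_differentiable\<close>)

subsection \<open>Symmetry of second derivatives and the second derivative test\<close>

lemma D_line:
  assumes "open S" "smooth_on S f" "x + t *\<^sub>R u \<in> S"
  shows "((\<lambda>t. f (x + t *\<^sub>R u)) has_vector_derivative D f (x + t *\<^sub>R u) u) (at t)"
proof -
  have f: "(f has_derivative D f (x + t *\<^sub>R u)) (at (x + t *\<^sub>R u))"
    by (rule D_has_derivative[OF smooth_on_differentiable[OF assms(2,1,3)]])
  have "((\<lambda>t. x + t *\<^sub>R u) has_derivative (\<lambda>s. s *\<^sub>R u)) (at t)"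
    by (auto intro!: derivative_eq_intros)
  from diff_chain_at[OF this f] show ?thesis
    using has_derivative_linear[OF f] by (simp add: has_vector_derivative_def o_def linear_cmul)
qed

text \<open>Two applications of the mean value theorem, first in direction \<open>u\<close> and then in direction \<open>v\<close>.\<close>

lemma mixed_difference_mean_value:
  fixes f :: "'a::euclidean_space \<Rightarrow> real"
  assumes S: "open S" "smooth_on S f" and t: "t > 0"
    and inS: "\<And>a b. 0 \<le> a \<Longrightarrow> a \<le> t \<Longrightarrow> 0 \<le> b \<Longrightarrow> b \<le> t \<Longrightarrow> x + a *\<^sub>R u + b *\<^sub>R v \<in> S"
  obtains a b where "0 \<le> a" "a \<le> t" "0 \<le> b" "b \<le> t"
    "f (x + t *\<^sub>R u + t *\<^sub>R v) - f (x + t *\<^sub>R u) - f (x + t *\<^sub>R v) + f x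
      = t * (t * D (\<lambda>y. D f y u) (x + a *\<^sub>R u + b *\<^sub>R v) v)"
proof -
  define h where "h a = f (x + t *\<^sub>R v + a *\<^sub>R u) - f (x + a *\<^sub>R u)" for a
  have dh: "(h has_vector_derivative
      (D f (x + t *\<^sub>R v + a *\<^sub>R u) u - D f (x + a *\<^sub>R u) u)) (at a)" if "0 \<le> a" "a \<le> t" for a
    unfolding h_def
    by (intro has_vector_derivative_diff D_line[OF S])
       (use inS[of a t] inS[of a 0] that t in \<open>auto simp: algebra_simps\<close>)
  obtain a where a: "0 < a" "a < t"
    "h t - h 0 = (t - 0) * (D f (x + t *\<^sub>R v + a *\<^sub>R u) u - D f (x + a *\<^sub>R u) u)"
    using MVT2[OF t, of h "\<lambda>a. D f (x + t *\<^sub>R v + a *\<^sub>R u) u - D f (x + a *\<^sub>R u) u"] dh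
    by (auto simp: has_real_derivative_iff_has_vector_derivative)
  have dk: "((\<lambda>b. D f (x + a *\<^sub>R u + b *\<^sub>R v) u) has_vector_derivative
      D (\<lambda>y. D f y u) (x + a *\<^sub>R u + b *\<^sub>R v) v) (at b)" if "0 \<le> b" "b \<le> t" for b
    by (rule D_line[OF S(1) smooth_on_D[OF S(2)]]) (use inS[of a b] a that in auto)
  obtain b where b: "0 < b" "b < t"
    "D f (x + a *\<^sub>R u + t *\<^sub>R v) u - D f (x + a *\<^sub>R u + 0 *\<^sub>R v) u
      = (t - 0) * D (\<lambda>y. D f y u) (x + a *\<^sub>R u + b *\<^sub>R v) v"
    using MVT2[OF t, of "\<lambda>b. D f (x + a *\<^sub>R u + b *\<^sub>R v) u"
        "\<lambda>b. D (\<lambda>y. D f y u) (x + a *\<^sub>R u + b *\<^sub>R v) v"] dk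
    by (auto simp: has_real_derivative_iff_has_vector_derivative)
  show thesis
    by (rule that[of a b]) (use a b in \<open>auto simp: h_def algebra_simps\<close>)
qed

text \<open>Both mixed derivatives at a point are limits of the same second difference quotient
  \<open>(f (x + tu + tv) - f (x + tu) - f (x + tv) + f x) / t\<^sup>2\<close>, which by the mean value theorem equals
  either mixed derivative at some nearby point.\<close>

lemma D_commute_real:
  fixes f :: "'a::euclidean_space \<Rightarrow> real"
  assumes S: "open S" "smooth_on S f" "x \<in> S"
  shows "D (\<lambda>y. D f y u) x v = D (\<lambda>y. D f y v) x u"
proof (rule ccontr)
  define P where "P u v y = D (\<lambda>y. D f y u) y v" for u v y
  assume "\<not> ?thesis"
  then have ne: "P u v x \<noteq> P v u x" by (simp add: P_def)
  have cont: "isCont (P u v) x" for u v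
    unfolding P_def
    using smooth_on_continuous[OF smooth_on_D[OF smooth_on_D[OF S(2)]]] S(1,3)
    by (simp add: continuous_on_eq_continuous_at)
  define \<epsilon> where "\<epsilon> = \<bar>P u v x - P v u x\<bar> / 2"
  have "\<epsilon> > 0" using ne by (simp add: \<epsilon>_def)
  from cont[of u v] this obtain d1 where d1: "d1 > 0" "\<And>y. dist y x < d1 \<Longrightarrow> \<bar>P u v y - P u v x\<bar> < \<epsilon>"
    unfolding continuous_at_eps_delta by (metis dist_real_def)
  from cont[of v u] \<open>\<epsilon> > 0\<close> obtain d2 where d2: "d2 > 0" "\<And>y. dist y x < d2 \<Longrightarrow> \<bar>P v u y - P v u x\<bar> < \<epsilon>"
    unfolding continuous_at_eps_delta by (metis dist_real_def)
  obtain d3 where d3: "d3 > 0" "\<And>y. dist y x < d3 \<Longrightarrow> y \<in> S"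
    using S(1,3) unfolding open_dist by blast
  define d where "d = min d1 (min d2 d3)"
  define c where "c = norm u + norm v + 1"
  define t where "t = d / (2 * c)"
  have "c > 0" by (simp add: c_def add_nonneg_pos)
  have "d > 0" using d1 d2 d3 by (simp add: d_def)
  then have t: "t > 0"
    using \<open>c > 0\<close> by (simp add: t_def)
  have near: "dist (x + a *\<^sub>R u + b *\<^sub>R v) x < d" if "0 \<le> a" "a \<le> t" "0 \<le> b" "b \<le> t" for a b
  proof -
    have "dist (x + a *\<^sub>R u + b *\<^sub>R v) x = norm (a *\<^sub>R u + b *\<^sub>R v)" by (simp add: dist_norm)
    also have "\<dots> \<le> a * norm u + b * norm v"
      using that by (intro norm_triangle_le) simp
    also have "\<dots> \<le> t * norm u + t * norm v"
      using that by (intro add_mono mult_right_mono) auto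
    also have "\<dots> \<le> t * c" using t by (simp add: c_def algebra_simps)
    also have "\<dots> = d / 2" using \<open>c > 0\<close> by (simp add: t_def)
    also have "\<dots> < d" using \<open>d > 0\<close> by simp
    finally show ?thesis .
  qed
  have inS': "x + a *\<^sub>R v + b *\<^sub>R u \<in> S" if "0 \<le> a" "a \<le> t" "0 \<le> b" "b \<le> t" for a b
  proof -
    have "x + a *\<^sub>R v + b *\<^sub>R u = x + b *\<^sub>R u + a *\<^sub>R v" by simp
    moreover have "x + b *\<^sub>R u + a *\<^sub>R v \<in> S"
      using near[OF that(3,4,1,2)] by (intro d3(2)) (simp add: d_def)
    ultimately show ?thesis by (simp only:)
  qed
  obtain a b where ab: "0 \<le> a" "a \<le> t" "0 \<le> b" "b \<le> t"
    "f (x + t *\<^sub>R u + t *\<^sub>R v) - f (x + t *\<^sub>R u) - f (x + t *\<^sub>R v) + f x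
      = t * (t * P u v (x + a *\<^sub>R u + b *\<^sub>R v))"
    unfolding P_def
    by (rule mixed_difference_mean_value[OF S(1,2) t, of x u v]) (use near d3 in \<open>auto simp: d_def\<close>)
  obtain a' b' where ab': "0 \<le> a'" "a' \<le> t" "0 \<le> b'" "b' \<le> t"
    "f (x + t *\<^sub>R v + t *\<^sub>R u) - f (x + t *\<^sub>R v) - f (x + t *\<^sub>R u) + f x
      = t * (t * P v u (x + a' *\<^sub>R v + b' *\<^sub>R u))"
    unfolding P_def
    by (rule mixed_difference_mean_value[OF S(1,2) t, of x v u])
       (use inS' in auto)
  have "t * (t * P u v (x + a *\<^sub>R u + b *\<^sub>R v)) = t * (t * P v u (x + b' *\<^sub>R u + a' *\<^sub>R v))"
    using ab(5) ab'(5) by (simp add: algebra_simps)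
  then have "P u v (x + a *\<^sub>R u + b *\<^sub>R v) = P v u (x + b' *\<^sub>R u + a' *\<^sub>R v)"
    using t by simp
  moreover have "\<bar>P u v (x + a *\<^sub>R u + b *\<^sub>R v) - P u v x\<bar> < \<epsilon>"
    using near[OF ab(1-4)] by (intro d1) (simp add: d_def)
  moreover have "\<bar>P v u (x + b' *\<^sub>R u + a' *\<^sub>R v) - P v u x\<bar> < \<epsilon>"
    using near[OF ab'(3,4,1,2)] by (intro d2) (simp add: d_def)
  ultimately show False unfolding \<epsilon>_def by (auto simp: abs_if split: if_splits)
qed

lemma D_commute:
  fixes f :: "'a::euclidean_space \<Rightarrow> 'b::euclidean_space"
  assumes S: "open S" "smooth_on S f" "x \<in> S"
  shows "D (\<lambda>y. D f y u) x v = D (\<lambda>y. D f y v) x u"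
proof (rule euclidean_eqI)
  fix b :: 'b
  have comp: "D (\<lambda>y. D f y u) x v \<bullet> b = D (\<lambda>y. D (\<lambda>z. f z \<bullet> b) y u) x v" for u v
  proof -
    have "D (\<lambda>y. D f y u) x v \<bullet> b = D (\<lambda>y. D f y u \<bullet> b) x v"
      by (rule D_bounded_linear[OF bounded_linear_inner_left, symmetric])
         (rule smooth_on_differentiable[OF smooth_on_D[OF S(2)] S(1,3)])
    also have "D (\<lambda>y. D f y u \<bullet> b) x = D (\<lambda>y. D (\<lambda>z. f z \<bullet> b) y u) x"
    proof (rule D_cong_open(1)[OF S(1,3)])
      show "D (\<lambda>z. f z \<bullet> b) y u = D f y u \<bullet> b" if "y \<in> S" for y
        by (rule D_bounded_linear[OF bounded_linear_inner_left smooth_on_differentiable[OF S(2,1) that]])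
      show "(\<lambda>y. D (\<lambda>z. f z \<bullet> b) y u) differentiable (at x)"
        by (rule smooth_on_differentiable[OF smooth_on_D[OF smooth_on_inner_const[OF S(1,2)]] S(1,3)])
    qed
    finally show ?thesis .
  qed
  show "D (\<lambda>y. D f y u) x v \<bullet> b = D (\<lambda>y. D f y v) x u \<bullet> b"
    unfolding comp by (rule D_commute_real[OF S(1) smooth_on_inner_const[OF S(1,2)] S(3)])
qed

lemma D_zero_at_max:
  fixes f :: "'a::euclidean_space \<Rightarrow> real"
  assumes S: "open S" "smooth_on S f" "x \<in> S" and max: "\<And>y. y \<in> S \<Longrightarrow> f y \<le> f x"
  shows "D f x v = 0"
  using differential_zero_maxmin[OF S(3,1) D_has_derivative[OF smooth_on_differentiable[OF S(2,1,3)]]] max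
  by auto

text \<open>Second derivative test: if the derivative along \<open>X\<close> had positive derivative in direction
  \<open>X x\<close>, then \<open>f\<close>, having vanishing derivative at \<open>x\<close>, would be increasing along the line
  through \<open>x\<close> in that direction.\<close>

lemma D_D_nonpos_at_max:
  fixes f :: "'a::euclidean_space \<Rightarrow> real"
  assumes S: "open S" "smooth_on S f" "x \<in> S" and max: "\<And>y. y \<in> S \<Longrightarrow> f y \<le> f x"
    and X: "smooth_on S X"
  shows "D (\<lambda>y. D f y (X y)) x (X x) \<le> 0"
proof -
  define u where "u = X x"
  have "D (\<lambda>y. D f y (X y)) x u = D (\<lambda>z. D f z (X x)) x (D (\<lambda>y. y) x u) + D f x (D X x u)"
    by (rule D_linear_family(1)[OF S(1) S(1) _ S(3), of "\<lambda>y. y"])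
       (use S X in \<open>auto intro: smooth_on_differentiable D_linear smooth_on_D\<close>)
  then have eq: "D (\<lambda>y. D f y (X y)) x u = D (\<lambda>z. D f z u) x u"
    by (simp add: u_def D_zero_at_max[OF S max])
  have "D (\<lambda>z. D f z u) x u \<le> 0"
  proof (rule ccontr)
    assume "\<not> ?thesis"
    then have pos: "D (\<lambda>z. D f z u) x u > 0" by simp
    define k where "k t = D f (x + t *\<^sub>R u) u" for t
    have "((\<lambda>t. D f (x + t *\<^sub>R u) u) has_vector_derivative D (\<lambda>z. D f z u) (x + 0 *\<^sub>R u) u) (at 0)"
      by (rule D_line[OF S(1) smooth_on_D[OF S(2)]]) (use S(3) in simp)
    then have dk: "(k has_real_derivative D (\<lambda>z. D f z u) x u) (at 0)"
      unfolding k_def has_real_derivative_iff_has_vector_derivative by simp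
    obtain d1 where d1: "d1 > 0" "\<And>h. 0 < h \<Longrightarrow> h < d1 \<Longrightarrow> k 0 < k (0 + h)"
      using DERIV_pos_inc_right[OF dk pos] by auto
    have "isCont (\<lambda>t. x + t *\<^sub>R u) 0" by (intro continuous_intros)
    then have "\<forall>\<^sub>F t in at 0. x + t *\<^sub>R u \<in> S"
      using S(1,3) by (auto simp: isCont_def elim!: topological_tendstoD)
    then obtain d2 where d2: "d2 > 0" "\<And>t. t \<noteq> 0 \<Longrightarrow> \<bar>t\<bar> < d2 \<Longrightarrow> x + t *\<^sub>R u \<in> S"
      unfolding eventually_at by (auto simp: dist_real_def)
    define t where "t = min d1 d2 / 2"
    have t: "t > 0" "t < d1" "t < d2" using d1(1) d2(1) by (auto simp: t_def)
    have inS: "x + s *\<^sub>R u \<in> S" if "0 \<le> s" "s \<le> t" for s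
      using d2(2)[of s] that t S(3) by (cases "s = 0") auto
    obtain s where s: "0 < s" "s < t" "f (x + t *\<^sub>R u) - f (x + 0 *\<^sub>R u) = (t - 0) * k s"
      using MVT2[OF t(1), of "\<lambda>t. f (x + t *\<^sub>R u)" k] D_line[OF S(1,2)] inS
      unfolding k_def by (auto simp: has_real_derivative_iff_has_vector_derivative)
    have "k s > 0"
      using d1(2)[of s] s t by (simp add: k_def D_zero_at_max[OF S max])
    then have "f (x + t *\<^sub>R u) > f x" using s t(1) by (simp add: algebra_simps)
    then show False using max[OF inS[of t]] t by simp
  qed
  then show ?thesis using eq by (simp add: u_def)
qed

section \<open>Inner products given by positive definite forms\<close>

locale inner_form =
  fixes g :: "'n::euclidean_space \<Rightarrow> 'n \<Rightarrow> real"
  assumes linear_right: "linear (g u)"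
    and sym: "g u v = g v u"
    and pos: "u \<noteq> 0 \<Longrightarrow> g u u > 0"
begin

lemma linear_left: "linear (\<lambda>u. g u v)"
  using linear_right[of v] by (simp add: sym[of _ v])

lemmas form_simps =
  linear_add[OF linear_right] linear_diff[OF linear_right] linear_cmul[OF linear_right]
  linear_sum[OF linear_right] linear_0[OF linear_right]
  linear_add[OF linear_left] linear_diff[OF linear_left] linear_cmul[OF linear_left]
  linear_sum[OF linear_left] linear_0[OF linear_left]

lemma nonneg: "g u u \<ge> 0"
  using pos[of u] form_simps(5)[of 0] by (cases "u = 0") auto

lemma eqI:
  assumes "\<And>w. g u w = g v w"
  shows "u = v"
proof -
  have "g (u - v) (u - v) = 0" using assms by (simp add: form_simps)
  then show ?thesis using pos[of "u - v"] by force
qed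

definition orthonormal :: "('i \<Rightarrow> 'n) \<Rightarrow> 'i set \<Rightarrow> bool" where
  "orthonormal e I \<longleftrightarrow> (\<forall>i\<in>I. \<forall>j\<in>I. g (e i) (e j) = (if i = j then 1 else 0))"

lemma orthonormal_expansion:
  assumes e: "orthonormal e I" and I: "finite I" "card I = DIM('n)"
  shows "v = (\<Sum>i\<in>I. g v (e i) *\<^sub>R e i)"
proof -
  have gs: "g (\<Sum>i\<in>I. c i *\<^sub>R e i) (e j) = c j" if "j \<in> I" for c j
  proof -
    have "g (\<Sum>i\<in>I. c i *\<^sub>R e i) (e j) = (\<Sum>i\<in>I. c i * g (e i) (e j))" by (simp add: form_simps)
    also have "\<dots> = (\<Sum>i\<in>I. if i = j then c i else 0)"
      using e that by (intro sum.cong) (auto simp: orthonormal_def)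
    also have "\<dots> = c j" using I(1) that by simp
    finally show ?thesis .
  qed
  have inj: "inj_on e I"
  proof (rule inj_onI)
    fix i j assume ij: "i \<in> I" "j \<in> I" "e i = e j"
    have "g (e i) (e i) = 1" "g (e i) (e j) = (if i = j then 1 else 0)"
      using e ij(1,2) by (simp_all add: orthonormal_def)
    then show "i = j" using ij(3) by (auto split: if_splits)
  qed
  have "independent (e ` I)"
  proof (rule independent_if_scalars_zero)
    fix f x assume f: "(\<Sum>x\<in>e ` I. f x *\<^sub>R x) = 0" and x: "x \<in> e ` I"
    then have "(\<Sum>i\<in>I. f (e i) *\<^sub>R e i) = 0" by (simp add: sum.reindex[OF inj])
    then show "f x = 0" using gs[of _ "\<lambda>i. f (e i)"] x form_simps(10) by force
  qed (use I in auto)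
  then have span: "span (e ` I) = UNIV"
    using I(2) inj by (intro dim_eq_full[THEN iffD1]) (auto simp: dim_eq_card_independent card_image)
  define w where "w = v - (\<Sum>i\<in>I. g v (e i) *\<^sub>R e i)"
  have "g w (e i) = 0" if "i \<in> I" for i
    using gs[OF that] by (simp add: w_def form_simps(7))
  then have "e ` I \<subseteq> {x. g w x = 0}" by auto
  moreover have "subspace {x. g w x = 0}"
    by (simp add: subspace_def form_simps)
  ultimately have "span (e ` I) \<subseteq> {x. g w x = 0}" by (rule span_minimal)
  then have "g w w = 0" using span by auto
  then have "w = 0" using pos[of w] by force
  then show ?thesis by (simp add: w_def)
qed

lemma parseval:
  assumes e: "orthonormal e I" and I: "finite I" "card I = DIM('n)"
  shows "g u v = (\<Sum>i\<in>I. g u (e i) * g v (e i))"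
proof -
  have "g u v = g u (\<Sum>i\<in>I. g v (e i) *\<^sub>R e i)"
    using orthonormal_expansion[OF assms, of v] by simp
  then show ?thesis by (simp add: form_simps mult.commute)
qed

lemma bilinear_expansion:
  assumes e: "orthonormal e I" and I: "finite I" "card I = DIM('n)" and B: "bilinear B"
  shows "B u v = (\<Sum>(i, j)\<in>I \<times> I. (g u (e i) * g v (e j)) *\<^sub>R B (e i) (e j))"
proof -
  have "B u v = B (\<Sum>i\<in>I. g u (e i) *\<^sub>R e i) (\<Sum>i\<in>I. g v (e i) *\<^sub>R e i)"
    using orthonormal_expansion[OF e I] by simp
  also have "\<dots> = (\<Sum>(i, j)\<in>I \<times> I. B (g u (e i) *\<^sub>R e i) (g v (e j) *\<^sub>R e j))"
    by (rule bilinear_sum[OF B])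
  finally show ?thesis by (simp add: bilinear_lmul[OF B] bilinear_rmul[OF B] mult.commute[of "g v _"])
qed

text \<open>Expand \<open>e i\<close> in the basis \<open>e'\<close>. Summing the products of the coefficients over \<open>i\<close> gives, by
  Parseval, the matrix \<open>g (e' j) (e' k)\<close>, which is the identity.\<close>

lemma trace_unique:
  assumes e: "orthonormal e I" "finite I" "card I = DIM('n)"
    and e': "orthonormal e' J" "finite J" "card J = DIM('n)" and B: "bilinear B"
  shows "(\<Sum>i\<in>I. B (e i) (e i)) = (\<Sum>j\<in>J. B (e' j) (e' j))"
proof -
  have "(\<Sum>i\<in>I. B (e i) (e i))
      = (\<Sum>i\<in>I. \<Sum>(j, k)\<in>J \<times> J. (g (e i) (e' j) * g (e i) (e' k)) *\<^sub>R B (e' j) (e' k))"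
    by (rule sum.cong[OF refl bilinear_expansion[OF e' B]])
  also have "\<dots> = (\<Sum>(j, k)\<in>J \<times> J. (\<Sum>i\<in>I. g (e' j) (e i) * g (e' k) (e i)) *\<^sub>R B (e' j) (e' k))"
    by (subst sum.swap) (auto simp: scaleR_sum_left sym[of "e _"] intro!: sum.cong)
  also have "\<dots> = (\<Sum>(j, k)\<in>J \<times> J. g (e' j) (e' k) *\<^sub>R B (e' j) (e' k))"
    by (simp add: parseval[OF e, symmetric])
  also have "\<dots> = (\<Sum>(j, k)\<in>J \<times> J. if j = k then B (e' j) (e' k) else 0)"
    using e'(1) by (intro sum.cong) (auto simp: orthonormal_def)
  also have "\<dots> = (\<Sum>j\<in>J. B (e' j) (e' j))"
    using e'(2) by (subst sum.cartesian_product[symmetric]) simp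
  finally show ?thesis .
qed

lemma sum_products_le:
  assumes e: "orthonormal e I" and I: "finite I" "card I = DIM('n)"
  shows "(\<Sum>(i, j)\<in>I \<times> I. (g u (e i) * g v (e j))\<^sup>2) = g u u * g v v"
  using parseval[OF assms, of u u] parseval[OF assms, of v v]
  by (simp add: power2_eq_square sum_product sum.cartesian_product mult_ac)

text \<open>Cauchy--Schwarz for the expansion in the orthonormal basis.\<close>

lemma bilinear_bound:
  fixes B :: "'n \<Rightarrow> 'n \<Rightarrow> real"
  assumes e: "orthonormal e I" and I: "finite I" "card I = DIM('n)" and B: "bilinear B"
  shows "(B u v)\<^sup>2 \<le> g u u * g v v * (\<Sum>(i, j)\<in>I \<times> I. (B (e i) (e j))\<^sup>2)"
proof -
  have "(B u v)\<^sup>2 = (\<Sum>p\<in>I \<times> I. (g u (e (fst p)) * g v (e (snd p))) * B (e (fst p)) (e (snd p)))\<^sup>2"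
    by (subst bilinear_expansion[OF assms]) (simp add: case_prod_beta)
  also have "\<dots> \<le> (\<Sum>p\<in>I \<times> I. (g u (e (fst p)) * g v (e (snd p)))\<^sup>2)
      * (\<Sum>p\<in>I \<times> I. (B (e (fst p)) (e (snd p)))\<^sup>2)"
    by (rule Cauchy_Schwarz_ineq_sum)
  finally show ?thesis
    using sum_products_le[OF e I, of u v] by (simp add: case_prod_beta)
qed

text \<open>A skew form only sees the skew part \<open>(u \<otimes> v - v \<otimes> u) / 2\<close> of \<open>u \<otimes> v\<close>, whose squared norm is at
  most half of that of \<open>u \<otimes> v\<close>.\<close>

lemma skew_bound:
  fixes B :: "'n \<Rightarrow> 'n \<Rightarrow> real"
  assumes e: "orthonormal e I" and I: "finite I" "card I = DIM('n)" and B: "bilinear B"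
    and skew: "\<And>x y. B x y = - B y x"
  shows "(B u v)\<^sup>2 \<le> g u u * g v v / 2 * (\<Sum>(i, j)\<in>I \<times> I. (B (e i) (e j))\<^sup>2)"
proof -
  define a where "a p = (g u (e (fst p)) * g v (e (snd p)) - g v (e (fst p)) * g u (e (snd p))) / 2"
    for p
  have "B u v = (B u v - B v u) / 2" using skew[of v u] by simp
  also have "\<dots> = (\<Sum>p\<in>I \<times> I. a p * B (e (fst p)) (e (snd p)))"
    by (subst (1 2) bilinear_expansion[OF e I B])
       (simp add: case_prod_beta a_def sum_subtractf[symmetric] sum_divide_distrib diff_divide_distrib left_diff_distrib)
  finally have "(B u v)\<^sup>2 \<le> (\<Sum>p\<in>I \<times> I. (a p)\<^sup>2) * (\<Sum>p\<in>I \<times> I. (B (e (fst p)) (e (snd p)))\<^sup>2)"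
    by (simp add: Cauchy_Schwarz_ineq_sum)
  also have "\<dots> \<le> (g u u * g v v / 2) * (\<Sum>p\<in>I \<times> I. (B (e (fst p)) (e (snd p)))\<^sup>2)"
  proof (rule mult_right_mono)
    have "(\<Sum>p\<in>I \<times> I. (g u (e (fst p)) * g v (e (snd p))) * (g v (e (fst p)) * g u (e (snd p))))
        = (\<Sum>i\<in>I. g u (e i) * g v (e i)) * (\<Sum>j\<in>I. g u (e j) * g v (e j))"
      by (simp add: sum_product sum.cartesian_product case_prod_beta mult_ac)
    then have m: "(\<Sum>p\<in>I \<times> I. (g u (e (fst p)) * g v (e (snd p))) * (g v (e (fst p)) * g u (e (snd p))))
        = (g u v)\<^sup>2"
      by (simp add: parseval[OF e I, symmetric] power2_eq_square)
    have "(\<Sum>p\<in>I \<times> I. (a p)\<^sup>2)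
        = ((\<Sum>p\<in>I \<times> I. (g u (e (fst p)) * g v (e (snd p)))\<^sup>2)
          + (\<Sum>p\<in>I \<times> I. (g v (e (fst p)) * g u (e (snd p)))\<^sup>2)
          - 2 * (\<Sum>p\<in>I \<times> I. (g u (e (fst p)) * g v (e (snd p))) * (g v (e (fst p)) * g u (e (snd p))))) / 4"
      by (simp add: a_def power_divide power2_diff sum.distrib sum_subtractf sum_distrib_left
          sum_divide_distrib[symmetric] mult.assoc)
    also have "\<dots> = (2 * (g u u * g v v) - 2 * (g u v)\<^sup>2) / 4"
      using sum_products_le[OF e I, of u v] sum_products_le[OF e I, of v u] m
      by (simp add: case_prod_beta)
    also have "\<dots> \<le> g u u * g v v / 2" by simp
    finally show "(\<Sum>p\<in>I \<times> I. (a p)\<^sup>2) \<le> g u u * g v v / 2" .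
  qed (simp add: sum_nonneg)
  finally show ?thesis by (simp add: case_prod_beta)
qed

end

section \<open>Riemannian metrics on open subsets of Euclidean space\<close>

locale local_metric =
  fixes U :: "'n::euclidean_space set" and g :: "'n \<Rightarrow> 'n \<Rightarrow> 'n \<Rightarrow> real"
  assumes open_U: "open U"
    and form: "z \<in> U \<Longrightarrow> inner_form (g z)"
    and g_smooth: "smooth_on U (\<lambda>z. g z u v)"

text \<open>The Christoffel symbols enter through Koszul's formula, which determines them because \<open>g\<close> is
  nondegenerate. Symmetry, linearity, smoothness and compatibility with the metric are all read off
  from it by pairing with a test vector.\<close>

locale local_riemannian = local_metric U g
  for U :: "'n::euclidean_space set" and g :: "'n \<Rightarrow> 'n \<Rightarrow> 'n \<Rightarrow> real" +
  fixes \<Gamma> :: "'n \<Rightarrow> 'n \<Rightarrow> 'n \<Rightarrow> 'n"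
  assumes koszul: "z \<in> U \<Longrightarrow> 2 * g z (\<Gamma> z u v) w
      = D (\<lambda>z. g z v w) z u + D (\<lambda>z. g z u w) z v - D (\<lambda>z. g z u v) z w"

text \<open>The covariant derivative of a vector field \<open>V\<close> along the map \<open>\<Phi>\<close>, in direction \<open>u\<close>; for the
  identity \<open>\<Phi>\<close> it is the covariant derivative on the open set itself.\<close>

definition cov_deriv ::
  "('n::real_normed_vector \<Rightarrow> 'n \<Rightarrow> 'n \<Rightarrow> 'n) \<Rightarrow> ('a::real_normed_vector \<Rightarrow> 'n) \<Rightarrow> ('a \<Rightarrow> 'n) \<Rightarrow> 'a \<Rightarrow> 'a \<Rightarrow> 'n"
  where "cov_deriv \<Gamma> \<Phi> V x u = D V x u + \<Gamma> (\<Phi> x) (D \<Phi> x u) (V x)"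

text \<open>\<open>[\<nabla>\<^sub>x, \<nabla>\<^sub>y] w\<close> for vector fields with constant coordinates, whose bracket vanishes.\<close>

definition riemann_tensor ::
  "('n::real_normed_vector \<Rightarrow> 'n \<Rightarrow> 'n \<Rightarrow> 'n) \<Rightarrow> 'n \<Rightarrow> 'n \<Rightarrow> 'n \<Rightarrow> 'n \<Rightarrow> 'n" where
  "riemann_tensor \<Gamma> z x y w =
     D (\<lambda>z. \<Gamma> z y w) z x - D (\<lambda>z. \<Gamma> z x w) z y + \<Gamma> z x (\<Gamma> z y w) - \<Gamma> z y (\<Gamma> z x w)"

context local_metric
begin

lemma g_linear: "z \<in> U \<Longrightarrow> linear (g z u)" "z \<in> U \<Longrightarrow> linear (\<lambda>u. g z u v)"
  and g_sym: "z \<in> U \<Longrightarrow> g z u v = g z v u"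
  using inner_form.linear_right[OF form] inner_form.linear_left[OF form] inner_form.sym[OF form]
  by blast+

lemma g_diff: "z \<in> U \<Longrightarrow> (\<lambda>z. g z u v) differentiable (at z)"
  by (rule smooth_on_differentiable[OF g_smooth open_U])

lemma D_g_sym: "z \<in> U \<Longrightarrow> D (\<lambda>z. g z u v) z = D (\<lambda>z. g z v u) z"
  by (rule D_cong_open(1)[OF open_U]) (auto intro: g_sym g_diff)

lemma D_g_linear: "z \<in> U \<Longrightarrow> linear (\<lambda>w. D (\<lambda>z. g z v w) z u)"
  "z \<in> U \<Longrightarrow> linear (\<lambda>v. D (\<lambda>z. g z v w) z u)"
  "z \<in> U \<Longrightarrow> linear (D (\<lambda>z. g z v w) z)"
  by (rule linear_D_family[OF open_U]; use g_linear g_diff in auto)+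
     (auto intro: D_linear g_diff)

lemma smooth_on_g:
  fixes \<Phi> :: "'a::euclidean_space \<Rightarrow> 'n"
  assumes "open S" "\<Phi> ` S \<subseteq> U" "smooth_on S \<Phi>" "smooth_on S V" "smooth_on S W"
  shows "smooth_on S (\<lambda>x. g (\<Phi> x) (V x) (W x))"
  by (rule smooth_on_bilinear_family[OF assms(1) open_U assms(2-5)]) (auto intro: g_linear g_smooth)

lemma D_g:
  fixes \<Phi> :: "'a::euclidean_space \<Rightarrow> 'n"
  assumes "open S" "\<Phi> ` S \<subseteq> U" "smooth_on S \<Phi>" "smooth_on S V" "smooth_on S W" "x \<in> S"
  shows "D (\<lambda>x. g (\<Phi> x) (V x) (W x)) x u = D (\<lambda>z. g z (V x) (W x)) (\<Phi> x) (D \<Phi> x u)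
    + g (\<Phi> x) (D V x u) (W x) + g (\<Phi> x) (V x) (D W x u)"
  by (rule D_bilinear_family[OF assms(1) open_U assms(2-5) _ _ _ assms(6)])
     (auto intro: g_linear g_smooth)

text \<open>Gram--Schmidt. The coefficient functions of \<open>E b\<close> at coordinate vectors not yet treated vanish,
  so the next coordinate vector minus its projection is nowhere zero.\<close>

lemma smooth_frame_partial:
  assumes "finite S" "S \<subseteq> Basis"
  shows "\<exists>E. (\<forall>b\<in>S. smooth_on U (E b)) \<and> (\<forall>z\<in>U. inner_form.orthonormal (g z) (\<lambda>b. E b z) S) \<and>
     (\<forall>z\<in>U. \<forall>b\<in>S. \<forall>c\<in>Basis - S. E b z \<bullet> c = 0)"
  using assms
proof (induction S)
  case empty
  then show ?case by (auto simp: inner_form.orthonormal_def[OF form])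
next
  case (insert s S)
  then obtain E where E0: "\<forall>b\<in>S. smooth_on U (E b)"
    "\<forall>z\<in>U. inner_form.orthonormal (g z) (\<lambda>b. E b z) S"
    "\<forall>z\<in>U. \<forall>b\<in>S. \<forall>c\<in>Basis - S. E b z \<bullet> c = 0"
    by blast
  have E: "\<And>b. b \<in> S \<Longrightarrow> smooth_on U (E b)"
    "\<And>z. z \<in> U \<Longrightarrow> inner_form.orthonormal (g z) (\<lambda>b. E b z) S"
    "\<And>z b c. z \<in> U \<Longrightarrow> b \<in> S \<Longrightarrow> c \<in> Basis - S \<Longrightarrow> E b z \<bullet> c = 0"
    using E0 by auto
  define w where "w z = s - (\<Sum>b\<in>S. g z s (E b z) *\<^sub>R E b z)" for z
  define n where "n z = g z (w z) (w z) powr (- (1/2))" for z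
  define E' where "E' b = (if b = s then \<lambda>z. n z *\<^sub>R w z else E b)" for b
  have w_smooth: "smooth_on U w"
    unfolding w_def
    by (intro smooth_on_diff smooth_on_sum smooth_on_scaleR smooth_on_const smooth_on_g E(1)
        smooth_on_ident open_U) auto
  have w_pos: "g z (w z) (w z) > 0" if "z \<in> U" for z
  proof -
    have "w z \<bullet> s = s \<bullet> s"
      using E(3)[OF that] insert.hyps insert.prems by (simp add: w_def inner_diff_left inner_sum_left)
    also have "\<dots> = 1" using insert.prems by (simp add: inner_Basis)
    finally show ?thesis by (intro inner_form.pos[OF form[OF that]]) auto
  qed
  have n_smooth: "smooth_on U n"
    unfolding n_def
    by (intro smooth_on_powr open_U smooth_on_g smooth_on_ident w_smooth w_pos) auto
  have w_orth: "g z (w z) (E c z) = 0" if "z \<in> U" "c \<in> S" for z c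
  proof -
    interpret inner_form "g z" by (rule form[OF that(1)])
    have "(\<Sum>b\<in>S. g z s (E b z) * g z (E b z) (E c z)) = (\<Sum>b\<in>S. if b = c then g z s (E b z) else 0)"
      using E(2)[OF that(1)] that(2) by (intro sum.cong) (auto simp: orthonormal_def)
    then show ?thesis using that(2) insert.hyps by (simp add: w_def form_simps)
  qed
  have nw: "n z * n z * g z (w z) (w z) = 1" if "z \<in> U" for z
    using w_pos[OF that] by (simp add: n_def powr_add[symmetric] powr_neg_one del: powr_minus)
  show ?case
  proof (intro exI[of _ E'] conjI ballI)
    show "smooth_on U (E' b)" if "b \<in> insert s S" for b
      using that E(1) by (auto simp: E'_def intro!: smooth_on_scaleR n_smooth w_smooth open_U)
    show "inner_form.orthonormal (g z) (\<lambda>b. E' b z) (insert s S)" if z: "z \<in> U" for z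
    proof -
      interpret inner_form "g z" by (rule form[OF z])
      show ?thesis
        using nw[OF z] w_orth[OF z] E(2)[OF z] insert.hyps(2)
        by (auto simp: orthonormal_def E'_def form_simps sym[of "E _ z" "w z"] mult.assoc)
    qed
    show "E' b z \<bullet> c = 0" if "z \<in> U" "b \<in> insert s S" "c \<in> Basis - insert s S" for z b c
    proof -
      have "s \<bullet> c = 0" using that(3) insert.prems by (auto simp: inner_Basis)
      then show ?thesis
        using that E(3)[OF that(1)] by (auto simp: E'_def w_def inner_diff_left inner_sum_left)
    qed
  qed
qed

lemma smooth_frame:
  obtains E :: "'n \<Rightarrow> 'n \<Rightarrow> 'n" where "\<And>b. b \<in> Basis \<Longrightarrow> smooth_on U (E b)"
    "\<And>z. z \<in> U \<Longrightarrow> inner_form.orthonormal (g z) (\<lambda>b. E b z) Basis"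
proof -
  from smooth_frame_partial[OF finite_Basis order_refl] obtain E :: "'n \<Rightarrow> 'n \<Rightarrow> 'n"
    where "\<forall>b\<in>Basis. smooth_on U (E b)" "\<forall>z\<in>U. inner_form.orthonormal (g z) (\<lambda>b. E b z) Basis"
    by blast
  then show thesis by (intro that[of E]) auto
qed

end

context local_riemannian
begin

lemma \<Gamma>_linear:
  assumes "z \<in> U"
  shows "linear (\<Gamma> z u)" "linear (\<lambda>u. \<Gamma> z u v)"
proof -
  interpret inner_form "g z" by (rule form[OF assms])
  note lin = D_g_linear[OF assms]
  have k: "g z (\<Gamma> z u v) w = (D (\<lambda>z. g z v w) z u + D (\<lambda>z. g z u w) z v - D (\<lambda>z. g z u v) z w) / 2" for u v w
    using koszul[OF assms, of u v w] by simp
  show "linear (\<Gamma> z u)" "linear (\<lambda>u. \<Gamma> z u v)"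
    by (rule linearI; rule eqI;
        simp add: form_simps k linear_add[OF lin(1)] linear_cmul[OF lin(1)] linear_add[OF lin(2)]
          linear_cmul[OF lin(2)] linear_add[OF lin(3)] linear_cmul[OF lin(3)] field_simps)+
qed

lemma \<Gamma>_sym:
  assumes "z \<in> U"
  shows "\<Gamma> z u v = \<Gamma> z v u"
proof -
  interpret inner_form "g z" by (rule form[OF assms])
  show ?thesis
  proof (rule eqI)
    show "g z (\<Gamma> z u v) w = g z (\<Gamma> z v u) w" for w
      using koszul[OF assms, of u v w] koszul[OF assms, of v u w] D_g_sym[OF assms, of u v] by simp
  qed
qed

lemma metric_compatible:
  assumes "z \<in> U"
  shows "D (\<lambda>z. g z v w) z x = g z (\<Gamma> z x v) w + g z v (\<Gamma> z x w)"
proof -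
  have "2 * D (\<lambda>z. g z v w) z x = 2 * g z (\<Gamma> z x v) w + 2 * g z (\<Gamma> z x w) v"
    unfolding koszul[OF assms] using D_g_sym[OF assms, of v w] by simp
  then show ?thesis using g_sym[OF assms, of v] by simp
qed

text \<open>Expanding \<open>\<Gamma> z u v\<close> in a smooth orthonormal frame avoids the inverse of the metric: the
  coefficients are given by Koszul's formula.\<close>

lemma \<Gamma>_smooth: "smooth_on U (\<lambda>z. \<Gamma> z u v)"
proof -
  obtain E :: "'n \<Rightarrow> 'n \<Rightarrow> 'n" where E: "\<And>b. b \<in> Basis \<Longrightarrow> smooth_on U (E b)"
    "\<And>z. z \<in> U \<Longrightarrow> inner_form.orthonormal (g z) (\<lambda>b. E b z) Basis"
    using smooth_frame by metis
  have k: "g z (\<Gamma> z u v) w = (D (\<lambda>z. g z v w) z u + D (\<lambda>z. g z u w) z v - D (\<lambda>z. g z u v) z w) / 2"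
    if "z \<in> U" for z w
    using koszul[OF that, of u v w] by simp
  have *: "smooth_on U (\<lambda>z. g z (\<Gamma> z u v) w)" for w
  proof (rule smooth_on_cong[OF open_U _ k[symmetric]])
    show "smooth_on U (\<lambda>z. (D (\<lambda>z. g z v w) z u + D (\<lambda>z. g z u w) z v - D (\<lambda>z. g z u v) z w) / 2)"
      by (intro smooth_on_bounded_linear[OF open_U bounded_linear_divide] smooth_on_add smooth_on_diff
          open_U smooth_on_D g_smooth)
  qed
  have "smooth_on U (\<lambda>z. g z (\<Gamma> z u v) (E b z))" if "b \<in> Basis" for b
    by (rule smooth_on_linear_family[OF open_U open_U _ smooth_on_ident E(1)[OF that], of "\<lambda>z. g z (\<Gamma> z u v)"])
       (use open_U g_linear * in auto)
  then have "smooth_on U (\<lambda>z. \<Sum>b\<in>Basis. g z (\<Gamma> z u v) (E b z) *\<^sub>R E b z)"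
    by (intro smooth_on_sum smooth_on_scaleR open_U E) auto
  then show ?thesis
    by (rule smooth_on_cong[OF open_U])
       (simp add: inner_form.orthonormal_expansion[OF form E(2) finite_Basis refl, symmetric])
qed

lemma \<Gamma>_diff: "z \<in> U \<Longrightarrow> (\<lambda>z. \<Gamma> z u v) differentiable (at z)"
  by (rule smooth_on_differentiable[OF \<Gamma>_smooth open_U])

lemma smooth_on_\<Gamma>:
  fixes \<Phi> :: "'a::euclidean_space \<Rightarrow> 'n"
  assumes "open S" "\<Phi> ` S \<subseteq> U" "smooth_on S \<Phi>" "smooth_on S V" "smooth_on S W"
  shows "smooth_on S (\<lambda>x. \<Gamma> (\<Phi> x) (V x) (W x))"
  by (rule smooth_on_bilinear_family[OF assms(1) open_U assms(2-5)]) (auto intro: \<Gamma>_linear \<Gamma>_smooth)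

lemma smooth_on_cov_deriv:
  fixes \<Phi> :: "'a::euclidean_space \<Rightarrow> 'n"
  assumes "open S" "\<Phi> ` S \<subseteq> U" "smooth_on S \<Phi>" "smooth_on S V" "smooth_on S X"
  shows "smooth_on S (\<lambda>x. cov_deriv \<Gamma> \<Phi> V x (X x))"
  unfolding cov_deriv_def
  using assms by (intro smooth_on_add smooth_on_\<Gamma> smooth_on_D_arg)

lemma D_inner_cov_deriv:
  fixes \<Phi> :: "'a::euclidean_space \<Rightarrow> 'n"
  assumes "open S" "\<Phi> ` S \<subseteq> U" "smooth_on S \<Phi>" "smooth_on S V" "smooth_on S W" "x \<in> S"
  shows "D (\<lambda>x. g (\<Phi> x) (V x) (W x)) x u
    = g (\<Phi> x) (cov_deriv \<Gamma> \<Phi> V x u) (W x) + g (\<Phi> x) (V x) (cov_deriv \<Gamma> \<Phi> W x u)"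
proof -
  have z: "\<Phi> x \<in> U" using assms(2,6) by auto
  interpret inner_form "g (\<Phi> x)" by (rule form[OF z])
  show ?thesis
    unfolding D_g[OF assms] metric_compatible[OF z] cov_deriv_def by (simp add: form_simps)
qed

lemma riemann_tensor_antisym: "riemann_tensor \<Gamma> z x y w = - riemann_tensor \<Gamma> z y x w"
  by (simp add: riemann_tensor_def)

lemma riemann_tensor_linear:
  assumes z: "z \<in> U"
  shows "linear (\<lambda>x. riemann_tensor \<Gamma> z x y w)" "linear (\<lambda>y. riemann_tensor \<Gamma> z x y w)"
    "linear (riemann_tensor \<Gamma> z x y)"
proof -
  note l = \<Gamma>_linear[OF z]
  have d: "linear (\<lambda>w. D (\<lambda>z. \<Gamma> z v w) z u)" "linear (\<lambda>v. D (\<lambda>z. \<Gamma> z v w) z u)" for u v w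
    by (rule linear_D_family[OF open_U _ _ z]; use \<Gamma>_linear \<Gamma>_diff z in auto)+
  have d': "linear (D (\<lambda>z. \<Gamma> z v w) z)" for v w by (rule D_linear[OF \<Gamma>_diff[OF z]])
  show "linear (\<lambda>x. riemann_tensor \<Gamma> z x y w)" "linear (\<lambda>y. riemann_tensor \<Gamma> z x y w)"
    "linear (riemann_tensor \<Gamma> z x y)"
    by (rule linearI; simp add: riemann_tensor_def linear_add[OF l(1)] linear_add[OF l(2)]
          linear_add[OF d(1)] linear_add[OF d(2)] linear_add[OF d'] linear_cmul[OF l(1)]
          linear_cmul[OF l(2)] linear_cmul[OF d(1)] linear_cmul[OF d(2)] linear_cmul[OF d']
          algebra_simps)+
qed

text \<open>Differentiating the function \<open>g z w w\<close> twice, metric compatibility turns the commutator of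
  the two covariant derivatives of the constant field \<open>w\<close> into a commutator of partial
  derivatives, which vanishes.\<close>

lemma riemann_tensor_skew:
  assumes z: "z \<in> U"
  shows "g z (riemann_tensor \<Gamma> z x y w) w = 0"
proof -
  interpret inner_form "g z" by (rule form[OF z])
  have second: "D (\<lambda>z'. D (\<lambda>z. g z w w) z' y) z x
      = 2 * (g z (D (\<lambda>z. \<Gamma> z y w) z x + \<Gamma> z x (\<Gamma> z y w)) w + g z (\<Gamma> z y w) (\<Gamma> z x w))" for x y
  proof -
    have first: "2 * g z' (\<Gamma> z' y w) w = D (\<lambda>z. g z w w) z' y" if "z' \<in> U" for z'
      using metric_compatible[OF that, of w w y] g_sym[OF that, of w] by simp
    have sm: "smooth_on U (\<lambda>z. g z (\<Gamma> z y w) w)"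
      by (intro smooth_on_g open_U smooth_on_ident \<Gamma>_smooth smooth_on_const) auto
    note diff = smooth_on_differentiable[OF sm open_U z]
    have "D (\<lambda>z'. D (\<lambda>z. g z w w) z' y) z x = D (\<lambda>z. 2 * g z (\<Gamma> z y w) w) z x"
      by (subst D_cong_open(1)[OF open_U z first])
         (use differentiable_bounded_linear[OF bounded_linear_mult_right diff] in auto)
    also have "\<dots> = 2 * D (\<lambda>z. g z (\<Gamma> z y w) w) z x"
      by (rule D_bounded_linear[OF bounded_linear_mult_right diff])
    also have "D (\<lambda>z. g z (\<Gamma> z y w) w) z x
        = g z (cov_deriv \<Gamma> (\<lambda>z. z) (\<lambda>z. \<Gamma> z y w) z x) w + g z (\<Gamma> z y w) (cov_deriv \<Gamma> (\<lambda>z. z) (\<lambda>z. w) z x)"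
      by (rule D_inner_cov_deriv[of U "\<lambda>z. z" "\<lambda>z. \<Gamma> z y w" "\<lambda>z. w"])
         (use z open_U \<Gamma>_smooth smooth_on_ident smooth_on_const in auto)
    finally show ?thesis by (simp add: cov_deriv_def)
  qed
  have "D (\<lambda>z'. D (\<lambda>z. g z w w) z' y) z x = D (\<lambda>z'. D (\<lambda>z. g z w w) z' x) z y"
    by (rule D_commute[OF open_U g_smooth z])
  then show ?thesis
    unfolding second by (simp add: riemann_tensor_def form_simps sym algebra_simps)
qed

end

subsection \<open>Isometries and harmonic map operators in coordinates\<close>

text \<open>The transformation law of the Christoffel symbols, read off from Koszul's formula: the terms in
  which the derivative of the metric falls on \<open>D \<psi>\<close> combine, by symmetry of second derivatives, to
  the single term with the second derivative of \<open>\<psi>\<close>.\<close>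

lemma christoffel_transformation:
  fixes \<psi> :: "'n::euclidean_space \<Rightarrow> 'k::euclidean_space"
  assumes L: "local_riemannian U g \<Gamma>" and L': "local_riemannian U' g' \<Gamma>'"
    and S: "open S" "S \<subseteq> U" and \<psi>: "smooth_on S \<psi>" "\<psi> ` S \<subseteq> U'"
    and iso: "\<And>z u v. z \<in> S \<Longrightarrow> g z u v = g' (\<psi> z) (D \<psi> z u) (D \<psi> z v)"
    and z: "z \<in> S" and surj: "surj (D \<psi> z)"
  shows "D \<psi> z (\<Gamma> z u v) = \<Gamma>' (\<psi> z) (D \<psi> z u) (D \<psi> z v) + D (\<lambda>z. D \<psi> z v) z u"
proof -
  interpret L: local_riemannian U g \<Gamma> by (rule L)
  interpret L': local_riemannian U' g' \<Gamma>' by (rule L')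
  have z': "\<psi> z \<in> U'" using \<psi>(2) z by auto
  interpret f: inner_form "g' (\<psi> z)" by (rule L'.form[OF z'])
  have dg: "D (\<lambda>z. g z v w) z u = D (\<lambda>y. g' y (D \<psi> z v) (D \<psi> z w)) (\<psi> z) (D \<psi> z u)
      + g' (\<psi> z) (D (\<lambda>z. D \<psi> z v) z u) (D \<psi> z w) + g' (\<psi> z) (D \<psi> z v) (D (\<lambda>z. D \<psi> z w) z u)"
    for u v w
  proof -
    have "D (\<lambda>z. g z v w) z u = D (\<lambda>z. g' (\<psi> z) (D \<psi> z v) (D \<psi> z w)) z u"
      by (subst D_cong_open(1)[OF S(1) z iso[symmetric]])
         (auto intro!: smooth_on_differentiable[OF _ S(1) z] L'.smooth_on_g S(1) \<psi> smooth_on_D)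
    also have "\<dots> = D (\<lambda>y. g' y (D \<psi> z v) (D \<psi> z w)) (\<psi> z) (D \<psi> z u)
      + g' (\<psi> z) (D (\<lambda>z. D \<psi> z v) z u) (D \<psi> z w) + g' (\<psi> z) (D \<psi> z v) (D (\<lambda>z. D \<psi> z w) z u)"
      by (rule L'.D_g[OF S(1) \<psi>(2,1) smooth_on_D[OF \<psi>(1)] smooth_on_D[OF \<psi>(1)] z])
    finally show ?thesis .
  qed
  have comm: "D (\<lambda>z. D \<psi> z v) z u = D (\<lambda>z. D \<psi> z u) z v" for u v
    by (rule D_commute[OF S(1) \<psi>(1) z])
  have "g' (\<psi> z) (D \<psi> z (\<Gamma> z u v)) (D \<psi> z w)
      = g' (\<psi> z) (\<Gamma>' (\<psi> z) (D \<psi> z u) (D \<psi> z v) + D (\<lambda>z. D \<psi> z v) z u) (D \<psi> z w)" for w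
  proof -
    have "z \<in> U" using z S(2) by blast
    note ks = L.koszul[OF this, of u v w] L'.koszul[OF z', of "D \<psi> z u" "D \<psi> z v" "D \<psi> z w"]
    have "2 * g' (\<psi> z) (D \<psi> z (\<Gamma> z u v)) (D \<psi> z w) = 2 * g z (\<Gamma> z u v) w"
      by (simp add: iso[OF z])
    also have "\<dots> = 2 * g' (\<psi> z) (\<Gamma>' (\<psi> z) (D \<psi> z u) (D \<psi> z v)) (D \<psi> z w)
        + 2 * g' (\<psi> z) (D (\<lambda>z. D \<psi> z v) z u) (D \<psi> z w)"
      using ks dg[of v w u] dg[of u w v] dg[of u v w]
        f.sym[of "D \<psi> z v" "D (\<lambda>z. D \<psi> z w) z u"]
      unfolding comm[of u v] comm[of u w] comm[of v w] by linarith
    finally show ?thesis by (simp add: f.form_simps)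
  qed
  then show ?thesis
  proof (intro f.eqI)
    fix w'
    assume eq: "\<And>w. g' (\<psi> z) (D \<psi> z (\<Gamma> z u v)) (D \<psi> z w)
      = g' (\<psi> z) (\<Gamma>' (\<psi> z) (D \<psi> z u) (D \<psi> z v) + D (\<lambda>z. D \<psi> z v) z u) (D \<psi> z w)"
    obtain w where "w' = D \<psi> z w" using surj by (auto simp: surj_def)
    then show "g' (\<psi> z) (D \<psi> z (\<Gamma> z u v)) w'
      = g' (\<psi> z) (\<Gamma>' (\<psi> z) (D \<psi> z u) (D \<psi> z v) + D (\<lambda>z. D \<psi> z v) z u) w'"
      using eq by simp
  qed
qed

text \<open>In the derivative of \<open>D \<psi> (\<Phi> y) (V y)\<close> the term with the second derivative of \<open>\<psi>\<close> is the one
  by which the Christoffel symbols fail to transform as tensors.\<close>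

lemma cov_deriv_transformation:
  fixes \<psi> :: "'n::euclidean_space \<Rightarrow> 'k::euclidean_space" and \<Phi> :: "'a::euclidean_space \<Rightarrow> 'n"
  assumes L: "local_riemannian U g \<Gamma>" and L': "local_riemannian U' g' \<Gamma>'"
    and S: "open S" "S \<subseteq> U" and \<psi>: "smooth_on S \<psi>" "\<psi> ` S \<subseteq> U'"
    and iso: "\<And>z u v. z \<in> S \<Longrightarrow> g z u v = g' (\<psi> z) (D \<psi> z u) (D \<psi> z v)"
    and T: "open T" "x \<in> T" and \<Phi>: "\<Phi> ` T \<subseteq> S" "smooth_on T \<Phi>" and V: "smooth_on T V"
    and surj: "surj (D \<psi> (\<Phi> x))"
  shows "cov_deriv \<Gamma>' (\<lambda>y. \<psi> (\<Phi> y)) (\<lambda>y. D \<psi> (\<Phi> y) (V y)) x u = D \<psi> (\<Phi> x) (cov_deriv \<Gamma> \<Phi> V x u)"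
proof -
  have z: "\<Phi> x \<in> S" using \<Phi>(1) T(2) by auto
  have \<psi>_diff: "\<psi> differentiable (at z)" if "z \<in> S" for z
    by (rule smooth_on_differentiable[OF \<psi>(1) S(1) that])
  have \<Phi>_diff: "\<Phi> differentiable (at x)" "V differentiable (at x)"
    by (rule smooth_on_differentiable[OF _ T]; fact)+
  have "D (\<lambda>y. D \<psi> (\<Phi> y) (V y)) x u
      = D (\<lambda>z. D \<psi> z (V x)) (\<Phi> x) (D \<Phi> x u) + D \<psi> (\<Phi> x) (D V x u)"
    by (rule D_linear_family(1)[OF T(1) S(1) \<Phi>(1) T(2) \<Phi>_diff])
       (auto intro: D_linear \<psi>_diff smooth_on_differentiable[OF smooth_on_D[OF \<psi>(1)] S(1) z])
  moreover have "D (\<lambda>y. \<psi> (\<Phi> y)) x u = D \<psi> (\<Phi> x) (D \<Phi> x u)"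
    by (rule D_chain[OF \<Phi>_diff(1) \<psi>_diff[OF z]])
  ultimately show ?thesis
    using christoffel_transformation[OF L L' S \<psi> iso z surj, of "D \<Phi> x u" "V x"]
      linear_add[OF D_linear[OF \<psi>_diff[OF z]]]
    by (simp add: cov_deriv_def)
qed

text \<open>The coordinate expression of \<open>\<nabla> d\<phi>\<close>, for a map \<open>\<Phi>\<close> between open sets with Christoffel symbols
  \<open>\<Gamma>\<close> on the source and \<open>\<Gamma>'\<close> on the target.\<close>

definition second_fundamental_form ::
  "('a::real_normed_vector \<Rightarrow> 'a \<Rightarrow> 'a \<Rightarrow> 'a) \<Rightarrow> ('n::real_normed_vector \<Rightarrow> 'n \<Rightarrow> 'n \<Rightarrow> 'n) \<Rightarrow>
     ('a \<Rightarrow> 'n) \<Rightarrow> 'a \<Rightarrow> 'a \<Rightarrow> 'a \<Rightarrow> 'n" where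
  "second_fundamental_form \<Gamma> \<Gamma>' \<Phi> x u v =
     D (\<lambda>y. D \<Phi> y v) x u + \<Gamma>' (\<Phi> x) (D \<Phi> x u) (D \<Phi> x v) - D \<Phi> x (\<Gamma> x u v)"

text \<open>The derivatives of \<open>Y\<close> cancel in \<open>(\<nabla> d\<phi>)(\<cdot>, Y)\<close>. Being bilinear in the values of the two fields
  at the point, it has a trace that any orthonormal basis computes.\<close>

lemma second_fundamental_form:
  fixes \<Phi> :: "'a::euclidean_space \<Rightarrow> 'n::euclidean_space"
  assumes L: "local_riemannian U g \<Gamma>" and L': "local_riemannian U' g' \<Gamma>'"
    and S: "open S" "S \<subseteq> U" "x \<in> S" and \<Phi>: "smooth_on S \<Phi>" "\<Phi> ` S \<subseteq> U'"
  shows "bilinear (second_fundamental_form \<Gamma> \<Gamma>' \<Phi> x)"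
    and "smooth_on S Y \<Longrightarrow> cov_deriv \<Gamma>' \<Phi> (\<lambda>y. D \<Phi> y (Y y)) x u - D \<Phi> x (cov_deriv \<Gamma> (\<lambda>y. y) Y x u)
      = second_fundamental_form \<Gamma> \<Gamma>' \<Phi> x u (Y x)"
proof -
  interpret L: local_riemannian U g \<Gamma> by (rule L)
  interpret L': local_riemannian U' g' \<Gamma>' by (rule L')
  have xU: "x \<in> U" "\<Phi> x \<in> U'" using S \<Phi>(2) by auto
  have \<Phi>_diff: "\<Phi> differentiable (at y)" if "y \<in> S" for y
    by (rule smooth_on_differentiable[OF \<Phi>(1) S(1) that])
  have D\<Phi>_diff: "(\<lambda>y. D \<Phi> y v) differentiable (at x)" for v
    by (rule smooth_on_differentiable[OF smooth_on_D[OF \<Phi>(1)] S(1,3)])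
  note lin = D_linear[OF \<Phi>_diff[OF S(3)]]
  have l2: "linear (\<lambda>v. D (\<lambda>y. D \<Phi> y v) x u)" for u
    by (rule linear_D_family[OF S(1) _ _ S(3)]) (auto intro: D_linear \<Phi>_diff D\<Phi>_diff)
  show "bilinear (second_fundamental_form \<Gamma> \<Gamma>' \<Phi> x)"
    unfolding bilinear_def second_fundamental_form_def
    by (intro conjI allI linear_compose_add linear_compose_sub l2 D_linear D\<Phi>_diff
        linear_compose[OF lin L'.\<Gamma>_linear(1)[OF xU(2)], unfolded o_def]
        linear_compose[OF lin L'.\<Gamma>_linear(2)[OF xU(2)], unfolded o_def]
        linear_compose[OF L.\<Gamma>_linear(1)[OF xU(1)] lin, unfolded o_def]
        linear_compose[OF L.\<Gamma>_linear(2)[OF xU(1)] lin, unfolded o_def])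
  assume Y: "smooth_on S Y"
  have "D (\<lambda>y. D \<Phi> y (Y y)) x u
      = D (\<lambda>y. D \<Phi> y (Y x)) x (D (\<lambda>y. y) x u) + D \<Phi> x (D Y x u)"
    by (rule D_linear_family(1)[OF S(1) S(1) _ S(3)])
       (auto intro: D_linear \<Phi>_diff D\<Phi>_diff smooth_on_differentiable[OF Y S(1,3)])
  then show "cov_deriv \<Gamma>' \<Phi> (\<lambda>y. D \<Phi> y (Y y)) x u - D \<Phi> x (cov_deriv \<Gamma> (\<lambda>y. y) Y x u)
      = second_fundamental_form \<Gamma> \<Gamma>' \<Phi> x u (Y x)"
    by (simp add: cov_deriv_def second_fundamental_form_def linear_add[OF lin])
qed

section \<open>Charts and tangent vectors\<close>

locale smooth_mfd =
  fixes M :: "('a, 'm::finite) riem"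
  assumes smooth_mfd: "smooth_manifold M"
begin

definition transition :: "('a, 'm) chart \<Rightarrow> ('a, 'm) chart \<Rightarrow> real ^ 'm \<Rightarrow> real ^ 'm" where
  "transition c c' z = snd c' (inv_chart c z)"

lemma transition_eq: "snd c' \<circ> inv_chart c = transition c c'"
  by (auto simp: transition_def)

lemma chart_open: "c \<in> atlas M \<Longrightarrow> openin (top_of M) (fst c)"
  and chart_homeo: "c \<in> atlas M \<Longrightarrow>
    homeomorphic_map (subtopology (top_of M) (fst c)) (top_of_set (snd c ` fst c)) (snd c)"
  and chart_image_open': "c \<in> atlas M \<Longrightarrow> open (snd c ` fst c)"
  and transition_smooth: "c \<in> atlas M \<Longrightarrow> c' \<in> atlas M \<Longrightarrow>
    smooth_on (snd c ` (fst c \<inter> fst c')) (transition c c')"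
  and charts_cover: "(\<Union>c\<in>atlas M. fst c) = pts M"
  using smooth_mfd unfolding smooth_manifold_def transition_eq by auto

lemma chart_subset: "c \<in> atlas M \<Longrightarrow> fst c \<subseteq> pts M"
  using chart_open openin_subset by blast

lemma inv_chart_left: "c \<in> atlas M \<Longrightarrow> p \<in> fst c \<Longrightarrow> inv_chart c (snd c p) = p"
proof -
  assume c: "c \<in> atlas M" "p \<in> fst c"
  have "inj_on (snd c) (fst c)"
    using homeomorphic_imp_injective_map[OF chart_homeo[OF c(1)]] chart_subset[OF c(1)]
    by (simp add: Int_absorb1)
  then show ?thesis using c(2) by (simp add: inv_chart_def)
qed

lemma chart_image_iff:
  "c \<in> atlas M \<Longrightarrow> z \<in> snd c ` (fst c \<inter> W) \<longleftrightarrow> z \<in> snd c ` fst c \<and> inv_chart c z \<in> W"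
  by (auto simp: inv_chart_left)

lemma chart_image_D:
  "z \<in> snd c ` fst c \<Longrightarrow> inv_chart c z \<in> fst c \<and> snd c (inv_chart c z) = z"
  by (metis f_inv_into_f inv_chart_def inv_into_into)

lemma chart_image_open:
  assumes "c \<in> atlas M" "openin (top_of M) W"
  shows "open (snd c ` (fst c \<inter> W))"
proof -
  have "openin (subtopology (top_of M) (fst c)) (fst c \<inter> W)"
    by (rule openin_subtopology_Int2[OF assms(2)])
  then have "openin (top_of_set (snd c ` fst c)) (snd c ` (fst c \<inter> W))"
    using homeomorphic_imp_open_map[OF chart_homeo[OF assms(1)]] by (simp add: open_map_def)
  then show ?thesis using chart_image_open'[OF assms(1)] openin_open_trans by blast
qed

lemma charts_atD: "c \<in> charts_at M p \<Longrightarrow> c \<in> atlas M \<and> p \<in> fst c \<and> p \<in> pts M"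
  unfolding charts_at_def using chart_subset by blast

lemma charts_atI: "c \<in> atlas M \<Longrightarrow> p \<in> fst c \<Longrightarrow> c \<in> charts_at M p"
  by (simp add: charts_at_def)

lemma inv_chart_charts_at: "c \<in> atlas M \<Longrightarrow> z \<in> snd c ` fst c \<Longrightarrow> c \<in> charts_at M (inv_chart c z)"
  using chart_image_D[of z c] by (simp add: charts_atI)

lemma chart_at: "p \<in> pts M \<Longrightarrow> chart_at M p \<in> charts_at M p"
proof -
  assume "p \<in> pts M"
  then have "\<exists>c. c \<in> charts_at M p" unfolding charts_cover[symmetric] by (auto simp: charts_at_def)
  then show ?thesis unfolding chart_at_def by (rule someI_ex)
qed

lemma overlap_open: "c \<in> atlas M \<Longrightarrow> c' \<in> atlas M \<Longrightarrow> open (snd c ` (fst c \<inter> fst c'))"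
  by (intro chart_image_open chart_open)

lemma transition_diff:
  assumes "c \<in> charts_at M p" "c' \<in> charts_at M p"
  shows "transition c c' differentiable (at (snd c p))"
  using assms[THEN charts_atD] by (intro smooth_on_differentiable[OF transition_smooth overlap_open]) auto

lemma transition_at: "c \<in> charts_at M p \<Longrightarrow> transition c c' (snd c p) = snd c' p"
  using charts_atD by (auto simp: transition_def inv_chart_left)

lemma D_transition_self: "c \<in> charts_at M p \<Longrightarrow> D (transition c c) (snd c p) u = u"
proof -
  assume c: "c \<in> charts_at M p"
  note c' = charts_atD[OF c]
  have "D (transition c c) (snd c p) = D (\<lambda>z. z) (snd c p)"
  proof (rule D_cong_open(1)[OF chart_image_open'[of c]])
    show "z = transition c c z" if "z \<in> snd c ` fst c" for z
      using chart_image_D[OF that] by (simp add: transition_def)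
  qed (use c' in auto)
  then show ?thesis by simp
qed

lemma D_transition_chain:
  assumes c: "c \<in> charts_at M p" "c' \<in> charts_at M p" "c'' \<in> charts_at M p"
  shows "D (transition c c'') (snd c p) u = D (transition c' c'') (snd c' p) (D (transition c c') (snd c p) u)"
proof -
  note at = c[THEN charts_atD]
  have "D (\<lambda>z. transition c' c'' (transition c c' z)) (snd c p) u
      = D (transition c' c'') (snd c' p) (D (transition c c') (snd c p) u)"
    by (subst D_chain[OF transition_diff[OF c(1,2)]])
       (use transition_diff[OF c(2,3)] transition_at[OF c(1)] in auto)
  moreover have "D (transition c c'') (snd c p) = D (\<lambda>z. transition c' c'' (transition c c' z)) (snd c p)"
  proof (rule sym, rule D_cong_open(1)[OF overlap_open[of c c']])
    fix z assume "z \<in> snd c ` (fst c \<inter> fst c')"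
    then show "transition c c'' z = transition c' c'' (transition c c' z)"
      using at by (auto simp: transition_def inv_chart_left)
  qed (use at transition_diff[OF c(1,3)] in auto)
  ultimately show ?thesis by simp
qed

lemma D_transition_inverse:
  assumes "c \<in> charts_at M p" "c' \<in> charts_at M p"
  shows "D (transition c' c) (snd c' p) (D (transition c c') (snd c p) u) = u"
  using D_transition_chain[OF assms assms(1), of u] D_transition_self[OF assms(1)] by simp

lemma surj_D_transition:
  assumes "c \<in> charts_at M p" "c' \<in> charts_at M p"
  shows "surj (D (transition c c') (snd c p))"
  by (rule surjI) (rule D_transition_inverse[OF assms(2,1)])

lemma tangent_transition:
  assumes "v \<in> tangent_space M p" "c \<in> charts_at M p" "c' \<in> charts_at M p"
  shows "v c' = D (transition c c') (snd c p) (v c)"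
  using assms unfolding tangent_space_def transition_eq by blast

lemma tangentI:
  assumes "\<And>c. c \<notin> charts_at M p \<Longrightarrow> v c = 0"
    and "\<And>c c'. c \<in> charts_at M p \<Longrightarrow> c' \<in> charts_at M p \<Longrightarrow> v c' = D (transition c c') (snd c p) (v c)"
  shows "v \<in> tangent_space M p"
  using assms unfolding tangent_space_def transition_eq by blast

lemma tangent_outside: "v \<in> tangent_space M p \<Longrightarrow> c \<notin> charts_at M p \<Longrightarrow> v c = 0"
  unfolding tangent_space_def by blast

lemma D_transition_linear:
  assumes "c \<in> charts_at M p" "c' \<in> charts_at M p"
  shows "linear (D (transition c c') (snd c p))"
  by (rule D_linear[OF transition_diff[OF assms]])

lemma coord_vec_apply:
  "c' \<in> charts_at M p \<Longrightarrow> coord_vec M c p u c' = D (transition c c') (snd c p) u"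
  by (simp add: coord_vec_def transition_eq)

lemma coord_vec_self: "c \<in> charts_at M p \<Longrightarrow> coord_vec M c p u c = u"
  by (simp add: coord_vec_apply D_transition_self)

lemma coord_vec_tangent: "c \<in> charts_at M p \<Longrightarrow> coord_vec M c p u \<in> tangent_space M p"
  by (rule tangentI) (auto simp: coord_vec_def transition_eq intro: D_transition_chain)

lemma tangent_eqI:
  assumes "u \<in> tangent_space M p" "v \<in> tangent_space M p" "c \<in> charts_at M p" "u c = v c"
  shows "u = v"
proof
  fix c' show "u c' = v c'"
    using tangent_transition[OF assms(1,3)] tangent_transition[OF assms(2,3)] assms(4)
      tangent_outside[OF assms(1)] tangent_outside[OF assms(2)]
    by (cases "c' \<in> charts_at M p") auto
qed

lemma tangent_add:
  "u \<in> tangent_space M p \<Longrightarrow> v \<in> tangent_space M p \<Longrightarrow> (\<lambda>c. u c + v c) \<in> tangent_space M p"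
  by (rule tangentI)
     (auto simp: tangent_outside linear_add[OF D_transition_linear] tangent_transition[symmetric])

lemma tangent_scaleR: "u \<in> tangent_space M p \<Longrightarrow> (\<lambda>c. a *\<^sub>R u c) \<in> tangent_space M p"
  by (rule tangentI)
     (auto simp: tangent_outside linear_cmul[OF D_transition_linear] tangent_transition[symmetric])

lemma tangent_diff:
  "u \<in> tangent_space M p \<Longrightarrow> v \<in> tangent_space M p \<Longrightarrow> (\<lambda>c. u c - v c) \<in> tangent_space M p"
  using tangent_add[of u p "\<lambda>c. (-1) *\<^sub>R v c"] tangent_scaleR[of v p "-1"] by simp

lemma tangent_zero: "(\<lambda>c. 0) \<in> tangent_space M p"
  by (rule tangentI) (auto simp: linear_0[OF D_transition_linear])

lemma tangent_sum:
  "(\<And>i. i \<in> I \<Longrightarrow> u i \<in> tangent_space M p) \<Longrightarrow> (\<lambda>c. \<Sum>i\<in>I. u i c) \<in> tangent_space M p"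
  by (induction I rule: infinite_finite_induct) (auto simp: tangent_zero tangent_add)

lemma tangent_coord:
  assumes "v \<in> tangent_space M p" "c \<in> charts_at M p"
  shows "coord_vec M c p (v c) = v"
  by (rule tangent_eqI[OF coord_vec_tangent[OF assms(2)] assms]) (simp add: coord_vec_self[OF assms(2)])

text \<open>By the chain rule any chart around \<open>p\<close> may replace the one picked in the definition of
  \<open>dir_deriv\<close>. All computations below fix one chart for a whole neighbourhood.\<close>

lemma dir_deriv_chart:
  assumes c: "c \<in> charts_at M p" and v: "v \<in> tangent_space M p"
    and f: "(\<lambda>z. f (inv_chart c z)) differentiable (at (snd c p))"
  shows "dir_deriv M p v f = D (\<lambda>z. f (inv_chart c z)) (snd c p) (v c)"
proof -
  define c0 where "c0 = chart_at M p"
  note at = charts_atD[OF c]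
  have c0: "c0 \<in> charts_at M p" unfolding c0_def using at by (intro chart_at) auto
  note at0 = charts_atD[OF c0]
  have eq: "D (f \<circ> inv_chart c0) (snd c0 p) = D (\<lambda>z. f (inv_chart c (transition c0 c z))) (snd c0 p)"
  proof (rule D_cong_open(1)[OF overlap_open[of c0 c]])
    show "f (inv_chart c (transition c0 c z)) = (f \<circ> inv_chart c0) z"
      if "z \<in> snd c0 ` (fst c0 \<inter> fst c)" for z
      using that at at0 by (auto simp: transition_def inv_chart_left)
    show "(\<lambda>z. f (inv_chart c (transition c0 c z))) differentiable (at (snd c0 p))"
      by (rule differentiable_chain[OF transition_diff[OF c0 c]]) (use f transition_at[OF c0] in simp)
  qed (use at at0 in auto)
  have "D (f \<circ> inv_chart c0) (snd c0 p) (v c0) = D (\<lambda>z. f (inv_chart c z)) (snd c p) (D (transition c0 c) (snd c0 p) (v c0))"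
    unfolding eq by (subst D_chain[OF transition_diff[OF c0 c]]) (use f transition_at[OF c0] in auto)
  also have "D (transition c0 c) (snd c0 p) (v c0) = v c"
    using tangent_transition[OF v c0 c] by simp
  finally show ?thesis unfolding dir_deriv_def c0_def Let_def .
qed

lemma smooth_coord_vec_field:
  assumes c: "c \<in> atlas M" and F: "smooth_on (snd c ` fst c) F"
  shows "smooth_vector_field_on M (fst c) (\<lambda>q. coord_vec M c q (F (snd c q)))"
  unfolding smooth_vector_field_on_def
proof (intro conjI ballI)
  show "coord_vec M c q (F (snd c q)) \<in> tangent_space M q" if "q \<in> fst c" for q
    by (rule coord_vec_tangent[OF charts_atI[OF c that]])
  fix c' assume c': "c' \<in> atlas M"
  show "smooth_on (snd c' ` (fst c' \<inter> fst c))
    (\<lambda>z. coord_vec M c (inv_chart c' z) (F (snd c (inv_chart c' z))) c')"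
  proof (rule smooth_on_cong[OF overlap_open[OF c' c]])
    let ?S = "snd c ` (fst c \<inter> fst c')"
    have sub: "transition c' c ` (snd c' ` (fst c' \<inter> fst c)) \<subseteq> ?S"
      using c' by (auto simp: transition_def inv_chart_left)
    have "smooth_on ?S F"
      by (rule smooth_on_subset[OF F]) auto
    then have F_smooth: "smooth_on (snd c' ` (fst c' \<inter> fst c)) (\<lambda>z. F (transition c' c z))"
      by (rule smooth_on_compose[OF overlap_open[OF c' c] overlap_open[OF c c'] sub
            transition_smooth[OF c' c]])
    show "smooth_on (snd c' ` (fst c' \<inter> fst c))
      (\<lambda>z. D (transition c c') (transition c' c z) (F (transition c' c z)))"
    proof (rule smooth_on_linear_family[OF overlap_open[OF c' c] overlap_open[OF c c'] sub
          transition_smooth[OF c' c] F_smooth])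
      show "linear (D (transition c c') z)" if "z \<in> ?S" for z
        by (rule D_linear[OF smooth_on_differentiable[OF transition_smooth[OF c c']
              overlap_open[OF c c'] that]])
      show "smooth_on ?S (\<lambda>z. D (transition c c') z v)" for v
        by (rule smooth_on_D[OF transition_smooth[OF c c']])
    qed
    fix z assume "z \<in> snd c' ` (fst c' \<inter> fst c)"
    then obtain q where q: "z = snd c' q" "q \<in> fst c'" "q \<in> fst c" by auto
    then show "D (transition c c') (transition c' c z) (F (transition c' c z))
      = coord_vec M c (inv_chart c' z) (F (snd c (inv_chart c' z))) c'"
      using c c' by (simp add: inv_chart_left transition_def[of c' c] coord_vec_apply charts_atI)
  qed
qed

end

section \<open>Riemannian metrics and orthonormal frames\<close>

lemma linear_sum_axis:
  fixes f :: "real ^ 'm::finite \<Rightarrow> 'b::real_vector"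
  assumes "linear f"
  shows "f v = (\<Sum>i\<in>UNIV. (v $ i) *\<^sub>R f (axis i 1))"
proof -
  have "f v = f (\<Sum>i\<in>UNIV. (v $ i) *\<^sub>R axis i 1)"
    using basis_expansion[of v] by (simp add: scalar_mult_eq_scaleR)
  then show ?thesis by (simp add: linear_sum[OF assms] linear_cmul[OF assms])
qed

text \<open>As functions of the coordinates, metric and Christoffel symbols of a chart fit the locale
  \<open>local_riemannian\<close>.\<close>

definition chart_metric :: "('a, 'm::finite) riem \<Rightarrow> ('a, 'm) chart \<Rightarrow>
    real ^ 'm \<Rightarrow> real ^ 'm \<Rightarrow> real ^ 'm \<Rightarrow> real" where
  "chart_metric M c z u v =
     rmetric M (inv_chart c z) (coord_vec M c (inv_chart c z) u) (coord_vec M c (inv_chart c z) v)"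

definition chart_christoffel :: "('a, 'm::finite) riem \<Rightarrow> ('a, 'm) chart \<Rightarrow>
    real ^ 'm \<Rightarrow> real ^ 'm \<Rightarrow> real ^ 'm \<Rightarrow> real ^ 'm" where
  "chart_christoffel M c z = christoffel_form M c (inv_chart c z)"

locale riem_mfd =
  fixes M :: "('a, 'm::finite) riem"
  assumes riem: "riemannian_manifold M"
begin

sublocale smooth_mfd M
  by unfold_locales (use riem in \<open>simp add: riemannian_manifold_def\<close>)

lemma rmetric_sym:
  "u \<in> tangent_space M p \<Longrightarrow> v \<in> tangent_space M p \<Longrightarrow> p \<in> pts M \<Longrightarrow> rmetric M p u v = rmetric M p v u"
  and rmetric_pos:
  "u \<in> tangent_space M p \<Longrightarrow> p \<in> pts M \<Longrightarrow> u \<noteq> (\<lambda>c. 0) \<Longrightarrow> rmetric M p u u > 0"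
  and rmetric_lin:
  "u \<in> tangent_space M p \<Longrightarrow> v \<in> tangent_space M p \<Longrightarrow> w \<in> tangent_space M p \<Longrightarrow> p \<in> pts M \<Longrightarrow>
    rmetric M p (\<lambda>c. a *\<^sub>R u c + b *\<^sub>R v c) w = a * rmetric M p u w + b * rmetric M p v w"
  using riem unfolding riemannian_manifold_def by blast+

lemma rmetric_chart:
  assumes "u \<in> tangent_space M p" "v \<in> tangent_space M p" "c \<in> charts_at M p"
  shows "rmetric M p u v = chart_metric M c (snd c p) (u c) (v c)"
  using assms charts_atD[OF assms(3)] by (simp add: chart_metric_def inv_chart_left tangent_coord)

lemma chart_metric_form:
  assumes c: "c \<in> atlas M" and z: "z \<in> snd c ` fst c"
  shows "inner_form (chart_metric M c z)"
proof -
  define p where "p = inv_chart c z"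
  have p: "c \<in> charts_at M p" "p \<in> pts M"
    using charts_atD[OF inv_chart_charts_at[OF c z]] inv_chart_charts_at[OF c z] by (auto simp: p_def)
  note tan = coord_vec_tangent[OF p(1)]
  have comb: "coord_vec M c p (a *\<^sub>R u + b *\<^sub>R v) = (\<lambda>c'. a *\<^sub>R coord_vec M c p u c' + b *\<^sub>R coord_vec M c p v c')"
    for a b u v
    by (rule tangent_eqI[OF tan _ p(1)])
       (auto intro!: tangent_add tangent_scaleR tan simp: coord_vec_self[OF p(1)])
  have sym: "chart_metric M c z u v = chart_metric M c z v u" for u v
    unfolding chart_metric_def p_def[symmetric] by (rule rmetric_sym[OF tan tan p(2)])
  have lin: "chart_metric M c z w (a *\<^sub>R u + b *\<^sub>R v) = a * chart_metric M c z w u + b * chart_metric M c z w v" for a b u v w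
    unfolding sym[of w] unfolding chart_metric_def p_def[symmetric] comb
    by (rule rmetric_lin[OF tan tan tan p(2)])
  show ?thesis
  proof (rule inner_form.intro)
    show "linear (chart_metric M c z u)" for u
      using lin[of u 1 _ 1] lin[of u _ _ 0] by (intro linearI) auto
    show "chart_metric M c z u v = chart_metric M c z v u" for u v by (rule sym)
    show "chart_metric M c z u u > 0" if "u \<noteq> 0" for u
      unfolding chart_metric_def p_def[symmetric]
      using coord_vec_self[OF p(1), of u] that by (intro rmetric_pos[OF tan p(2)]) auto
  qed
qed

lemma chart_metric_axis:
  "metric_matrix M c (inv_chart c z) $ i $ j = chart_metric M c z (axis i 1) (axis j 1)"
  by (simp add: metric_matrix_def chart_metric_def)

lemma chart_metric_expansion:
  assumes "c \<in> atlas M" "z \<in> snd c ` fst c"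
  shows "chart_metric M c z u v
    = (\<Sum>i\<in>UNIV. \<Sum>j\<in>UNIV. (u $ i * v $ j) *\<^sub>R chart_metric M c z (axis i 1) (axis j 1))"
proof -
  interpret inner_form "chart_metric M c z" by (rule chart_metric_form[OF assms])
  show ?thesis
    by (subst linear_sum_axis[OF linear_left], subst linear_sum_axis[OF linear_right])
       (simp add: sum_distrib_left mult.assoc)
qed

lemma local_metric:
  assumes c: "c \<in> atlas M"
  shows "local_metric (snd c ` fst c) (chart_metric M c)"
proof (rule local_metric.intro)
  show "open (snd c ` fst c)" by (rule chart_image_open'[OF c])
  show "inner_form (chart_metric M c z)" if "z \<in> snd c ` fst c" for z by (rule chart_metric_form[OF c that])
  have "smooth_on (snd c ` fst c) (\<lambda>z. chart_metric M c z (axis i 1) (axis j 1))" for i j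
    using riem c unfolding riemannian_manifold_def chart_metric_axis by blast
  then have "smooth_on (snd c ` fst c) (\<lambda>z. \<Sum>i\<in>UNIV. \<Sum>j\<in>UNIV.
      (u $ i * v $ j) *\<^sub>R chart_metric M c z (axis i 1) (axis j 1))" for u v :: "real ^ 'm"
    by (intro smooth_on_sum smooth_on_bounded_linear[OF _ bounded_linear_scaleR_right]
        chart_image_open'[OF c])
  then show "smooth_on (snd c ` fst c) (\<lambda>z. chart_metric M c z u v)" for u v
    by (rule smooth_on_cong[OF chart_image_open'[OF c]]) (rule chart_metric_expansion[OF c, symmetric])
qed

text \<open>The definition of the Christoffel symbols is \<open>\<Gamma>(u,v) = G\<^sup>-\<^sup>1 S\<close>, where \<open>G\<close> is the matrix of the metric and
  \<open>2 \<langle>S, w\<rangle>\<close> is the right-hand side of Koszul's formula. Hence \<open>g(\<Gamma>(u,v), w) = \<langle>S, w\<rangle>\<close>.\<close>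

lemma local_riemannian:
  assumes c: "c \<in> atlas M"
  shows "local_riemannian (snd c ` fst c) (chart_metric M c) (chart_christoffel M c)"
proof -
  interpret local_metric "snd c ` fst c" "chart_metric M c" by (rule local_metric[OF c])
  show ?thesis
  proof unfold_locales
    fix z u v w assume z: "z \<in> snd c ` fst c"
    interpret f: inner_form "chart_metric M c z" by (rule form[OF z])
    define T where "T u v w = D (\<lambda>z. chart_metric M c z v w) z u" for u v w
    define G where "G = metric_matrix M c (inv_chart c z)"
    define S where "S = (\<chi> l. \<Sum>i\<in>UNIV. \<Sum>j\<in>UNIV. (1/2) * (T (axis i 1) (axis j 1) (axis l 1)
      + T (axis j 1) (axis i 1) (axis l 1) - T (axis l 1) (axis i 1) (axis j 1)) * u $ i * v $ j)"
    have G: "chart_metric M c z x y = x \<bullet> (G *v y)" for x y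
      by (subst chart_metric_expansion[OF c z])
         (simp add: inner_vec_def matrix_vector_mult_def G_def chart_metric_axis sum_distrib_left mult_ac)
    have "G *v x = 0 \<Longrightarrow> x = 0" for x
      using G[of x x] f.pos[of x] by force
    then have "invertible G"
      by (simp add: invertible_left_inverse matrix_left_invertible_ker)
    then have "G ** matrix_inv G = mat 1"
      unfolding invertible_def matrix_inv_def by (rule someI_ex[THEN conjunct1])
    then have Ginv: "G *v (matrix_inv G *v x) = x" for x
      by (simp add: matrix_vector_mul_assoc)
    have T: "metric_partial M c (inv_chart c z) l i j = T (axis l 1) (axis i 1) (axis j 1)" for l i j
      using chart_image_D[OF z] by (simp add: metric_partial_def T_def chart_metric_axis)
    have \<Gamma>: "chart_christoffel M c z u v = matrix_inv G *v S"
    proof (rule vec_eq_iff[THEN iffD2], intro allI)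
      fix k
      have "chart_christoffel M c z u v $ k = (\<Sum>i\<in>UNIV. \<Sum>j\<in>UNIV. \<Sum>l\<in>UNIV. matrix_inv G $ k $ l *
        ((1/2) * (T (axis i 1) (axis j 1) (axis l 1)
      + T (axis j 1) (axis i 1) (axis l 1) - T (axis l 1) (axis i 1) (axis j 1)) * u $ i * v $ j))"
        by (simp add: chart_christoffel_def christoffel_form_def christoffel_def T G_def[symmetric]
            sum_distrib_left sum_distrib_right mult.assoc mult.left_commute)
      also have "\<dots> = (\<Sum>l\<in>UNIV. \<Sum>i\<in>UNIV. \<Sum>j\<in>UNIV. matrix_inv G $ k $ l *
        ((1/2) * (T (axis i 1) (axis j 1) (axis l 1)
      + T (axis j 1) (axis i 1) (axis l 1) - T (axis l 1) (axis i 1) (axis j 1)) * u $ i * v $ j))"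
        by (subst (2) sum.swap, subst sum.swap, rule refl)
      also have "\<dots> = (matrix_inv G *v S) $ k"
        by (simp add: matrix_vector_mult_def S_def sum_distrib_left)
      finally show "chart_christoffel M c z u v $ k = (matrix_inv G *v S) $ k" .
    qed
    have "chart_metric M c z (chart_christoffel M c z u v) w = S \<bullet> w"
      by (subst f.sym) (simp add: G \<Gamma> Ginv inner_commute)
    also have "2 * (S \<bullet> w) = T u v w + T v u w - T w u v"
    proof -
      have lin: "linear (\<lambda>u. T u v w)" "linear (\<lambda>v. T u v w)" "linear (T u v)" for u v w
        unfolding T_def using D_g_linear[OF z] by auto
      have T3: "T u v w = (\<Sum>l\<in>UNIV. \<Sum>i\<in>UNIV. \<Sum>j\<in>UNIV. w $ l * (u $ i * (v $ j * T (axis i 1) (axis j 1) (axis l 1))))" for u v w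
        by (subst linear_sum_axis[OF lin(3)], subst linear_sum_axis[OF lin(1)], subst linear_sum_axis[OF lin(2)])
           (simp add: sum_distrib_left)
      have a: "T v u w = (\<Sum>l\<in>UNIV. \<Sum>i\<in>UNIV. \<Sum>j\<in>UNIV. w $ l * (u $ i * (v $ j * T (axis j 1) (axis i 1) (axis l 1))))"
        by (subst T3, rule sum.cong[OF refl], subst sum.swap) (simp add: mult.left_commute)
      have b: "T w u v = (\<Sum>l\<in>UNIV. \<Sum>i\<in>UNIV. \<Sum>j\<in>UNIV. w $ l * (u $ i * (v $ j * T (axis l 1) (axis i 1) (axis j 1))))"
        by (subst linear_sum_axis[OF lin(1)], subst linear_sum_axis[OF lin(2)], subst linear_sum_axis[OF lin(3)])
           (simp add: sum_distrib_left)
      show ?thesis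
        unfolding T3[of u v w] a b
        by (simp add: inner_vec_def S_def sum_distrib_left sum_distrib_right sum.distrib[symmetric]
            sum_subtractf[symmetric] algebra_simps)
    qed
    finally show "2 * chart_metric M c z (chart_christoffel M c z u v) w =
       D (\<lambda>z. chart_metric M c z v w) z u + D (\<lambda>z. chart_metric M c z u w) z v
         - D (\<lambda>z. chart_metric M c z u v) z w"
      by (simp add: T_def)
  qed
qed

lemma chart_metric_isometry:
  assumes c: "c \<in> atlas M" "c' \<in> atlas M" and z: "z \<in> snd c ` (fst c \<inter> fst c')"
  shows "chart_metric M c z u v
    = chart_metric M c' (transition c c' z) (D (transition c c') z u) (D (transition c c') z v)"
proof -
  define p where "p = inv_chart c z"
  have z': "z = snd c p" and p: "p \<in> fst c" "p \<in> fst c'"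
    using z c chart_image_iff[of c z "fst c'"] chart_image_D[of z c] by (auto simp: p_def)
  have at: "c \<in> charts_at M p" "c' \<in> charts_at M p" using c p by (auto intro: charts_atI)
  note tan = coord_vec_tangent[OF at(1)]
  have "chart_metric M c z u v = rmetric M p (coord_vec M c p u) (coord_vec M c p v)"
    by (simp add: chart_metric_def p_def)
  also have "\<dots> = chart_metric M c' (snd c' p) (coord_vec M c p u c') (coord_vec M c p v c')"
    by (rule rmetric_chart[OF tan tan at(2)])
  finally show ?thesis
    by (simp add: coord_vec_apply[OF at(2)] z' transition_at[OF at(1)])
qed

text \<open>The orthonormal frame on the coordinate image is carried back to the chart domain.\<close>

lemma local_orthonormal_frame_exists:
  assumes "p \<in> pts M"
  shows "\<exists>e. local_orthonormal_frame M p e"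
proof -
  obtain c where c: "c \<in> atlas M" "p \<in> fst c" using chart_at[OF assms] charts_atD by blast
  interpret local_metric "snd c ` fst c" "chart_metric M c" by (rule local_metric[OF c(1)])
  obtain E :: "real ^ 'm \<Rightarrow> real ^ 'm \<Rightarrow> real ^ 'm" where E: "\<And>b. b \<in> Basis \<Longrightarrow> smooth_on (snd c ` fst c) (E b)"
    "\<And>z. z \<in> snd c ` fst c \<Longrightarrow> inner_form.orthonormal (chart_metric M c z) (\<lambda>b. E b z) Basis"
    using smooth_frame by metis
  define e where "e \<alpha> q = coord_vec M c q (E (axis \<alpha> 1) (snd c q))" for \<alpha> q
  have basis: "axis \<alpha> 1 \<in> (Basis :: (real ^ 'm) set)" for \<alpha> by (simp add: axis_in_Basis_iff)
  have e_smooth: "smooth_vector_field_on M (fst c) (e \<alpha>)" for \<alpha>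
    unfolding e_def by (rule smooth_coord_vec_field[OF c(1) E(1)[OF basis]])
  have e_orth: "orthonormal_basis_at M q (\<lambda>\<alpha>. e \<alpha> q)" if q: "q \<in> fst c" for q
  proof -
    have at: "c \<in> charts_at M q" by (rule charts_atI[OF c(1) q])
    have z: "snd c q \<in> snd c ` fst c" using q by blast
    interpret f: inner_form "chart_metric M c (snd c q)" by (rule form[OF z])
    note tan = coord_vec_tangent[OF at]
    show ?thesis
      unfolding orthonormal_basis_at_def e_def
      using E(2)[OF z] basis tan
      by (auto simp: rmetric_chart[OF tan tan at] coord_vec_self[OF at] f.orthonormal_def axis_eq_axis)
  qed
  show ?thesis
    unfolding local_orthonormal_frame_def
    using chart_open[OF c(1)] c(2) e_smooth e_orth by blast
qed

lemma frame: "p \<in> pts M \<Longrightarrow> local_orthonormal_frame M p (frame M p)"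
  unfolding frame_def by (rule someI_ex[OF local_orthonormal_frame_exists])

lemma frame_orthonormal: "p \<in> pts M \<Longrightarrow> orthonormal_basis_at M p (\<lambda>\<alpha>. frame M p \<alpha> p)"
  using frame unfolding local_orthonormal_frame_def by blast

lemma orthonormal_basis_chart:
  assumes "orthonormal_basis_at M p e" "c \<in> charts_at M p"
  shows "inner_form.orthonormal (chart_metric M c (snd c p)) (\<lambda>\<alpha>. e \<alpha> c) UNIV"
proof -
  interpret f: inner_form "chart_metric M c (snd c p)"
    by (rule chart_metric_form) (use charts_atD[OF assms(2)] in auto)
  show ?thesis
    using assms(1) unfolding orthonormal_basis_at_def f.orthonormal_def
    by (simp add: rmetric_chart[OF _ _ assms(2), symmetric])
qed

lemma rmetric_sum_left:
  assumes "p \<in> pts M" "\<And>i. i \<in> I \<Longrightarrow> u i \<in> tangent_space M p" "w \<in> tangent_space M p"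
  shows "rmetric M p (\<lambda>c. \<Sum>i\<in>I. u i c) w = (\<Sum>i\<in>I. rmetric M p (u i) w)"
proof -
  note at = chart_at[OF assms(1)]
  interpret f: inner_form "chart_metric M (chart_at M p) (snd (chart_at M p) p)"
    by (rule chart_metric_form) (use charts_atD[OF at] in auto)
  show ?thesis
    by (simp add: rmetric_chart[OF tangent_sum[OF assms(2)] assms(3) at] f.form_simps
        rmetric_chart[OF assms(2) assms(3) at])
qed

lemma rmetric_diff_left:
  assumes "p \<in> pts M" "u \<in> tangent_space M p" "v \<in> tangent_space M p" "w \<in> tangent_space M p"
  shows "rmetric M p (\<lambda>c. u c - v c) w = rmetric M p u w - rmetric M p v w"
  using rmetric_lin[OF assms(2,3,4,1), of 1 "-1"] by simp

lemma rmetric_nonneg: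
  assumes "p \<in> pts M" "u \<in> tangent_space M p"
  shows "rmetric M p u u \<ge> 0"
proof (cases "u = (\<lambda>c. 0)")
  case True
  then show ?thesis using rmetric_lin[OF tangent_zero tangent_zero tangent_zero assms(1), of 0 0] by simp
next
  case False
  then show ?thesis using rmetric_pos[OF assms(2,1)] by simp
qed

end

section \<open>Smooth sections along a map\<close>

lemma cov_deriv_cong:
  assumes "open T" "x \<in> T" "\<And>y. y \<in> T \<Longrightarrow> \<Phi> y = \<Phi>' y" "\<And>y. y \<in> T \<Longrightarrow> V y = V' y"
    and "\<Phi> differentiable (at x)" "V differentiable (at x)"
  shows "cov_deriv \<Gamma> \<Phi> V x u = cov_deriv \<Gamma> \<Phi>' V' x u"
  using D_cong_open(1)[OF assms(1,2,3,5)] D_cong_open(1)[OF assms(1,2,4,6)] assms(2-4)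
  by (simp add: cov_deriv_def)

locale riem_map = M: riem_mfd M + N: riem_mfd N
  for M :: "('a, 'm::finite) riem" and N :: "('b, 'n::finite) riem" +
  fixes \<phi> :: "'a \<Rightarrow> 'b"
  assumes smooth_map: "smooth_map M N \<phi>"
begin

definition rep_dom :: "('a, 'm) chart \<Rightarrow> 'a set \<Rightarrow> ('b, 'n) chart \<Rightarrow> (real ^ 'm) set" where
  "rep_dom c W d = snd c ` (fst c \<inter> (W \<inter> \<phi> -` fst d))"

definition rep :: "('a, 'm) chart \<Rightarrow> ('b, 'n) chart \<Rightarrow> real ^ 'm \<Rightarrow> real ^ 'n" where
  "rep c d z = snd d (\<phi> (inv_chart c z))"

definition smooth_section :: "'a set \<Rightarrow> ('a \<Rightarrow> ('b, 'n) tvec) \<Rightarrow> bool" where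
  "smooth_section W V \<longleftrightarrow> (\<forall>q\<in>W. V q \<in> tangent_space N (\<phi> q)) \<and>
     (\<forall>c\<in>atlas M. \<forall>d\<in>atlas N. smooth_on (rep_dom c W d) (\<lambda>z. V (inv_chart c z) d))"

lemma map_pts: "p \<in> pts M \<Longrightarrow> \<phi> p \<in> pts N"
  using smooth_map unfolding smooth_map_def by (auto dest: continuous_map_image_subset_topspace)

lemma open_preimage:
  assumes "openin (top_of M) W" "d \<in> atlas N"
  shows "openin (top_of M) (W \<inter> \<phi> -` fst d)"
proof -
  have "openin (top_of M) {x \<in> pts M. \<phi> x \<in> fst d}"
    using smooth_map N.chart_open[OF assms(2)] unfolding smooth_map_def
    by (auto intro: openin_continuous_map_preimage)
  then have "openin (top_of M) (W \<inter> {x \<in> pts M. \<phi> x \<in> fst d})" using assms(1) by blast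
  also have "W \<inter> {x \<in> pts M. \<phi> x \<in> fst d} = W \<inter> \<phi> -` fst d"
    using openin_subset[OF assms(1)] by auto
  finally show ?thesis .
qed

lemma rep_dom_open: "openin (top_of M) W \<Longrightarrow> c \<in> atlas M \<Longrightarrow> d \<in> atlas N \<Longrightarrow> open (rep_dom c W d)"
  unfolding rep_dom_def by (intro M.chart_image_open open_preimage)

lemma rep_smooth:
  assumes "c \<in> atlas M" "d \<in> atlas N"
  shows "smooth_on (rep_dom c W d) (rep c d)"
proof -
  have "snd d \<circ> \<phi> \<circ> inv_chart c = rep c d" by (auto simp: rep_def)
  then have "smooth_on (snd c ` (fst c \<inter> \<phi> -` fst d)) (rep c d)"
    using smooth_map assms unfolding smooth_map_def by metis
  then show ?thesis by (rule smooth_on_subset) (auto simp: rep_dom_def)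
qed

lemma rep_dom_subset: "rep_dom c W d \<subseteq> snd c ` fst c" "rep_dom c W d \<subseteq> snd c ` (fst c \<inter> W)"
  by (auto simp: rep_dom_def)

lemma rep_dom_point:
  assumes "c \<in> charts_at M q" "d \<in> charts_at N (\<phi> q)" "q \<in> W"
  shows "snd c q \<in> rep_dom c W d" "rep c d (snd c q) = snd d (\<phi> q)"
  using assms M.charts_atD[OF assms(1)] N.charts_atD[OF assms(2)]
  by (auto simp: rep_dom_def rep_def M.inv_chart_left)

lemma rep_dom_cases:
  assumes "z \<in> rep_dom c W d" "c \<in> atlas M" "d \<in> atlas N"
  obtains q where "z = snd c q" "q \<in> W" "c \<in> charts_at M q" "d \<in> charts_at N (\<phi> q)"
    "inv_chart c z = q" "rep c d z = snd d (\<phi> q)"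
  using assms by (auto simp: rep_dom_def rep_def M.inv_chart_left M.charts_atI N.charts_atI)

lemma rep_image:
  assumes "c \<in> atlas M" "d \<in> atlas N"
  shows "rep c d ` rep_dom c W d \<subseteq> snd d ` fst d"
proof
  fix y assume "y \<in> rep c d ` rep_dom c W d"
  then obtain z where "z \<in> rep_dom c W d" "y = rep c d z" by auto
  then show "y \<in> snd d ` fst d" using assms by (auto elim!: rep_dom_cases dest: N.charts_atD)
qed

lemma charts_atlas: "c \<in> charts_at M q \<Longrightarrow> c \<in> atlas M" "d \<in> charts_at N q' \<Longrightarrow> d \<in> atlas N"
  using M.charts_atD N.charts_atD by blast+

lemma rep_diff:
  assumes "c \<in> charts_at M q" "d \<in> charts_at N (\<phi> q)"
  shows "rep c d differentiable (at (snd c q))"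
proof -
  have "q \<in> pts M" using M.charts_atD[OF assms(1)] by blast
  then show ?thesis
    by (intro smooth_on_differentiable[OF rep_smooth rep_dom_open[OF openin_topspace] rep_dom_point(1)[OF assms]]
        charts_atlas(1)[OF assms(1)] charts_atlas(2)[OF assms(2)])
qed

lemma D_rep_change:
  assumes c: "c \<in> charts_at M q" and d: "d \<in> charts_at N (\<phi> q)" "d' \<in> charts_at N (\<phi> q)"
  shows "D (rep c d') (snd c q) u = D (N.transition d d') (snd d (\<phi> q)) (D (rep c d) (snd c q) u)"
proof -
  note atl = charts_atlas(1)[OF c] charts_atlas(2)[OF d(1)] charts_atlas(2)[OF d(2)]
  have q: "q \<in> pts M" "\<phi> q \<in> fst d'" using M.charts_atD[OF c] N.charts_atD[OF d(2)] by auto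
  let ?W = "pts M \<inter> \<phi> -` fst d'"
  have diff: "N.transition d d' differentiable (at (rep c d (snd c q)))"
    unfolding rep_dom_point(2)[OF c d(1) q(1)] by (rule N.transition_diff[OF d])
  have "D (rep c d') (snd c q) = D (\<lambda>z. N.transition d d' (rep c d z)) (snd c q)"
  proof (rule D_cong_open(1)[OF rep_dom_open[OF open_preimage[OF openin_topspace atl(3)] atl(1,2)], THEN sym])
    show "snd c q \<in> rep_dom c ?W d" by (rule rep_dom_point[OF c d(1)]) (use q in auto)
    show "rep c d' z = N.transition d d' (rep c d z)" if "z \<in> rep_dom c ?W d" for z
      using that atl
      by (auto elim!: rep_dom_cases simp: N.transition_at rep_def)
  qed (rule rep_diff[OF c d(2)])
  then show ?thesis
    by (simp add: D_chain[OF rep_diff[OF c d(1)] diff] rep_dom_point(2)[OF c d(1) q(1)])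
qed

lemma differential_chart:
  assumes c: "c \<in> charts_at M q" and d: "d \<in> charts_at N (\<phi> q)" and v: "v \<in> tangent_space M q"
  shows "differential M N \<phi> q v d = D (rep c d) (snd c q) (v c)"
  using M.dir_deriv_chart[OF c v, of "\<lambda>q. snd d (\<phi> q)"] rep_diff[OF c d] d
  by (simp add: differential_def rep_def[abs_def])

lemma differential_tangent:
  assumes v: "v \<in> tangent_space M q" and q: "q \<in> pts M"
  shows "differential M N \<phi> q v \<in> tangent_space N (\<phi> q)"
proof (rule N.tangentI)
  note c = M.chart_at[OF q]
  fix d d' assume d: "d \<in> charts_at N (\<phi> q)" "d' \<in> charts_at N (\<phi> q)"
  show "differential M N \<phi> q v d' = D (N.transition d d') (snd d (\<phi> q)) (differential M N \<phi> q v d)"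
    unfolding differential_chart[OF c d(1) v] differential_chart[OF c d(2) v] by (rule D_rep_change[OF c d])
qed (simp add: differential_def)

lemma smooth_section_tangent: "smooth_section W V \<Longrightarrow> q \<in> W \<Longrightarrow> V q \<in> tangent_space N (\<phi> q)"
  and smooth_section_smooth: "smooth_section W V \<Longrightarrow> c \<in> atlas M \<Longrightarrow> d \<in> atlas N \<Longrightarrow>
    smooth_on (rep_dom c W d) (\<lambda>z. V (inv_chart c z) d)"
  by (auto simp: smooth_section_def)

lemma vector_field_tangent: "smooth_vector_field_on M W X \<Longrightarrow> q \<in> W \<Longrightarrow> X q \<in> tangent_space M q"
  and vector_field_smooth: "smooth_vector_field_on M W X \<Longrightarrow> c \<in> atlas M \<Longrightarrow>
    smooth_on (rep_dom c W d) (\<lambda>z. X (inv_chart c z) c)"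
  unfolding smooth_vector_field_on_def using smooth_on_subset[OF _ rep_dom_subset(2)] by blast+

lemma smooth_section_differential:
  assumes W: "openin (top_of M) W" and X: "smooth_vector_field_on M W X"
  shows "smooth_section W (\<lambda>q. differential M N \<phi> q (X q))"
  unfolding smooth_section_def
proof (intro conjI ballI)
  show "differential M N \<phi> q (X q) \<in> tangent_space N (\<phi> q)" if "q \<in> W" for q
    using vector_field_tangent[OF X that] that openin_subset[OF W] by (intro differential_tangent) auto
  fix c d assume cd: "c \<in> atlas M" "d \<in> atlas N"
  show "smooth_on (rep_dom c W d) (\<lambda>z. differential M N \<phi> (inv_chart c z) (X (inv_chart c z)) d)"
  proof (rule smooth_on_cong[OF rep_dom_open[OF W cd]])
    show "smooth_on (rep_dom c W d) (\<lambda>z. D (rep c d) z (X (inv_chart c z) c))"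
      by (rule smooth_on_D_arg[OF rep_dom_open[OF W cd] rep_smooth[OF cd] vector_field_smooth[OF X cd(1)]])
    show "D (rep c d) z (X (inv_chart c z) c) = differential M N \<phi> (inv_chart c z) (X (inv_chart c z)) d"
      if z: "z \<in> rep_dom c W d" for z
      by (rule rep_dom_cases[OF z cd]) (simp add: differential_chart vector_field_tangent[OF X])
  qed
qed

lemma section_diff:
  assumes W: "openin (top_of M) W" and V: "smooth_section W V" and q: "q \<in> W"
    and c: "c \<in> charts_at M q" and d: "d \<in> charts_at N (\<phi> q)"
  shows "(\<lambda>z. V (inv_chart c z) d) differentiable (at (snd c q))"
  by (rule smooth_on_differentiable[OF smooth_section_smooth[OF V] rep_dom_open[OF W]])
     (use charts_atlas(1)[OF c] charts_atlas(2)[OF d] rep_dom_point[OF c d q] in auto)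

lemma nabla_pb_chart:
  assumes W: "openin (top_of M) W" and V: "smooth_section W V" and q: "q \<in> W"
    and x: "x \<in> tangent_space M q"
    and c: "c \<in> charts_at M q" and d: "d \<in> charts_at N (\<phi> q)"
  shows "nabla_pb M N \<phi> q x V d
    = cov_deriv (chart_christoffel N d) (rep c d) (\<lambda>z. V (inv_chart c z) d) (snd c q) (x c)"
proof -
  have "dir_deriv M q x (\<lambda>q. V q d) = D (\<lambda>z. V (inv_chart c z) d) (snd c q) (x c)"
    by (rule M.dir_deriv_chart[OF c x section_diff[OF W V q c d]])
  then show ?thesis
    using d N.charts_atD[OF d] M.charts_atD[OF c]
    by (simp add: nabla_pb_def cov_deriv_def differential_chart[OF c d x] chart_christoffel_def
        rep_dom_point(2)[OF c d q] N.inv_chart_left M.inv_chart_left)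
qed

text \<open>For two charts of \<open>N\<close> the transition map is an isometry of the coordinate metrics, so the two
  components are related by \<open>cov_deriv_transformation\<close>.\<close>

lemma nabla_pb_tangent:
  assumes W: "openin (top_of M) W" and V: "smooth_section W V" and q: "q \<in> W"
    and x: "x \<in> tangent_space M q"
  shows "nabla_pb M N \<phi> q x V \<in> tangent_space N (\<phi> q)"
proof (rule N.tangentI)
  have "q \<in> pts M" using q openin_subset[OF W] by auto
  note c = M.chart_at[OF this]
  define c' where "c' = chart_at M q"
  note c = c[folded c'_def]
  fix d d' assume d: "d \<in> charts_at N (\<phi> q)" "d' \<in> charts_at N (\<phi> q)"
  note atl = charts_atlas(1)[OF c] charts_atlas(2)[OF d(1)] charts_atlas(2)[OF d(2)]
  let ?W = "W \<inter> \<phi> -` fst d'"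
  let ?S = "snd d ` (fst d \<inter> fst d')"
  have W': "openin (top_of M) ?W" by (rule open_preimage[OF W atl(3)])
  have T: "open (rep_dom c' ?W d)" by (rule rep_dom_open[OF W' atl(1,2)])
  have qT: "snd c' q \<in> rep_dom c' ?W d" using q N.charts_atD[OF d(2)] by (intro rep_dom_point c d) auto
  have V_smooth: "smooth_on (rep_dom c' ?W d) (\<lambda>z. V (inv_chart c' z) d)"
    by (rule smooth_on_subset[OF smooth_section_smooth[OF V atl(1,2)]]) (auto simp: rep_dom_def)
  have points: "rep c' d' z = N.transition d d' (rep c' d z) \<and> rep c' d z \<in> ?S \<and>
      V (inv_chart c' z) d' = D (N.transition d d') (rep c' d z) (V (inv_chart c' z) d)"
    if z: "z \<in> rep_dom c' ?W d" for z
  proof (rule rep_dom_cases[OF z atl(1,2)])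
    fix p assume p: "z = snd c' p" "p \<in> ?W" "c' \<in> charts_at M p" "d \<in> charts_at N (\<phi> p)"
      "inv_chart c' z = p" "rep c' d z = snd d (\<phi> p)"
    then have "d' \<in> charts_at N (\<phi> p)" using atl by (auto intro: N.charts_atI)
    then show ?thesis
      using p N.charts_atD[OF p(4)] N.tangent_transition[OF smooth_section_tangent[OF V] p(4), of d']
      by (auto simp: rep_def N.transition_at)
  qed
  have "nabla_pb M N \<phi> q x V d'
      = cov_deriv (chart_christoffel N d') (rep c' d') (\<lambda>z. V (inv_chart c' z) d') (snd c' q) (x c')"
    by (rule nabla_pb_chart[OF W V q x c d(2)])
  also have "\<dots> = cov_deriv (chart_christoffel N d') (\<lambda>z. N.transition d d' (rep c' d z))
      (\<lambda>z. D (N.transition d d') (rep c' d z) (V (inv_chart c' z) d)) (snd c' q) (x c')"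
    by (rule cov_deriv_cong[OF T qT])
       (use points rep_diff[OF c d(2)] section_diff[OF W V q c d(2)] in auto)
  also have "\<dots> = D (N.transition d d') (rep c' d (snd c' q))
      (cov_deriv (chart_christoffel N d) (rep c' d) (\<lambda>z. V (inv_chart c' z) d) (snd c' q) (x c'))"
  proof (rule cov_deriv_transformation[OF N.local_riemannian[OF atl(2)] N.local_riemannian[OF atl(3)]
        N.overlap_open[OF atl(2,3)] _ N.transition_smooth[OF atl(2,3)] _
        N.chart_metric_isometry[OF atl(2,3)] T qT])
    show "smooth_on (rep_dom c' ?W d) (rep c' d)" by (rule rep_smooth[OF atl(1,2)])
    show "N.transition d d' ` ?S \<subseteq> snd d' ` fst d'"
      using atl by (auto simp: N.transition_def N.inv_chart_left)
    show "surj (D (N.transition d d') (rep c' d (snd c' q)))"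
      unfolding rep_dom_point(2)[OF c d(1) q] by (rule N.surj_D_transition[OF d])
  qed (use V_smooth points in auto)
  also have "cov_deriv (chart_christoffel N d) (rep c' d) (\<lambda>z. V (inv_chart c' z) d) (snd c' q) (x c')
      = nabla_pb M N \<phi> q x V d"
    by (rule nabla_pb_chart[OF W V q x c d(1), symmetric])
  finally show "nabla_pb M N \<phi> q x V d' = D (N.transition d d') (snd d (\<phi> q)) (nabla_pb M N \<phi> q x V d)"
    unfolding rep_dom_point(2)[OF c d(1) q] .
qed (simp add: nabla_pb_def)

lemma smooth_section_nabla_pb:
  assumes W: "openin (top_of M) W" and V: "smooth_section W V" and X: "smooth_vector_field_on M W X"
  shows "smooth_section W (\<lambda>q. nabla_pb M N \<phi> q (X q) V)"
  unfolding smooth_section_def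
proof (intro conjI ballI)
  show "nabla_pb M N \<phi> q (X q) V \<in> tangent_space N (\<phi> q)" if "q \<in> W" for q
    by (rule nabla_pb_tangent[OF W V that vector_field_tangent[OF X that]])
  fix c d assume cd: "c \<in> atlas M" "d \<in> atlas N"
  interpret local_riemannian "snd d ` fst d" "chart_metric N d" "chart_christoffel N d"
    by (rule N.local_riemannian[OF cd(2)])
  show "smooth_on (rep_dom c W d) (\<lambda>z. nabla_pb M N \<phi> (inv_chart c z) (X (inv_chart c z)) V d)"
  proof (rule smooth_on_cong[OF rep_dom_open[OF W cd]])
    show "smooth_on (rep_dom c W d) (\<lambda>z. cov_deriv (chart_christoffel N d) (rep c d)
        (\<lambda>z. V (inv_chart c z) d) z (X (inv_chart c z) c))"
      by (rule smooth_on_cov_deriv[OF rep_dom_open[OF W cd] rep_image[OF cd] rep_smooth[OF cd]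
            smooth_section_smooth[OF V cd] vector_field_smooth[OF X cd(1)]])
    show "cov_deriv (chart_christoffel N d) (rep c d) (\<lambda>z. V (inv_chart c z) d) z (X (inv_chart c z) c)
        = nabla_pb M N \<phi> (inv_chart c z) (X (inv_chart c z)) V d" if z: "z \<in> rep_dom c W d" for z
      by (rule rep_dom_cases[OF z cd]) (simp add: nabla_pb_chart[OF W V] vector_field_tangent[OF X])
  qed
qed

lemma smooth_section_diff:
  assumes "openin (top_of M) W" "smooth_section W V" "smooth_section W V'"
  shows "smooth_section W (\<lambda>q d. V q d - V' q d)"
  using assms unfolding smooth_section_def
  by (auto intro!: N.tangent_diff smooth_on_diff rep_dom_open)

lemma smooth_section_sum:
  assumes "openin (top_of M) W" "\<And>i. i \<in> I \<Longrightarrow> smooth_section W (V i)"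
  shows "smooth_section W (\<lambda>q d. \<Sum>i\<in>I. V i q d)"
  using assms unfolding smooth_section_def
  by (auto intro!: N.tangent_sum smooth_on_sum rep_dom_open)

lemma smooth_section_subset:
  assumes "smooth_section W V" "W' \<subseteq> W"
  shows "smooth_section W' V"
  unfolding smooth_section_def
proof (intro conjI ballI)
  show "V q \<in> tangent_space N (\<phi> q)" if "q \<in> W'" for q
    using that assms smooth_section_tangent by blast
  show "smooth_on (rep_dom c W' d) (\<lambda>z. V (inv_chart c z) d)" if "c \<in> atlas M" "d \<in> atlas N" for c d
    by (rule smooth_on_subset[OF smooth_section_smooth[OF assms(1) that]])
       (use assms(2) in \<open>auto simp: rep_dom_def\<close>)
qed

lemma smooth_section_local:
  assumes W: "openin (top_of M) W"
    and loc: "\<And>p. p \<in> W \<Longrightarrow> \<exists>W' V'. openin (top_of M) W' \<and> p \<in> W' \<and> smooth_section W' V' \<and> (\<forall>q\<in>W'. V q = V' q)"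
  shows "smooth_section W V"
  unfolding smooth_section_def
proof (intro conjI ballI)
  show "V q \<in> tangent_space N (\<phi> q)" if q: "q \<in> W" for q
    using loc[OF q] smooth_section_tangent by metis
  fix c d assume cd: "c \<in> atlas M" "d \<in> atlas N"
  show "smooth_on (rep_dom c W d) (\<lambda>z. V (inv_chart c z) d)"
  proof (rule smooth_on_local)
    fix z assume z: "z \<in> rep_dom c W d"
    then obtain p where p: "z = snd c p" "p \<in> W" "c \<in> charts_at M p" "d \<in> charts_at N (\<phi> p)"
      using rep_dom_cases[OF z cd] by metis
    obtain W' V' where W': "openin (top_of M) W'" "p \<in> W'" "smooth_section W' V'" "\<forall>q\<in>W'. V q = V' q"
      using loc[OF p(2)] by blast
    have "smooth_on (rep_dom c W' d) (\<lambda>z. V (inv_chart c z) d)"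
    proof (rule smooth_on_cong[OF rep_dom_open[OF W'(1) cd] smooth_section_smooth[OF W'(3) cd]])
      show "V' (inv_chart c z) d = V (inv_chart c z) d" if z: "z \<in> rep_dom c W' d" for z
        by (rule rep_dom_cases[OF z cd]) (use W'(4) in auto)
    qed
    then show "\<exists>T. open T \<and> z \<in> T \<and> smooth_on T (\<lambda>z. V (inv_chart c z) d)"
      using rep_dom_open[OF W'(1) cd] rep_dom_point(1)[OF p(3,4) W'(2)] p(1) by blast
  qed
qed

lemma section_inner_chart:
  assumes V: "smooth_section W V" "smooth_section W V'" and cd: "c \<in> atlas M" "d \<in> atlas N"
    and z: "z \<in> rep_dom c W d"
  shows "rmetric N (\<phi> (inv_chart c z)) (V (inv_chart c z)) (V' (inv_chart c z))
    = chart_metric N d (rep c d z) (V (inv_chart c z) d) (V' (inv_chart c z) d)"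
  by (rule rep_dom_cases[OF z cd])
     (simp add: N.rmetric_chart[OF smooth_section_tangent[OF V(1)] smooth_section_tangent[OF V(2)]])

lemma smooth_section_inner:
  assumes W: "openin (top_of M) W" and V: "smooth_section W V" "smooth_section W V'" and c: "c \<in> atlas M"
  shows "smooth_on (snd c ` (fst c \<inter> W))
    (\<lambda>z. rmetric N (\<phi> (inv_chart c z)) (V (inv_chart c z)) (V' (inv_chart c z)))"
proof (rule smooth_on_local)
  fix z assume "z \<in> snd c ` (fst c \<inter> W)"
  then obtain q where q: "z = snd c q" "q \<in> fst c" "q \<in> W" by auto
  have at: "c \<in> charts_at M q" by (rule M.charts_atI[OF c q(2)])
  obtain d where d: "d \<in> charts_at N (\<phi> q)"
    using N.chart_at[OF map_pts] M.charts_atD[OF at] by blast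
  note atl = charts_atlas(2)[OF d]
  interpret local_riemannian "snd d ` fst d" "chart_metric N d" "chart_christoffel N d"
    by (rule N.local_riemannian[OF atl])
  have "smooth_on (rep_dom c W d)
    (\<lambda>z. rmetric N (\<phi> (inv_chart c z)) (V (inv_chart c z)) (V' (inv_chart c z)))"
    by (rule smooth_on_cong[OF rep_dom_open[OF W c atl] _ section_inner_chart[OF V c atl, symmetric]])
       (intro smooth_on_g rep_dom_open W c atl rep_image rep_smooth smooth_section_smooth V)
  then show "\<exists>T. open T \<and> z \<in> T \<and> smooth_on T
      (\<lambda>z. rmetric N (\<phi> (inv_chart c z)) (V (inv_chart c z)) (V' (inv_chart c z)))"
    using rep_dom_open[OF W c atl] rep_dom_point(1)[OF at d q(3)] q(1) by blast
qed

text \<open>Metric compatibility of the pulled back connection.\<close>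

lemma dir_deriv_inner:
  assumes W: "openin (top_of M) W" and V: "smooth_section W V" "smooth_section W V'" and q: "q \<in> W"
    and x: "x \<in> tangent_space M q"
  shows "dir_deriv M q x (\<lambda>q. rmetric N (\<phi> q) (V q) (V' q))
    = rmetric N (\<phi> q) (nabla_pb M N \<phi> q x V) (V' q) + rmetric N (\<phi> q) (V q) (nabla_pb M N \<phi> q x V')"
proof -
  have "q \<in> pts M" using q openin_subset[OF W] by auto
  then obtain c d where c: "c \<in> charts_at M q" and d: "d \<in> charts_at N (\<phi> q)"
    using M.chart_at N.chart_at map_pts by metis
  note atl = charts_atlas(1)[OF c] charts_atlas(2)[OF d]
  interpret local_riemannian "snd d ` fst d" "chart_metric N d" "chart_christoffel N d"
    by (rule N.local_riemannian[OF atl(2)])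
  let ?r = "\<lambda>z. V (inv_chart c z) d" and ?r' = "\<lambda>z. V' (inv_chart c z) d"
  note pt = rep_dom_point[OF c d q]
  note T = rep_dom_open[OF W atl] rep_image[OF atl] rep_smooth[OF atl] smooth_section_smooth[OF V(1) atl]
    smooth_section_smooth[OF V(2) atl]
  have diff: "(\<lambda>z. chart_metric N d (rep c d z) (?r z) (?r' z)) differentiable (at (snd c q))"
    by (rule smooth_on_differentiable[OF smooth_on_g[OF T] T(1) pt(1)])
  note cong = D_cong_open[OF T(1) pt(1) section_inner_chart[OF V atl, symmetric] diff]
  note tan = nabla_pb_tangent[OF W V(1) q x] nabla_pb_tangent[OF W V(2) q x]
    smooth_section_tangent[OF V(1) q] smooth_section_tangent[OF V(2) q]
  have "dir_deriv M q x (\<lambda>q. rmetric N (\<phi> q) (V q) (V' q))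
      = D (\<lambda>z. chart_metric N d (rep c d z) (?r z) (?r' z)) (snd c q) (x c)"
    by (subst M.dir_deriv_chart[OF c x cong(2)]) (simp_all add: cong(1))
  also have "\<dots> = chart_metric N d (rep c d (snd c q))
        (cov_deriv (chart_christoffel N d) (rep c d) ?r (snd c q) (x c)) (?r' (snd c q))
      + chart_metric N d (rep c d (snd c q)) (?r (snd c q))
        (cov_deriv (chart_christoffel N d) (rep c d) ?r' (snd c q) (x c))"
    by (rule D_inner_cov_deriv[OF T pt(1)])
  finally show ?thesis
    using M.charts_atD[OF c]
    by (simp add: N.rmetric_chart[OF tan(1,4) d] N.rmetric_chart[OF tan(3,2) d] pt(2) M.inv_chart_left
        nabla_pb_chart[OF W V(1) q x c d] nabla_pb_chart[OF W V(2) q x c d])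
qed

end

context riem_mfd
begin

text \<open>The covariant derivative of vector fields is the case of the identity map, whose sections are
  the vector fields.\<close>

sublocale id: riem_map M M "\<lambda>x. x"
  by unfold_locales
     (use transition_smooth in \<open>auto simp: smooth_map_def transition_def[abs_def] o_def vimage_def\<close>)

lemma id_rep: "id.rep c d = transition c d"
  by (auto simp: id.rep_def transition_def)

lemma vector_field_iff_section:
  assumes W: "openin (top_of M) W"
  shows "smooth_vector_field_on M W X \<longleftrightarrow> id.smooth_section W X"
proof
  assume X: "smooth_vector_field_on M W X"
  have "smooth_on (id.rep_dom c W d) (\<lambda>z. X (inv_chart c z) d)" if cd: "c \<in> atlas M" "d \<in> atlas M" for c d
  proof (rule smooth_on_cong[OF id.rep_dom_open[OF W cd]])
    show "smooth_on (id.rep_dom c W d) (\<lambda>z. D (id.rep c d) z (X (inv_chart c z) c))"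
      by (rule smooth_on_D_arg[OF id.rep_dom_open[OF W cd] id.rep_smooth[OF cd] id.vector_field_smooth[OF X cd(1)]])
    show "D (id.rep c d) z (X (inv_chart c z) c) = X (inv_chart c z) d" if z: "z \<in> id.rep_dom c W d" for z
      by (rule id.rep_dom_cases[OF z cd])
         (simp add: id_rep tangent_transition[OF id.vector_field_tangent[OF X], symmetric])
  qed
  then show "id.smooth_section W X"
    using X by (simp add: id.smooth_section_def smooth_vector_field_on_def)
next
  assume X: "id.smooth_section W X"
  have "id.rep_dom c W c = snd c ` (fst c \<inter> W)" for c by (auto simp: id.rep_dom_def)
  then have "smooth_on (snd c ` (fst c \<inter> W)) (\<lambda>z. X (inv_chart c z) c)" if "c \<in> atlas M" for c
    using id.smooth_section_smooth[OF X that that] by simp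
  then show "smooth_vector_field_on M W X"
    using X by (simp add: id.smooth_section_def smooth_vector_field_on_def)
qed

lemma nabla_eq_nabla_pb:
  assumes x: "x \<in> tangent_space M p"
  shows "nabla M p x Y = nabla_pb M M (\<lambda>x. x) p x Y"
proof
  fix c
  have "differential M M (\<lambda>x. x) p x c = x c" if c: "c \<in> charts_at M p"
    by (simp add: id.differential_chart[OF c c x] id_rep D_transition_self[OF c])
  then show "nabla M p x Y c = nabla_pb M M (\<lambda>x. x) p x Y c"
    by (simp add: nabla_def nabla_pb_def)
qed

lemma nabla_tangent:
  assumes "openin (top_of M) W" "smooth_vector_field_on M W Y" "p \<in> W" "x \<in> tangent_space M p"
  shows "nabla M p x Y \<in> tangent_space M p"
  using assms id.nabla_pb_tangent by (simp add: nabla_eq_nabla_pb vector_field_iff_section)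

lemma smooth_nabla_field:
  assumes W: "openin (top_of M) W" and X: "smooth_vector_field_on M W X" and Y: "smooth_vector_field_on M W Y"
  shows "smooth_vector_field_on M W (nabla_field M X Y)"
  unfolding vector_field_iff_section[OF W]
proof (rule id.smooth_section_local[OF W])
  have "\<forall>q\<in>W. nabla_field M X Y q = nabla_pb M M (\<lambda>x. x) q (X q) Y"
    using id.vector_field_tangent[OF X] by (simp add: nabla_field_def nabla_eq_nabla_pb)
  moreover have "id.smooth_section W (\<lambda>q. nabla_pb M M (\<lambda>x. x) q (X q) Y)"
    by (rule id.smooth_section_nabla_pb[OF W _ X]) (use Y vector_field_iff_section[OF W] in blast)
  ultimately show "\<exists>W' V'. openin (top_of M) W' \<and> p \<in> W' \<and> id.smooth_section W' V' \<and>
      (\<forall>q\<in>W'. nabla_field M X Y q = V' q)" if "p \<in> W" for p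
    using W that by blast
qed

lemma nabla_chart:
  assumes W: "openin (top_of M) W" and Y: "smooth_vector_field_on M W Y" and p: "p \<in> W"
    and x: "x \<in> tangent_space M p" and c: "c \<in> charts_at M p"
  shows "nabla M p x Y c = cov_deriv (chart_christoffel M c) (\<lambda>z. z) (\<lambda>z. Y (inv_chart c z) c) (snd c p) (x c)"
proof -
  have Y': "id.smooth_section W Y" using Y vector_field_iff_section[OF W] by blast
  have "cov_deriv (chart_christoffel M c) (id.rep c c) (\<lambda>z. Y (inv_chart c z) c) (snd c p) (x c)
      = cov_deriv (chart_christoffel M c) (\<lambda>z. z) (\<lambda>z. Y (inv_chart c z) c) (snd c p) (x c)"
  proof (rule cov_deriv_cong[OF chart_image_open'[of c]])
    show "id.rep c c z = z" if "z \<in> snd c ` fst c" for z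
      using chart_image_D[OF that] by (simp add: id.rep_def)
  qed (use charts_atD[OF c] id.rep_diff[OF c c] id.section_diff[OF W Y' p c c] in auto)
  then show ?thesis
    using id.nabla_pb_chart[OF W Y' p x c c] by (simp add: nabla_eq_nabla_pb[OF x])
qed

end

section \<open>The tension field\<close>

context riem_map
begin

lemma nabla_d_chart:
  assumes W: "openin (top_of M) W" and X: "smooth_vector_field_on M W X" and Y: "smooth_vector_field_on M W Y"
    and q: "q \<in> W" and c: "c \<in> charts_at M q" and d: "d \<in> charts_at N (\<phi> q)"
  shows "nabla_d M N \<phi> X Y q d
    = second_fundamental_form (chart_christoffel M c) (chart_christoffel N d) (rep c d) (snd c q) (X q c) (Y q c)"
proof -
  note atl = charts_atlas(1)[OF c] charts_atlas(2)[OF d]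
  note pt = rep_dom_point[OF c d q]
  note Xq = vector_field_tangent[OF X q]
  let ?Y = "\<lambda>z. Y (inv_chart c z) c"
  have "nabla_pb M N \<phi> q (X q) (\<lambda>q. differential M N \<phi> q (Y q)) d
      = cov_deriv (chart_christoffel N d) (rep c d)
          (\<lambda>z. differential M N \<phi> (inv_chart c z) (Y (inv_chart c z)) d) (snd c q) (X q c)"
    by (rule nabla_pb_chart[OF W smooth_section_differential[OF W Y] q Xq c d])
  also have "\<dots> = cov_deriv (chart_christoffel N d) (rep c d) (\<lambda>z. D (rep c d) z (?Y z)) (snd c q) (X q c)"
  proof (rule cov_deriv_cong[OF rep_dom_open[OF W atl] pt(1)])
    show "differential M N \<phi> (inv_chart c z) (Y (inv_chart c z)) d = D (rep c d) z (?Y z)"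
      if z: "z \<in> rep_dom c W d" for z
      by (rule rep_dom_cases[OF z atl]) (simp add: differential_chart vector_field_tangent[OF Y])
  qed (auto intro: rep_diff[OF c d] section_diff[OF W smooth_section_differential[OF W Y] q c d])
  finally have 1: "nabla_pb M N \<phi> q (X q) (\<lambda>q. differential M N \<phi> q (Y q)) d
      = cov_deriv (chart_christoffel N d) (rep c d) (\<lambda>z. D (rep c d) z (?Y z)) (snd c q) (X q c)" .
  have "differential M N \<phi> q (nabla_field M X Y q) d = D (rep c d) (snd c q) (nabla_field M X Y q c)"
    by (rule differential_chart[OF c d vector_field_tangent[OF M.smooth_nabla_field[OF W X Y] q]])
  then have 2: "differential M N \<phi> q (nabla_field M X Y q) d
      = D (rep c d) (snd c q) (cov_deriv (chart_christoffel M c) (\<lambda>z. z) ?Y (snd c q) (X q c))"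
    by (simp add: nabla_field_def M.nabla_chart[OF W Y q Xq c])
  have "nabla_d M N \<phi> X Y q d = second_fundamental_form (chart_christoffel M c) (chart_christoffel N d)
      (rep c d) (snd c q) (X q c) (?Y (snd c q))"
    unfolding nabla_d_def 1 2
    by (rule second_fundamental_form(2)[OF M.local_riemannian[OF atl(1)] N.local_riemannian[OF atl(2)]
          rep_dom_open[OF W atl] rep_dom_subset(1) pt(1) rep_smooth[OF atl] rep_image[OF atl]
          vector_field_smooth[OF Y atl(1)]])
  then show ?thesis using M.charts_atD[OF c] by (simp add: M.inv_chart_left)
qed

lemma smooth_section_nabla_d:
  assumes W: "openin (top_of M) W" and X: "smooth_vector_field_on M W X" and Y: "smooth_vector_field_on M W Y"
  shows "smooth_section W (nabla_d M N \<phi> X Y)"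
  unfolding nabla_d_def
  by (intro smooth_section_diff W smooth_section_nabla_pb smooth_section_differential X Y M.smooth_nabla_field)

text \<open>By \<open>nabla_d_chart\<close> both frames enter only through their values at \<open>q\<close>, as arguments of one bilinear
  map, and both traces are taken over orthonormal bases.\<close>

lemma tension_frame:
  assumes W: "openin (top_of M) W" and e: "\<And>\<alpha>. smooth_vector_field_on M W (e \<alpha>)"
    and orth: "orthonormal_basis_at M q (\<lambda>\<alpha>. e \<alpha> q)" and q: "q \<in> W"
  shows "tension M N \<phi> q = (\<lambda>d. \<Sum>\<alpha>\<in>UNIV. nabla_d M N \<phi> (e \<alpha>) (e \<alpha>) q d)"
proof
  fix d
  have qM: "q \<in> pts M" using q openin_subset[OF W] by auto
  define f where "f = frame M q"
  have f_orth: "orthonormal_basis_at M q (\<lambda>\<alpha>. f \<alpha> q)"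
    unfolding f_def by (rule M.frame_orthonormal[OF qM])
  obtain W' where W': "openin (top_of M) W'" "q \<in> W'" "\<And>\<alpha>. smooth_vector_field_on M W' (f \<alpha>)"
    using M.frame[OF qM] unfolding local_orthonormal_frame_def f_def by blast
  show "tension M N \<phi> q d = (\<Sum>\<alpha>\<in>UNIV. nabla_d M N \<phi> (e \<alpha>) (e \<alpha>) q d)"
  proof (cases "d \<in> charts_at N (\<phi> q)")
    case True
    note c = M.chart_at[OF qM]
    note atl = charts_atlas(1)[OF c] charts_atlas(2)[OF True]
    interpret f: inner_form "chart_metric M (chart_at M q) (snd (chart_at M q) q)"
      by (rule M.chart_metric_form[OF atl(1)]) (use M.charts_atD[OF c] in auto)
    let ?B = "second_fundamental_form (chart_christoffel M (chart_at M q))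
        (chart_christoffel N d) (rep (chart_at M q) d) (snd (chart_at M q) q)"
    have bil: "bilinear ?B"
      by (rule second_fundamental_form(1)[OF M.local_riemannian[OF atl(1)] N.local_riemannian[OF atl(2)]
          rep_dom_open[OF W atl] rep_dom_subset(1) rep_dom_point(1)[OF c True q] rep_smooth[OF atl] rep_image[OF atl]])
    have "tension M N \<phi> q d = (\<Sum>\<alpha>\<in>UNIV. nabla_d M N \<phi> (f \<alpha>) (f \<alpha>) q d)"
      by (simp add: tension_def f_def Let_def)
    also have "\<dots> = (\<Sum>\<alpha>\<in>UNIV. ?B (f \<alpha> q (chart_at M q)) (f \<alpha> q (chart_at M q)))"
      by (rule sum.cong[OF refl nabla_d_chart[OF W'(1,3,3,2) c True]])
    also have "\<dots> = (\<Sum>\<alpha>\<in>UNIV. ?B (e \<alpha> q (chart_at M q)) (e \<alpha> q (chart_at M q)))"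
      by (rule f.trace_unique[OF M.orthonormal_basis_chart[OF f_orth c] _ _
          M.orthonormal_basis_chart[OF orth c] _ _ bil]) simp_all
    also have "\<dots> = (\<Sum>\<alpha>\<in>UNIV. nabla_d M N \<phi> (e \<alpha>) (e \<alpha>) q d)"
      by (rule sum.cong[OF refl nabla_d_chart[OF W e e q c True, symmetric]])
    finally show ?thesis .
  next
    case False
    then show ?thesis by (simp add: tension_def nabla_d_def nabla_pb_def differential_def)
  qed
qed

lemma smooth_section_tension: "smooth_section (pts M) (tension M N \<phi>)"
proof (rule smooth_section_local[OF openin_topspace])
  fix p assume p: "p \<in> pts M"
  define e where "e = frame M p"
  obtain W where W: "openin (top_of M) W" "p \<in> W" "\<And>\<alpha>. smooth_vector_field_on M W (e \<alpha>)"
    "\<And>q. q \<in> W \<Longrightarrow> orthonormal_basis_at M q (\<lambda>\<alpha>. e \<alpha> q)"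
    using M.frame[OF p] unfolding local_orthonormal_frame_def e_def by blast
  have "smooth_section W (\<lambda>q d. \<Sum>\<alpha>\<in>UNIV. nabla_d M N \<phi> (e \<alpha>) (e \<alpha>) q d)"
    by (intro smooth_section_sum W smooth_section_nabla_d)
  then show "\<exists>W' V'. openin (top_of M) W' \<and> p \<in> W' \<and> smooth_section W' V' \<and>
      (\<forall>q\<in>W'. tension M N \<phi> q = V' q)"
    using W tension_frame[OF W(1,3,4)] by blast
qed

end

section \<open>Curvature\<close>

context local_riemannian
begin

text \<open>Polarisation of \<open>riemann_tensor_skew\<close>.\<close>

lemma riemann_tensor_skew_pair:
  assumes z: "z \<in> U"
  shows "g z (riemann_tensor \<Gamma> z x y v) w = - g z (riemann_tensor \<Gamma> z x y w) v"
proof -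
  interpret inner_form "g z" by (rule form[OF z])
  have "g z (riemann_tensor \<Gamma> z x y (v + w)) (v + w) = 0" by (rule riemann_tensor_skew[OF z])
  then show ?thesis
    by (simp add: linear_add[OF riemann_tensor_linear(3)[OF z]] form_simps riemann_tensor_skew[OF z])
qed

text \<open>Both skew symmetries allow subtracting from \<open>u\<close> its component along \<open>v\<close>, so the sign of the
  sectional curvatures determines the sign for all pairs of vectors.\<close>

lemma sectional_nonpos_imp:
  assumes z: "z \<in> U"
    and K: "\<And>u v. g z u u = 1 \<Longrightarrow> g z v v = 1 \<Longrightarrow> g z u v = 0 \<Longrightarrow> g z (riemann_tensor \<Gamma> z u v v) u \<le> 0"
  shows "g z (riemann_tensor \<Gamma> z u v v) u \<le> 0"
proof -
  interpret inner_form "g z" by (rule form[OF z])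
  define R where "R = riemann_tensor \<Gamma> z"
  note lin = riemann_tensor_linear[OF z, folded R_def]
  have scale: "g z (R (a *\<^sub>R u) (b *\<^sub>R v) (b *\<^sub>R v)) (a *\<^sub>R u) = a\<^sup>2 * b\<^sup>2 * g z (R u v v) u" for a b u v
    by (simp add: linear_cmul[OF lin(1)] linear_cmul[OF lin(2)] linear_cmul[OF lin(3)] form_simps power2_eq_square)
  have unit: "g z ((1 / sqrt (g z u u)) *\<^sub>R u) ((1 / sqrt (g z u u)) *\<^sub>R u) = 1" if "u \<noteq> 0" for u
    using pos[OF that] by (simp add: form_simps)
  show ?thesis
  proof (cases "v = 0")
    case True
    then show ?thesis using linear_0[OF lin(3)] form_simps(10) by (simp add: R_def)
  next
    case False
    define w where "w = u - (g z u v / g z v v) *\<^sub>R v"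
    have Rvv: "R v v x = 0" for x
      by (simp add: R_def riemann_tensor_def)
    have u: "u = w + (g z u v / g z v v) *\<^sub>R v" by (simp add: w_def)
    have wv: "g z w v = 0" using pos[OF False] by (simp add: w_def form_simps)
    have "R u v v = R w v v"
      by (subst u) (simp add: linear_add[OF lin(1)] linear_cmul[OF lin(1)] Rvv)
    then have "g z (R u v v) u = g z (R w v v) (w + (g z u v / g z v v) *\<^sub>R v)"
      using u by simp
    also have "\<dots> = g z (R w v v) w"
      using riemann_tensor_skew[OF z, of w v v] by (simp add: form_simps R_def)
    finally have "g z (R u v v) u = g z (R w v v) w" .
    also have "\<dots> \<le> 0"
    proof (cases "w = 0")
      case True
      then show ?thesis using form_simps(5) by simp
    next
      case w0: False
      let ?a = "1 / sqrt (g z w w)" and ?b = "1 / sqrt (g z v v)"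
      have "?a\<^sup>2 * ?b\<^sup>2 * g z (R w v v) w \<le> 0"
        unfolding scale[symmetric] unfolding R_def
        by (rule K[OF unit[OF w0] unit[OF False]]) (simp add: form_simps wv)
      moreover have "?a\<^sup>2 * ?b\<^sup>2 > 0" using pos[OF w0] pos[OF False] by simp
      ultimately show ?thesis by (meson mult_pos_pos not_le)
    qed
    finally show ?thesis by (simp add: R_def)
  qed
qed

text \<open>Cauchy--Schwarz in the last two arguments, and its sharper form for skew maps in the first two,
  which gives the factor \<open>1/2\<close>.\<close>

lemma riemann_tensor_bound:
  assumes z: "z \<in> U" and e: "inner_form.orthonormal (g z) e I" "finite I" "card I = DIM('n)"
  shows "(g z (riemann_tensor \<Gamma> z u v u) v)\<^sup>2 \<le> (g z u u * g z v v)\<^sup>2 / 2 *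
    (\<Sum>i\<in>I. \<Sum>j\<in>I. \<Sum>k\<in>I. \<Sum>l\<in>I. (g z (riemann_tensor \<Gamma> z (e i) (e j) (e k)) (e l))\<^sup>2)"
proof -
  interpret inner_form "g z" by (rule form[OF z])
  define R where "R = riemann_tensor \<Gamma> z"
  note lin = riemann_tensor_linear[OF z, folded R_def]
  have "bilinear (\<lambda>a b. g z (R u v a) b)"
    unfolding bilinear_def by (auto intro: linear_right linear_compose[OF lin(3) linear_left, unfolded o_def])
  from bilinear_bound[OF e this, of u v]
  have "(g z (R u v u) v)\<^sup>2 \<le> g z u u * g z v v * (\<Sum>(k, l)\<in>I \<times> I. (g z (R u v (e k)) (e l))\<^sup>2)" .
  also have "\<dots> \<le> g z u u * g z v v * (\<Sum>(k, l)\<in>I \<times> I. g z u u * g z v v / 2 *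
      (\<Sum>(i, j)\<in>I \<times> I. (g z (R (e i) (e j) (e k)) (e l))\<^sup>2))"
  proof (intro mult_left_mono sum_mono)
    fix p assume "p \<in> I \<times> I"
    have "(g z (R u v (e k)) (e l))\<^sup>2 \<le> g z u u * g z v v / 2 *
      (\<Sum>(i, j)\<in>I \<times> I. (g z (R (e i) (e j) (e k)) (e l))\<^sup>2)" for k l
    proof (rule skew_bound[OF e])
      show "bilinear (\<lambda>a b. g z (R a b (e k)) (e l))"
        unfolding bilinear_def
        by (auto intro: linear_compose[OF lin(1) linear_left, unfolded o_def]
            linear_compose[OF lin(2) linear_left, unfolded o_def])
      show "g z (R x y (e k)) (e l) = - g z (R y x (e k)) (e l)" for x y
        using riemann_tensor_antisym[of z x y] linear_neg[OF linear_left] by (simp add: R_def)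
    qed
    then show "(case p of (k, l) \<Rightarrow> (g z (R u v (e k)) (e l))\<^sup>2) \<le> (case p of (k, l) \<Rightarrow> g z u u * g z v v / 2 *
      (\<Sum>(i, j)\<in>I \<times> I. (g z (R (e i) (e j) (e k)) (e l))\<^sup>2))"
      by (cases p) simp
  qed (simp add: nonneg)
  also have "\<dots> = (g z u u * g z v v)\<^sup>2 / 2 *
      (\<Sum>(k, l)\<in>I \<times> I. \<Sum>(i, j)\<in>I \<times> I. (g z (R (e i) (e j) (e k)) (e l))\<^sup>2)"
    by (simp add: sum_distrib_left power2_eq_square case_prod_beta mult_ac)
  also have "(\<Sum>(k, l)\<in>I \<times> I. \<Sum>(i, j)\<in>I \<times> I. (g z (R (e i) (e j) (e k)) (e l))\<^sup>2)
      = (\<Sum>(i, j)\<in>I \<times> I. \<Sum>(k, l)\<in>I \<times> I. (g z (R (e i) (e j) (e k)) (e l))\<^sup>2)"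
    unfolding case_prod_unfold by (rule sum.swap)
  finally show ?thesis
    by (simp add: R_def sum.cartesian_product[symmetric])
qed

end

context riem_mfd
begin

lemma smooth_extend_vec:
  assumes "p \<in> pts M"
  shows "smooth_vector_field_on M (fst (chart_at M p)) (extend_vec M p x)"
  unfolding extend_vec_def
  using smooth_coord_vec_field[OF _ smooth_on_const] chart_at[OF assms] charts_atD by blast

lemma extend_vec_self:
  "p \<in> pts M \<Longrightarrow> x \<in> tangent_space M p \<Longrightarrow> extend_vec M p x p = x"
  by (simp add: extend_vec_def tangent_coord chart_at)

lemma nabla_extend_vec:
  assumes p: "p \<in> pts M" and q: "q \<in> fst (chart_at M p)" and v: "v \<in> tangent_space M q"
  shows "nabla M q v (extend_vec M p z) (chart_at M p)
    = chart_christoffel M (chart_at M p) (snd (chart_at M p) q) (v (chart_at M p)) (z (chart_at M p))"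
proof -
  define c where "c = chart_at M p"
  have c: "c \<in> atlas M" unfolding c_def using chart_at[OF p] charts_atD by blast
  have q': "c \<in> charts_at M q" using q by (intro charts_atI[OF c]) (simp add: c_def)
  have const: "extend_vec M p z (inv_chart c y) c = z c" if "y \<in> snd c ` fst c" for y
    unfolding extend_vec_def c_def[symmetric] using coord_vec_self inv_chart_charts_at[OF c that] by simp
  have "nabla M q v (extend_vec M p z) c = cov_deriv (chart_christoffel M c) (\<lambda>z. z)
      (\<lambda>y. extend_vec M p z (inv_chart c y) c) (snd c q) (v c)"
    by (rule nabla_chart[OF chart_open[OF c] _ _ v q'])
       (use smooth_extend_vec[OF p] q in \<open>auto simp: c_def\<close>)
  also have "\<dots> = cov_deriv (chart_christoffel M c) (\<lambda>z. z) (\<lambda>y. z c) (snd c q) (v c)"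
    by (rule cov_deriv_cong[OF chart_image_open'[OF c], symmetric]) (use const q in \<open>auto simp: c_def\<close>)
  finally show ?thesis by (simp add: cov_deriv_def c_def)
qed

text \<open>The inner derivative \<open>\<nabla>\<^sub>Y Z\<close> of coordinate fields is the Christoffel symbol itself, as a function on
  the chart.\<close>

lemma nabla_field_extend_vec:
  assumes p: "p \<in> pts M" and x: "x \<in> tangent_space M p"
  defines "c \<equiv> chart_at M p"
  shows "nabla_field M (extend_vec M p x) (nabla_field M (extend_vec M p y) (extend_vec M p z)) p c
    = D (\<lambda>u. chart_christoffel M c u (y c) (z c)) (snd c p) (x c)
      + chart_christoffel M c (snd c p) (x c) (chart_christoffel M c (snd c p) (y c) (z c))"
    and "nabla_field M (extend_vec M p x) (nabla_field M (extend_vec M p y) (extend_vec M p z)) p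
      \<in> tangent_space M p"
proof -
  have at: "c \<in> charts_at M p" unfolding c_def by (rule chart_at[OF p])
  have c: "c \<in> atlas M" "p \<in> fst c" using charts_atD[OF at] by auto
  interpret local_riemannian "snd c ` fst c" "chart_metric M c" "chart_christoffel M c"
    by (rule local_riemannian[OF c(1)])
  let ?Y = "extend_vec M p y" and ?Z = "extend_vec M p z"
  note sm = smooth_extend_vec[OF p, folded c_def]
  note sm2 = smooth_nabla_field[OF chart_open[OF c(1)] sm sm]
  have YZ: "nabla_field M ?Y ?Z (inv_chart c u) c = chart_christoffel M c u (y c) (z c)"
    if u: "u \<in> snd c ` fst c" for u
  proof -
    have q: "inv_chart c u \<in> fst c" "snd c (inv_chart c u) = u" using chart_image_D[OF u] by auto
    have "nabla M (inv_chart c u) (?Y (inv_chart c u)) ?Z c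
        = chart_christoffel M c (snd c (inv_chart c u)) (?Y (inv_chart c u) c) (z c)"
      unfolding c_def
      by (rule nabla_extend_vec[OF p q(1)[unfolded c_def]])
         (use id.vector_field_tangent[OF sm q(1)] in \<open>simp add: c_def\<close>)
    also have "?Y (inv_chart c u) c = y c"
      unfolding extend_vec_def c_def[symmetric] by (rule coord_vec_self[OF inv_chart_charts_at[OF c(1) u]])
    finally show ?thesis by (simp add: nabla_field_def q(2))
  qed
  have "nabla M p x (nabla_field M ?Y ?Z) c = cov_deriv (chart_christoffel M c) (\<lambda>z. z)
      (\<lambda>u. nabla_field M ?Y ?Z (inv_chart c u) c) (snd c p) (x c)"
    by (rule nabla_chart[OF chart_open[OF c(1)] sm2 c(2) x at])
  also have "\<dots> = cov_deriv (chart_christoffel M c) (\<lambda>z. z)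
      (\<lambda>u. chart_christoffel M c u (y c) (z c)) (snd c p) (x c)"
    by (rule cov_deriv_cong[OF chart_image_open'[OF c(1)], symmetric]) (use YZ c(2) \<Gamma>_diff in auto)
  finally show "nabla_field M (extend_vec M p x) (nabla_field M ?Y ?Z) p c
    = D (\<lambda>u. chart_christoffel M c u (y c) (z c)) (snd c p) (x c)
      + chart_christoffel M c (snd c p) (x c) (chart_christoffel M c (snd c p) (y c) (z c))"
    by (simp add: nabla_field_def cov_deriv_def extend_vec_self[OF p x])
  show "nabla_field M (extend_vec M p x) (nabla_field M ?Y ?Z) p \<in> tangent_space M p"
    by (rule id.vector_field_tangent[OF smooth_nabla_field[OF chart_open[OF c(1)] sm sm2] c(2)])
qed

text \<open>The bracket is \<open>\<nabla>\<^sub>X Y - \<nabla>\<^sub>Y X\<close> since the connection is torsion free. This makes it a tangent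
  vector, and it vanishes for the coordinate fields because their components are constant in one
  chart.\<close>

lemma lie_bracket_extend_vec:
  assumes p: "p \<in> pts M" and x: "x \<in> tangent_space M p" and y: "y \<in> tangent_space M p"
  shows "lie_bracket M (extend_vec M p x) (extend_vec M p y) p = (\<lambda>c. 0)"
proof -
  define c where "c = chart_at M p"
  have at: "c \<in> charts_at M p" unfolding c_def by (rule chart_at[OF p])
  have c: "c \<in> atlas M" "p \<in> fst c" using charts_atD[OF at] by auto
  let ?X = "extend_vec M p x" and ?Y = "extend_vec M p y"
  note sm = smooth_extend_vec[OF p, folded c_def]
  have \<Gamma>_sym: "christoffel_form M c' p u v = christoffel_form M c' p v u" if "c' \<in> charts_at M p" for c' u v
  proof -
    have c': "c' \<in> atlas M" "p \<in> fst c'" using charts_atD[OF that] by auto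
    interpret local_riemannian "snd c' ` fst c'" "chart_metric M c'" "chart_christoffel M c'"
      by (rule local_riemannian[OF c'(1)])
    show ?thesis using \<Gamma>_sym[of "snd c' p" u v] c' by (simp add: chart_christoffel_def inv_chart_left)
  qed
  have "lie_bracket M ?X ?Y p c' = nabla M p x ?Y c' - nabla M p y ?X c'" for c'
    using \<Gamma>_sym[of c'] by (simp add: lie_bracket_def nabla_def extend_vec_self[OF p] x y)
  then have eq: "lie_bracket M ?X ?Y p = (\<lambda>c'. nabla M p x ?Y c' - nabla M p y ?X c')" by auto
  show ?thesis
  proof (rule tangent_eqI[OF _ tangent_zero at])
    show "lie_bracket M ?X ?Y p \<in> tangent_space M p"
      unfolding eq by (intro tangent_diff nabla_tangent[OF chart_open[OF c(1)] sm c(2)] x y)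
    show "lie_bracket M ?X ?Y p c = 0"
      using nabla_extend_vec[OF p _ x, where z = y] nabla_extend_vec[OF p _ y, where z = x] c(2) \<Gamma>_sym[OF at]
      by (simp add: eq c_def[symmetric] chart_christoffel_def inv_chart_left[OF c])
  qed
qed

lemma curvature:
  assumes p: "p \<in> pts M" and x: "x \<in> tangent_space M p" and y: "y \<in> tangent_space M p"
  defines "c \<equiv> chart_at M p"
  shows "curvature M p x y z \<in> tangent_space M p"
    and "curvature M p x y z c = riemann_tensor (chart_christoffel M c) (snd c p) (x c) (y c) (z c)"
proof -
  have at: "c \<in> charts_at M p" unfolding c_def by (rule chart_at[OF p])
  have c: "c \<in> atlas M" "p \<in> fst c" using charts_atD[OF at] by auto
  interpret local_riemannian "snd c ` fst c" "chart_metric M c" "chart_christoffel M c"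
    by (rule local_riemannian[OF c(1)])
  note sm = smooth_extend_vec[OF p, folded c_def]
  have lie: "nabla_field M (lie_bracket M (extend_vec M p x) (extend_vec M p y)) (extend_vec M p z) p
      = nabla M p (\<lambda>c. 0) (extend_vec M p z)"
    by (simp add: nabla_field_def lie_bracket_extend_vec[OF p x y])
  have "nabla M p (\<lambda>c. 0) (extend_vec M p z) \<in> tangent_space M p"
    by (rule nabla_tangent[OF chart_open[OF c(1)] sm c(2) tangent_zero])
  then show "curvature M p x y z \<in> tangent_space M p"
    unfolding curvature_def curvature_field_def lie
    by (intro tangent_diff nabla_field_extend_vec(2)[OF p] x y)
  have "nabla M p (\<lambda>c. 0) (extend_vec M p z) c = 0"
    using nabla_extend_vec[OF p _ tangent_zero, where z = z] c linear_0[OF \<Gamma>_linear(2)]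
    by (simp add: c_def[symmetric])
  then show "curvature M p x y z c = riemann_tensor (chart_christoffel M c) (snd c p) (x c) (y c) (z c)"
    unfolding curvature_def curvature_field_def lie
    using nabla_field_extend_vec(1)[OF p x, of y z] nabla_field_extend_vec(1)[OF p y, of x z]
    by (simp add: c_def[symmetric] riemann_tensor_def)
qed

lemma rmetric_curvature_chart:
  assumes p: "p \<in> pts M" and x: "x \<in> tangent_space M p" "y \<in> tangent_space M p" "w \<in> tangent_space M p"
  defines "c \<equiv> chart_at M p"
  shows "rmetric M p (curvature M p x y z) w
    = chart_metric M c (snd c p) (riemann_tensor (chart_christoffel M c) (snd c p) (x c) (y c) (z c)) (w c)"
  unfolding c_def
  by (simp add: rmetric_chart[OF curvature(1)[OF p x(1,2)] x(3) chart_at[OF p]] curvature(2)[OF p x(1,2)])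

lemma curvature_skew:
  assumes p: "p \<in> pts M" and x: "x \<in> tangent_space M p" "y \<in> tangent_space M p"
    "z \<in> tangent_space M p" "w \<in> tangent_space M p"
  shows "rmetric M p (curvature M p x y z) w = - rmetric M p (curvature M p x y w) z"
proof -
  let ?c = "chart_at M p"
  have c: "?c \<in> atlas M" "snd ?c p \<in> snd ?c ` fst ?c" using charts_atD[OF chart_at[OF p]] by auto
  interpret local_riemannian "snd ?c ` fst ?c" "chart_metric M ?c" "chart_christoffel M ?c"
    by (rule local_riemannian[OF c(1)])
  show ?thesis
    unfolding rmetric_curvature_chart[OF p x(1,2,3)] rmetric_curvature_chart[OF p x(1,2,4)]
    by (rule riemann_tensor_skew_pair[OF c(2)])
qed

lemma nonpositive_curvature_all_pairs:
  assumes K: "nonpositive_sectional_curvature M" and p: "p \<in> pts M"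
    and x: "x \<in> tangent_space M p" "y \<in> tangent_space M p"
  shows "rmetric M p (curvature M p x y y) x \<le> 0"
proof -
  let ?c = "chart_at M p"
  note at = chart_at[OF p]
  have c: "?c \<in> atlas M" "snd ?c p \<in> snd ?c ` fst ?c" using charts_atD[OF at] by auto
  interpret local_riemannian "snd ?c ` fst ?c" "chart_metric M ?c" "chart_christoffel M ?c"
    by (rule local_riemannian[OF c(1)])
  note tan = coord_vec_tangent[OF at]
  show ?thesis
    unfolding rmetric_curvature_chart[OF p x(1,2,1)]
  proof (rule sectional_nonpos_imp[OF c(2)])
    fix u v assume uv: "chart_metric M ?c (snd ?c p) u u = 1" "chart_metric M ?c (snd ?c p) v v = 1"
      "chart_metric M ?c (snd ?c p) u v = 0"
    have "sectional_curvature M p (coord_vec M ?c p u) (coord_vec M ?c p v) \<le> 0"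
      using K p tan uv unfolding nonpositive_sectional_curvature_def
      by (simp add: rmetric_chart[OF tan tan at] coord_vec_self[OF at])
    then show "chart_metric M ?c (snd ?c p)
        (riemann_tensor (chart_christoffel M ?c) (snd ?c p) u v v) u \<le> 0"
      unfolding sectional_curvature_def rmetric_curvature_chart[OF p tan tan tan]
      by (simp add: coord_vec_self[OF at])
  qed
qed

lemma curvature_norm_bound:
  assumes p: "p \<in> pts M" and x: "x \<in> tangent_space M p" "y \<in> tangent_space M p"
  shows "\<bar>rmetric M p (curvature M p x y x) y\<bar>
    \<le> rmetric M p x x * rmetric M p y y / sqrt 2 * curvature_norm M p"
proof -
  let ?c = "chart_at M p"
  note at = chart_at[OF p]
  have c: "?c \<in> atlas M" "snd ?c p \<in> snd ?c ` fst ?c" using charts_atD[OF at] by auto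
  interpret local_riemannian "snd ?c ` fst ?c" "chart_metric M ?c" "chart_christoffel M ?c"
    by (rule local_riemannian[OF c(1)])
  interpret f: inner_form "chart_metric M ?c (snd ?c p)" by (rule form[OF c(2)])
  define e where "e \<alpha> = frame M p \<alpha> p" for \<alpha>
  have e: "orthonormal_basis_at M p e"
    unfolding e_def by (rule frame_orthonormal[OF p])
  have et: "e \<alpha> \<in> tangent_space M p" for \<alpha> using e by (simp add: orthonormal_basis_at_def)
  define S where "S = (\<Sum>i\<in>UNIV. \<Sum>j\<in>UNIV. \<Sum>k\<in>UNIV. \<Sum>l\<in>UNIV.
    (rmetric M p (curvature M p (e i) (e j) (e k)) (e l))\<^sup>2)"
  have norm: "curvature_norm M p = sqrt S"
    by (simp add: curvature_norm_def S_def e_def Let_def)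
  have xx: "rmetric M p x x \<ge> 0" "rmetric M p y y \<ge> 0"
    using f.nonneg by (simp_all add: rmetric_chart[OF _ _ at] x)
  have "(rmetric M p (curvature M p x y x) y)\<^sup>2 \<le> (rmetric M p x x * rmetric M p y y)\<^sup>2 / 2 * S"
    using riemann_tensor_bound[OF c(2) orthonormal_basis_chart[OF e at], of "x ?c" "y ?c"]
    by (simp add: S_def rmetric_curvature_chart[OF p et et et] rmetric_curvature_chart[OF p x x(2)]
        rmetric_chart[OF x(1) x(1) at] rmetric_chart[OF x(2) x(2) at])
  then have "sqrt ((rmetric M p (curvature M p x y x) y)\<^sup>2)
      \<le> sqrt ((rmetric M p x x * rmetric M p y y)\<^sup>2 / 2 * S)"
    by (rule real_sqrt_le_mono)
  then show ?thesis
    using xx by (simp add: norm real_sqrt_mult real_sqrt_divide abs_mult)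
qed

section \<open>The maximum principle\<close>

text \<open>The topology of \<open>M\<close> is an abstract one, so continuity of \<open>f\<close> is put together from the charts.\<close>

lemma attains_max:
  fixes f :: "'a \<Rightarrow> real"
  assumes "compact_manifold M" "pts M \<noteq> {}"
    and cont: "\<And>c. c \<in> atlas M \<Longrightarrow> continuous_on (snd c ` fst c) (\<lambda>z. f (inv_chart c z))"
  obtains p where "p \<in> pts M" "\<And>q. q \<in> pts M \<Longrightarrow> f q \<le> f p"
proof -
  have "continuous_map (top_of M) euclideanreal f"
    unfolding continuous_map_def
  proof (intro conjI allI impI)
    fix B :: "real set" assume "openin euclideanreal B"
    then have B: "open B" by simp
    have "openin (top_of M) {x \<in> fst c. f x \<in> B}" if c: "c \<in> atlas M" for c
    proof -
      have "openin (top_of_set (snd c ` fst c)) (snd c ` fst c \<inter> (\<lambda>z. f (inv_chart c z)) -` B)"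
        by (rule continuous_openin_preimage_gen[OF cont[OF c] B])
      then have "openin (subtopology (top_of M) (fst c)) {x \<in> topspace (subtopology (top_of M) (fst c)).
          snd c x \<in> snd c ` fst c \<inter> (\<lambda>z. f (inv_chart c z)) -` B}"
        by (rule openin_continuous_map_preimage[OF homeomorphic_imp_continuous_map[OF chart_homeo[OF c]]])
      also have "{x \<in> topspace (subtopology (top_of M) (fst c)).
          snd c x \<in> snd c ` fst c \<inter> (\<lambda>z. f (inv_chart c z)) -` B} = {x \<in> fst c. f x \<in> B}"
      proof -
        have "snd c x \<in> snd c ` fst c \<inter> (\<lambda>z. f (inv_chart c z)) -` B \<longleftrightarrow> f x \<in> B" if "x \<in> fst c" for x
          using that by (simp add: inv_chart_left[OF c])
        then show ?thesis using chart_subset[OF c] by auto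
      qed
      finally show ?thesis by (rule openin_trans_full[OF _ chart_open[OF c]])
    qed
    then have "openin (top_of M) (\<Union>c\<in>atlas M. {x \<in> fst c. f x \<in> B})" by blast
    also have "(\<Union>c\<in>atlas M. {x \<in> fst c. f x \<in> B}) = {x \<in> pts M. f x \<in> B}"
      using charts_cover by blast
    finally show "openin (top_of M) {x \<in> pts M. f x \<in> B}" .
  qed auto
  then have "compactin euclideanreal (f ` pts M)"
    using assms(1) by (intro image_compactin) (auto simp: compact_manifold_def compact_space_def)
  then have "compact (f ` pts M)" by simp
  then obtain y where "y \<in> f ` pts M" "\<And>x. x \<in> f ` pts M \<Longrightarrow> x \<le> y"
    using compact_attains_sup[of "f ` pts M"] assms(2) by auto
  then show thesis using that by auto
qed

end

context riem_map
begin

text \<open>At a maximum \<open>p\<close> of \<open>|V|\<^sup>2\<close> the first derivatives of \<open>|V|\<^sup>2\<close> vanish and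
  \<open>X (X |V|\<^sup>2) = 2 \<langle>\<nabla>\<^sub>X \<nabla>\<^sub>X V, V\<rangle> + 2 |\<nabla>\<^sub>X V|\<^sup>2\<close> is nonpositive.\<close>

lemma second_derivative_at_max:
  assumes W: "openin (top_of M) W" and V: "smooth_section W V" and X: "smooth_vector_field_on M W X"
    and p: "p \<in> W" and max: "\<And>q. q \<in> W \<Longrightarrow> rmetric N (\<phi> q) (V q) (V q) \<le> rmetric N (\<phi> p) (V p) (V p)"
  shows "v \<in> tangent_space M p \<Longrightarrow> rmetric N (\<phi> p) (nabla_pb M N \<phi> p v V) (V p) = 0"
    and "rmetric N (\<phi> p) (nabla_pb M N \<phi> p (X p) (\<lambda>q. nabla_pb M N \<phi> q (X q) V)) (V p) \<le> 0"
proof -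
  define f where "f q = rmetric N (\<phi> q) (V q) (V q)" for q
  define k where "k q = rmetric N (\<phi> q) (nabla_pb M N \<phi> q (X q) V) (V q)" for q
  have pM: "q \<in> pts M" if "q \<in> W" for q using that openin_subset[OF W] by auto
  obtain c where c: "c \<in> charts_at M p" using M.chart_at[OF pM[OF p]] by blast
  note atl = charts_atlas(1)[OF c]
  define T where "T = snd c ` (fst c \<inter> W)"
  have T: "open T" "snd c p \<in> T"
    using M.chart_image_open[OF atl W] M.charts_atD[OF c] p by (auto simp: T_def)
  have T_cases: "\<exists>q. z = snd c q \<and> q \<in> W \<and> c \<in> charts_at M q \<and> inv_chart c z = q" if "z \<in> T" for z
    using that atl by (auto simp: T_def M.charts_atI M.inv_chart_left)
  have inv_p: "inv_chart c (snd c p) = p" using M.charts_atD[OF c] by (simp add: M.inv_chart_left)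
  have f_smooth: "smooth_on T (\<lambda>z. f (inv_chart c z))"
    unfolding f_def T_def by (rule smooth_section_inner[OF W V V atl])
  have X_smooth: "smooth_on T (\<lambda>z. X (inv_chart c z) c)"
    using X atl unfolding T_def smooth_vector_field_on_def by blast
  note V' = smooth_section_nabla_pb[OF W V X]
  have k_smooth: "smooth_on T (\<lambda>z. k (inv_chart c z))"
    unfolding k_def T_def by (rule smooth_section_inner[OF W V' V atl])
  have max_T: "f (inv_chart c z) \<le> f (inv_chart c (snd c p))" if "z \<in> T" for z
    using T_cases[OF that] max inv_p by (auto simp: f_def)
  have deriv: "D (\<lambda>z. f (inv_chart c z)) (snd c q) (v c) = 2 * rmetric N (\<phi> q) (nabla_pb M N \<phi> q v V) (V q)"
    if q: "q \<in> W" "c \<in> charts_at M q" and v: "v \<in> tangent_space M q" for q v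
  proof -
    have "snd c q \<in> T" using q M.charts_atD[OF q(2)] by (auto simp: T_def)
    then have "D (\<lambda>z. f (inv_chart c z)) (snd c q) (v c) = dir_deriv M q v f"
      by (intro M.dir_deriv_chart[OF q(2) v, symmetric] smooth_on_differentiable[OF f_smooth T(1)])
    also have "\<dots> = rmetric N (\<phi> q) (nabla_pb M N \<phi> q v V) (V q) + rmetric N (\<phi> q) (V q) (nabla_pb M N \<phi> q v V)"
      unfolding f_def by (rule dir_deriv_inner[OF W V V q(1) v])
    finally show ?thesis
      using N.rmetric_sym[OF nabla_pb_tangent[OF W V q(1) v] smooth_section_tangent[OF V q(1)] map_pts[OF pM[OF q(1)]]]
      by simp
  qed
  show "rmetric N (\<phi> p) (nabla_pb M N \<phi> p v V) (V p) = 0" if v: "v \<in> tangent_space M p"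
    using deriv[OF p c v] D_zero_at_max[OF T(1) f_smooth T(2) max_T] by simp
  have "D (\<lambda>z. 2 * k (inv_chart c z)) (snd c p)
      = D (\<lambda>z. D (\<lambda>z. f (inv_chart c z)) z (X (inv_chart c z) c)) (snd c p)"
  proof (rule D_cong_open(1)[OF T])
    fix z assume "z \<in> T"
    then obtain q where q: "z = snd c q" "q \<in> W" "c \<in> charts_at M q" "inv_chart c z = q"
      using T_cases by blast
    then show "D (\<lambda>z. f (inv_chart c z)) z (X (inv_chart c z) c) = 2 * k (inv_chart c z)"
      using deriv[OF q(2,3) vector_field_tangent[OF X q(2)]] by (simp add: k_def)
  next
    show "(\<lambda>z. D (\<lambda>z. f (inv_chart c z)) z (X (inv_chart c z) c)) differentiable (at (snd c p))"
      by (rule smooth_on_differentiable[OF smooth_on_D_arg[OF T(1) f_smooth X_smooth] T])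
  qed
  then have "D (\<lambda>z. 2 * k (inv_chart c z)) (snd c p) (X (inv_chart c (snd c p)) c) \<le> 0"
    using D_D_nonpos_at_max[OF T(1) f_smooth T(2) max_T X_smooth] by simp
  moreover have k_diff: "(\<lambda>z. k (inv_chart c z)) differentiable (at (snd c p))"
    by (rule smooth_on_differentiable[OF k_smooth T])
  ultimately have "D (\<lambda>z. k (inv_chart c z)) (snd c p) (X p c) \<le> 0"
    by (simp add: D_bounded_linear[OF bounded_linear_mult_right k_diff] inv_p)
  also have "D (\<lambda>z. k (inv_chart c z)) (snd c p) (X p c) = dir_deriv M p (X p) k"
    by (rule M.dir_deriv_chart[OF c vector_field_tangent[OF X p] k_diff, symmetric])
  also have "\<dots> = rmetric N (\<phi> p) (nabla_pb M N \<phi> p (X p) (\<lambda>q. nabla_pb M N \<phi> q (X q) V)) (V p)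
      + rmetric N (\<phi> p) (nabla_pb M N \<phi> p (X p) V) (nabla_pb M N \<phi> p (X p) V)"
    unfolding k_def by (rule dir_deriv_inner[OF W V' V p vector_field_tangent[OF X p]])
  finally show "rmetric N (\<phi> p) (nabla_pb M N \<phi> p (X p) (\<lambda>q. nabla_pb M N \<phi> q (X q) V)) (V p) \<le> 0"
    using N.rmetric_nonneg[OF map_pts[OF pM[OF p]] nabla_pb_tangent[OF W V p vector_field_tangent[OF X p]]]
    by simp
qed

text \<open>In \<open>\<langle>\<Delta>V, V\<rangle>\<close> the first-order terms \<open>\<langle>\<nabla>\<^bsub>\<nabla>\<^sub>e e\<^esub> V, V\<rangle>\<close> vanish at a critical point of \<open>|V|\<^sup>2\<close>.\<close>

lemma connection_laplacian_at_max:
  assumes V: "smooth_section (pts M) V" and p: "p \<in> pts M"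
    and max: "\<And>q. q \<in> pts M \<Longrightarrow> rmetric N (\<phi> q) (V q) (V q) \<le> rmetric N (\<phi> p) (V p) (V p)"
  shows "rmetric N (\<phi> p) (connection_laplacian M N \<phi> V p) (V p) \<le> 0"
proof -
  define e where "e = frame M p"
  obtain W where W: "openin (top_of M) W" "p \<in> W" "\<And>\<alpha>. smooth_vector_field_on M W (e \<alpha>)"
    using M.frame[OF p] unfolding local_orthonormal_frame_def e_def by blast
  have WM: "W \<subseteq> pts M" using openin_subset[OF W(1)] .
  note VW = smooth_section_subset[OF V WM]
  note Vp = smooth_section_tangent[OF V p]
  define A where "A \<alpha> = nabla_pb M N \<phi> p (e \<alpha> p) (\<lambda>q. nabla_pb M N \<phi> q (e \<alpha> q) V)" for \<alpha>
  define B where "B \<alpha> = nabla_pb M N \<phi> p (nabla_field M (e \<alpha>) (e \<alpha>) p) V" for \<alpha>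
  have nab: "nabla_field M (e \<alpha>) (e \<alpha>) p \<in> tangent_space M p" for \<alpha>
    by (rule vector_field_tangent[OF M.smooth_nabla_field[OF W(1,3,3)] W(2)])
  have tan: "A \<alpha> \<in> tangent_space N (\<phi> p)" "B \<alpha> \<in> tangent_space N (\<phi> p)" for \<alpha>
    unfolding A_def B_def
    by (intro nabla_pb_tangent[OF W(1) smooth_section_nabla_pb[OF W(1) VW W(3)] W(2)]
          nabla_pb_tangent[OF W(1) VW W(2)] vector_field_tangent[OF W(3,2)] nab)+
  have "connection_laplacian M N \<phi> V p = (\<lambda>d. \<Sum>\<alpha>\<in>UNIV. A \<alpha> d - B \<alpha> d)"
    by (simp add: connection_laplacian_def Let_def A_def B_def e_def)
  then have "rmetric N (\<phi> p) (connection_laplacian M N \<phi> V p) (V p)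
      = (\<Sum>\<alpha>\<in>UNIV. rmetric N (\<phi> p) (\<lambda>d. A \<alpha> d - B \<alpha> d) (V p))"
    by (simp add: N.rmetric_sum_left[OF map_pts[OF p] N.tangent_diff[OF tan] Vp])
  also have "\<dots> = (\<Sum>\<alpha>\<in>UNIV. rmetric N (\<phi> p) (A \<alpha>) (V p) - rmetric N (\<phi> p) (B \<alpha>) (V p))"
    by (simp add: N.rmetric_diff_left[OF map_pts[OF p] tan Vp])
  also have "\<dots> \<le> 0"
  proof (rule sum_nonpos)
    fix \<alpha> :: 'm
    note at_max = second_derivative_at_max[OF W(1) VW W(3)[of \<alpha>] W(2)]
    have "rmetric N (\<phi> p) (A \<alpha>) (V p) \<le> 0"
      unfolding A_def using max WM by (intro at_max(2)) auto
    moreover have "rmetric N (\<phi> p) (B \<alpha>) (V p) = 0"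
      unfolding B_def using max WM nab by (intro at_max(1)) auto
    ultimately show "rmetric N (\<phi> p) (A \<alpha>) (V p) - rmetric N (\<phi> p) (B \<alpha>) (V p) \<le> 0" by simp
  qed
  finally show ?thesis .
qed

section \<open>Interpolating sesqui-harmonic maps\<close>

lemma rmetric_curvature_term:
  fixes V :: "'a \<Rightarrow> ('b, 'n) tvec"
  assumes p: "p \<in> pts M" and V: "V p \<in> tangent_space N (\<phi> p)"
  defines "x \<equiv> \<lambda>\<alpha>. differential M N \<phi> p (frame M p \<alpha> p)"
  shows "x \<alpha> \<in> tangent_space N (\<phi> p)"
    and "rmetric N (\<phi> p) (curvature_term M N \<phi> V p) (V p)
      = (\<Sum>\<alpha>\<in>UNIV. rmetric N (\<phi> p) (curvature N (\<phi> p) (x \<alpha>) (V p) (x \<alpha>)) (V p))"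
    and "curvature_term M N \<phi> V p \<in> tangent_space N (\<phi> p)"
proof -
  show x: "x \<alpha> \<in> tangent_space N (\<phi> p)" for \<alpha>
    unfolding x_def using M.frame_orthonormal[OF p] p
    by (intro differential_tangent) (auto simp: orthonormal_basis_at_def)
  note tan = N.curvature(1)[OF map_pts[OF p] x V]
  have eq: "curvature_term M N \<phi> V p = (\<lambda>d. \<Sum>\<alpha>\<in>UNIV. curvature N (\<phi> p) (x \<alpha>) (V p) (x \<alpha>) d)"
    by (simp add: curvature_term_def Let_def x_def)
  show "rmetric N (\<phi> p) (curvature_term M N \<phi> V p) (V p)
      = (\<Sum>\<alpha>\<in>UNIV. rmetric N (\<phi> p) (curvature N (\<phi> p) (x \<alpha>) (V p) (x \<alpha>)) (V p))"
    unfolding eq by (rule N.rmetric_sum_left[OF map_pts[OF p] tan V])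
  show "curvature_term M N \<phi> V p \<in> tangent_space N (\<phi> p)"
    unfolding eq by (rule N.tangent_sum[OF tan])
qed

text \<open>Pairing the equation with \<open>\<tau>\<close> at a maximum of \<open>|\<tau>|\<^sup>2\<close> makes the expression in \<open>pos\<close> equal to
  \<open>\<langle>\<Delta>\<tau>, \<tau>\<rangle> \<le> 0\<close>, so \<open>\<tau>\<close> is zero there and therefore on all of \<open>M\<close>.\<close>

lemma sesqui_harmonic_imp_harmonic:
  assumes compact: "compact_manifold M" and sesqui: "sesqui_harmonic \<delta>1 \<delta>2 M N \<phi>" and "\<delta>2 \<noteq> 0"
    and pos: "\<And>p. p \<in> pts M \<Longrightarrow> tension M N \<phi> p \<noteq> (\<lambda>d. 0) \<Longrightarrow>
      rmetric N (\<phi> p) (curvature_term M N \<phi> (tension M N \<phi>) p) (tension M N \<phi> p)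
        + \<delta>1 / \<delta>2 * rmetric N (\<phi> p) (tension M N \<phi> p) (tension M N \<phi> p) > 0"
  shows "harmonic M N \<phi>"
proof (cases "pts M = {}")
  case True
  then show ?thesis by (simp add: harmonic_def)
next
  case False
  define \<tau> where "\<tau> = tension M N \<phi>"
  define f where "f q = rmetric N (\<phi> q) (\<tau> q) (\<tau> q)" for q
  have \<tau>: "smooth_section (pts M) \<tau>" unfolding \<tau>_def by (rule smooth_section_tension)
  have "continuous_on (snd c ` fst c) (\<lambda>z. f (inv_chart c z))" if c: "c \<in> atlas M" for c
  proof -
    have "fst c \<inter> pts M = fst c" using M.chart_subset[OF c] by blast
    then show ?thesis
      using smooth_on_continuous[OF smooth_section_inner[OF openin_topspace \<tau> \<tau> c]] by (simp add: f_def)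
  qed
  then obtain p where p: "p \<in> pts M" "\<And>q. q \<in> pts M \<Longrightarrow> f q \<le> f p"
    using M.attains_max[OF compact False, of f] by blast
  note \<tau>p = smooth_section_tangent[OF \<tau> p(1)]
  note C = rmetric_curvature_term(3)[where V = \<tau>, OF p(1) \<tau>p]
  have "\<delta>2 *\<^sub>R connection_laplacian M N \<phi> \<tau> p d = \<delta>2 *\<^sub>R curvature_term M N \<phi> \<tau> p d + \<delta>1 *\<^sub>R \<tau> p d" for d
    using sesqui p(1) unfolding sesqui_harmonic_def \<tau>_def by metis
  then have "(1 / \<delta>2) *\<^sub>R (\<delta>2 *\<^sub>R connection_laplacian M N \<phi> \<tau> p d)
      = (1 / \<delta>2) *\<^sub>R (\<delta>2 *\<^sub>R curvature_term M N \<phi> \<tau> p d + \<delta>1 *\<^sub>R \<tau> p d)" for d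
    by simp
  then have "connection_laplacian M N \<phi> \<tau> p = (\<lambda>d. 1 *\<^sub>R curvature_term M N \<phi> \<tau> p d + (\<delta>1 / \<delta>2) *\<^sub>R \<tau> p d)"
    using \<open>\<delta>2 \<noteq> 0\<close> by (simp add: scaleR_add_right fun_eq_iff)
  moreover have "rmetric N (\<phi> p) (connection_laplacian M N \<phi> \<tau> p) (\<tau> p) \<le> 0"
    using p by (intro connection_laplacian_at_max[OF \<tau>]) (auto simp: f_def)
  ultimately have "rmetric N (\<phi> p) (curvature_term M N \<phi> \<tau> p) (\<tau> p) + \<delta>1 / \<delta>2 * f p \<le> 0"
    by (simp only: N.rmetric_lin[OF C \<tau>p \<tau>p map_pts[OF p(1)]] f_def mult_1)
  then have "\<tau> p = (\<lambda>d. 0)"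
    using pos[OF p(1)] unfolding \<tau>_def[symmetric] f_def by force
  then have "f p = 0"
    using N.rmetric_lin[OF N.tangent_zero N.tangent_zero N.tangent_zero map_pts[OF p(1)], of 0 0]
    by (simp add: f_def)
  have "\<tau> q = (\<lambda>d. 0)" if q: "q \<in> pts M" for q
    using N.rmetric_pos[OF smooth_section_tangent[OF \<tau> q] map_pts[OF q]] p(2)[OF q] \<open>f p = 0\<close>
    by (force simp: f_def)
  then show ?thesis by (simp add: harmonic_def \<tau>_def)
qed

text \<open>Moving \<open>V\<close> from the last slot to the third changes the sign: each summand is minus a sectional
  curvature, up to normalisation.\<close>

lemma curvature_term_nonneg:
  assumes K: "nonpositive_sectional_curvature N" and p: "p \<in> pts M" and V: "V p \<in> tangent_space N (\<phi> p)"
  shows "rmetric N (\<phi> p) (curvature_term M N \<phi> V p) (V p) \<ge> 0"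
  unfolding rmetric_curvature_term(2)[where V = V, OF p V]
proof (rule sum_nonneg)
  fix \<alpha> :: 'm
  note x = rmetric_curvature_term(1)[where V = V, OF p V, of \<alpha>]
  show "rmetric N (\<phi> p) (curvature N (\<phi> p) (differential M N \<phi> p (frame M p \<alpha> p)) (V p)
      (differential M N \<phi> p (frame M p \<alpha> p))) (V p) \<ge> 0"
    using N.curvature_skew[OF map_pts[OF p] x V x V] N.nonpositive_curvature_all_pairs[OF K map_pts[OF p] x V]
    by simp
qed

lemma curvature_term_lower_bound:
  assumes p: "p \<in> pts M" and V: "V p \<in> tangent_space N (\<phi> p)"
  shows "rmetric N (\<phi> p) (curvature_term M N \<phi> V p) (V p)
    \<ge> - (curvature_norm N (\<phi> p) * energy_density M N \<phi> p / sqrt 2 * rmetric N (\<phi> p) (V p) (V p))"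
proof -
  define x where "x \<alpha> = differential M N \<phi> p (frame M p \<alpha> p)" for \<alpha>
  note x = rmetric_curvature_term(1)[where V = V, OF p V, folded x_def]
  have "(\<Sum>\<alpha>\<in>UNIV. - (rmetric N (\<phi> p) (x \<alpha>) (x \<alpha>) * rmetric N (\<phi> p) (V p) (V p) / sqrt 2 * curvature_norm N (\<phi> p)))
      \<le> (\<Sum>\<alpha>\<in>UNIV. rmetric N (\<phi> p) (curvature N (\<phi> p) (x \<alpha>) (V p) (x \<alpha>)) (V p))"
    using N.curvature_norm_bound[OF map_pts[OF p] x V] by (intro sum_mono) (smt (verit))
  also have "\<dots> = rmetric N (\<phi> p) (curvature_term M N \<phi> V p) (V p)"
    using rmetric_curvature_term(2)[where V = V, OF p V, folded x_def] by simp
  also have "(\<Sum>\<alpha>\<in>UNIV. - (rmetric N (\<phi> p) (x \<alpha>) (x \<alpha>) * rmetric N (\<phi> p) (V p) (V p) / sqrt 2 * curvature_norm N (\<phi> p)))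
      = - (curvature_norm N (\<phi> p) * energy_density M N \<phi> p / sqrt 2 * rmetric N (\<phi> p) (V p) (V p))"
    by (simp add: energy_density_def Let_def x_def sum_negf sum_distrib_left sum_distrib_right
        sum_divide_distrib mult_ac)
  finally show ?thesis .
qed

end

theorem proposition4p3:
  fixes M :: "('a, 'm::finite) riem" and N :: "('b, 'n::finite) riem"
    and \<phi> :: "'a \<Rightarrow> 'b" and \<delta>1 \<delta>2 :: real
  assumes "riemannian_manifold M" and "compact_manifold M"
    and "riemannian_manifold N"
    and "sesqui_harmonic \<delta>1 \<delta>2 M N \<phi>"
  shows "(nonpositive_sectional_curvature N \<and> \<delta>1 * \<delta>2 > 0 \<longrightarrow> harmonic M N \<phi>) \<and>
    (curvature_bounded N \<and> curvature_sup_norm N > 0 \<and>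
       (\<forall>p\<in>pts M. energy_density M N \<phi> p \<le> \<delta>1 / (curvature_sup_norm N * \<delta>2)) \<and>
       \<delta>1 * \<delta>2 > 0 \<longrightarrow> harmonic M N \<phi>)"
proof -
  interpret riem_map M N \<phi>
    using assms by unfold_locales (auto simp: sesqui_harmonic_def)
  define \<tau> where "\<tau> = tension M N \<phi>"
  have \<tau>: "\<tau> p \<in> tangent_space N (\<phi> p)" if "p \<in> pts M" for p
    unfolding \<tau>_def by (rule smooth_section_tangent[OF smooth_section_tension that])
  have \<tau>_pos: "rmetric N (\<phi> p) (\<tau> p) (\<tau> p) > 0" if "p \<in> pts M" "\<tau> p \<noteq> (\<lambda>d. 0)" for p
    by (rule N.rmetric_pos[OF \<tau>[OF that(1)] map_pts[OF that(1)] that(2)])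
  note harmonicI = sesqui_harmonic_imp_harmonic[OF assms(2,4), folded \<tau>_def]
  show ?thesis
  proof (intro conjI impI; elim conjE)
    assume K: "nonpositive_sectional_curvature N" and \<delta>: "\<delta>1 * \<delta>2 > 0"
    then have ratio: "\<delta>1 / \<delta>2 > 0" by (auto simp: zero_less_mult_iff zero_less_divide_iff)
    show "harmonic M N \<phi>"
    proof (rule harmonicI)
      show "\<delta>2 \<noteq> 0" using \<delta> by auto
      fix p assume p: "p \<in> pts M" "\<tau> p \<noteq> (\<lambda>d. 0)"
      show "rmetric N (\<phi> p) (curvature_term M N \<phi> \<tau> p) (\<tau> p) + \<delta>1 / \<delta>2 * rmetric N (\<phi> p) (\<tau> p) (\<tau> p) > 0"
        using curvature_term_nonneg[where V = \<tau>, OF K p(1) \<tau>[OF p(1)]] mult_pos_pos[OF ratio \<tau>_pos[OF p]]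
        by linarith
    qed
  next
    assume bdd: "curvature_bounded N" and S: "curvature_sup_norm N > 0"
      and energy: "\<forall>p\<in>pts M. energy_density M N \<phi> p \<le> \<delta>1 / (curvature_sup_norm N * \<delta>2)"
      and \<delta>: "\<delta>1 * \<delta>2 > 0"
    then have ratio: "\<delta>1 / \<delta>2 > 0" by (auto simp: zero_less_mult_iff zero_less_divide_iff)
    show "harmonic M N \<phi>"
    proof (rule harmonicI)
      show "\<delta>2 \<noteq> 0" using \<delta> by auto
      fix p assume p: "p \<in> pts M" "\<tau> p \<noteq> (\<lambda>d. 0)"
      let ?E = "energy_density M N \<phi> p" and ?t = "rmetric N (\<phi> p) (\<tau> p) (\<tau> p)"
      have "curvature_norm N (\<phi> p) \<le> curvature_sup_norm N"
        using bdd map_pts[OF p(1)] unfolding curvature_bounded_def curvature_sup_norm_def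
        by (intro cSUP_upper) auto
      moreover have "?E \<ge> 0"
        unfolding energy_density_def Let_def
        by (intro sum_nonneg N.rmetric_nonneg map_pts p(1) rmetric_curvature_term(1)[where V = \<tau>] \<tau>)
      ultimately have "curvature_norm N (\<phi> p) * ?E \<le> curvature_sup_norm N * ?E"
        by (rule mult_right_mono)
      also have "\<dots> \<le> curvature_sup_norm N * (\<delta>1 / (curvature_sup_norm N * \<delta>2))"
        using energy p(1) S by (intro mult_left_mono) auto
      also have "\<dots> = \<delta>1 / \<delta>2" using S by simp
      finally have "curvature_norm N (\<phi> p) * ?E / sqrt 2 \<le> \<delta>1 / \<delta>2 / sqrt 2"
        by (rule divide_right_mono) simp
      \<comment> \<open>the gain from skewness: \<open>\<surd>2 > 1\<close> makes the estimate strict\<close>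
      also have "\<dots> < \<delta>1 / \<delta>2"
        using divide_strict_left_mono[of 1 "sqrt 2" "\<delta>1 / \<delta>2"] ratio by simp
      finally have "curvature_norm N (\<phi> p) * ?E / sqrt 2 * ?t < \<delta>1 / \<delta>2 * ?t"
        by (rule mult_strict_right_mono[OF _ \<tau>_pos[OF p]])
      then show "rmetric N (\<phi> p) (curvature_term M N \<phi> \<tau> p) (\<tau> p) + \<delta>1 / \<delta>2 * ?t > 0"
        using curvature_term_lower_bound[where V = \<tau>, OF p(1) \<tau>[OF p(1)]] by linarith
    qed
  qed
qed

end
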